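(* Let $c=(c_l)_{l\ge 1}$ be a sequence of positive real numbers and let $n$ be a positive integer. Then there exists a constant $K$ (depending only on $c$ and $n$) such that for all $\delta\ge 0$, all positive integers $q$ and every function $\psi:S_q\to\mathbb C$ belonging to $\mathcal F^n_{c,\delta}$, the function $\psi$ is $(\delta+q^{-1})^{1/2}$-supported by the set of Young diagrams $\lambda\in\mathcal Y_q$ satisfying $$|m_l(\lambda)-m_l(\psi)|\le K(\delta+q^{-1})^{1/4}q^{l/2}\qquad\text{for all integers } 1\le l\le n/2 .$$
   Context: **Symmetric groups.** $S_q$ is the symmetric group on $\{1,\dots,q\}$. For $\sigma\in S_q$, $c(\sigma)$ is its number of cycles (fixed points included) and $|\sigma|=q-c(\sigma)$, the minimal number of transpositions whose product is $\sigma$. The support of $\sigma$ is the set of points not fixed by it. $\mathcal Y_q$ is the set of Young diagrams with $q$ boxes; for $\lambda\in\mathcal Y_q$, $\chi_\lambda$ is the normalized ($\chi_\lambda(e)=1$) irreducible character of $S_q$ associated with $\lambda$. **Positive definite functions.** Let $\psi:S_q\to\mathbb C$ be a central (constant on conjugacy classes), positive definite function, normalized by $\psi(e)=1$. Write $\psi=\sum_{\lambda\in\mathcal Y_q}p_\lambda\chi_\lambda$ with $p_\lambda\ge 0$, $\sum_\lambda p_\lambda=1$ (this expansion exists and is unique), and let $\Pi_\psi$ be the probability measure on $\mathcal Y_q$ with $\Pi_\psi(\{\lambda\})=p_\lambda$. For $\mathcal V\subset\mathcal Y_q$ and $\gamma>0$, $\psi$ is called $\gamma$-supported on (or by) $\mathcal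 V$ if $\Pi_\psi(\mathcal V)>1-\gamma$. **The class $\mathcal F^n_{c,\delta}$.** For a positive integer $n$, a sequence $c=(c_l)_{l\ge1}$ of positive reals and $\delta\ge 0$, $\mathcal F^n_{c,\delta}$ is the set of all central positive definite normalized functions $\psi:S_q\to\mathbb C$, for some positive integer $q$, such that (1) $|\psi(\rho)|\le c_l q^{-l/2}$ for all $l\le n$ and all $\rho\in S_q$ with $|\rho|=l$; (2) $|\psi(\rho\sigma)-\psi(\rho)\psi(\sigma)|\le\delta q^{-l/2}$ for all $l\le n$ and all $\rho,\sigma\in S_q$ with disjoint supports such that $|\rho\sigma|=l$. (In (1), $l$ ranges over $1\le l\le n$.) **Transition measures and moments.** A Young diagram $\lambda$ is identified with a function $\omega:\mathbb R\to\mathbb R$: put the box in row $i$, column $j$ at $[j-1,j]\times[i-1,i]$ in coordinates $(s,t)$ ($s$ along columns, $t$ along rows), change coordinates to $u=s-t$, $v=s+t$, and let $\omega$ be the upper boundary of the resulting region, extended by $\omega(u)=|u|$ elsewhere. This is a piecewise linear function with slopes $\pm1$ and local extrema at integer points. The transition measure $\mathfrak m_\lambda$ of $\lambda$ is the compactly supported probability measure on $\mathbb R$ determined by $$\frac1z\exp\int_{\mathbb R}\frac{1}{x-z}\,\sigma'(x)\,dx=\int_{\mathbb R}\frac{1}{z-x}\,\mathfrak m_\lambda(dx),\qquad z\in\mathbb C\setminus\mathbb R,\quad \sigma(u)=\tfrac12(\omega(u)-|u|).$$ Its moments are $m_l(\lambda)=\int x^l\,\mathfrak m_\lambda(dx)$.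 For a central positive definite function $\psi:S_q\to\mathbb C$ with $\psi(e)=1$ and expansion $\psi=\sum_{\lambda\in\mathcal Y_q}p_\lambda\chi_\lambda$ ($p_\lambda\ge0$, $\sum_\lambda p_\lambda=1$), $\mathfrak m_\psi=\sum_\lambda p_\lambda\mathfrak m_\lambda$ and $m_l(\psi)=\sum_\lambda p_\lambda m_l(\lambda)$ are the corresponding measure and moments. *)

theory Defs
  imports
    "HOL-Probability.Probability"
    "HOL-Combinatorics.Combinatorics"
    "HOL-Library.Function_Algebras"
begin

section \<open>Permutations\<close>

text \<open>
  A permutation of \<open>{1..q}\<close> is a function \<open>\<sigma> :: nat \<Rightarrow> nat\<close> with \<open>\<sigma> permutes {1..q}\<close>.  A complex
  function on the symmetric group is a HOL function on \<open>nat \<Rightarrow> nat\<close>; only its values at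
  permutations of \<open>{1..q}\<close> are ever used.
\<close>

definition sym_group :: "nat \<Rightarrow> (nat \<Rightarrow> nat) set" where
  "sym_group q = {\<sigma>. \<sigma> permutes {1..q}}"

definition num_cycles :: "nat \<Rightarrow> (nat \<Rightarrow> nat) \<Rightarrow> nat" where
  "num_cycles q \<sigma> = card (orbit \<sigma> ` {1..q})"

definition perm_length :: "nat \<Rightarrow> (nat \<Rightarrow> nat) \<Rightarrow> nat" where
  "perm_length q \<sigma> = q - num_cycles q \<sigma>"

definition perm_support :: "(nat \<Rightarrow> nat) \<Rightarrow> nat set" where
  "perm_support \<sigma> = {i. \<sigma> i \<noteq> i}"


section \<open>Young diagrams and Specht modules\<close>

text \<open>A diagram is its set of boxes (row, column), with rows and columns counted from 1.\<close>

type_synonym diagram = "(nat \<times> nat) set"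

definition young_diagrams :: "nat \<Rightarrow> diagram set" where
  "young_diagrams q = {D. finite D \<and> card D = q \<and>
     (\<forall>(i, j) \<in> D. 1 \<le> i \<and> 1 \<le> j \<and> (\<forall>i' \<in> {1..i}. \<forall>j' \<in> {1..j}. (i', j') \<in> D))}"

definition tableaux :: "diagram \<Rightarrow> (nat \<times> nat \<Rightarrow> nat) set" where
  "tableaux D = {t. bij_betw t D {1..card D}}"

definition row_entries :: "diagram \<Rightarrow> (nat \<times> nat \<Rightarrow> nat) \<Rightarrow> nat \<Rightarrow> nat set" where
  "row_entries D t i = t ` {b \<in> D. fst b = i}"

definition column_entries :: "diagram \<Rightarrow> (nat \<times> nat \<Rightarrow> nat) \<Rightarrow> nat \<Rightarrow> nat set" where
  "column_entries D t j = t ` {b \<in> D. snd b = j}"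

text \<open>
  The tabloid of a tableau (the tableau up to permutations within its rows) is encoded by the
  function sending each row index to the set of entries of that row, i.e. by \<open>row_entries D t\<close>.
  Formal combinations of tabloids are complex functions on tabloids.
\<close>

type_synonym tabloid = "nat \<Rightarrow> nat set"

definition column_group :: "diagram \<Rightarrow> (nat \<times> nat \<Rightarrow> nat) \<Rightarrow> (nat \<Rightarrow> nat) set" where
  "column_group D t =
     {\<pi> \<in> sym_group (card D). \<forall>j. \<pi> ` column_entries D t j = column_entries D t j}"

definition polytabloid :: "diagram \<Rightarrow> (nat \<times> nat \<Rightarrow> nat) \<Rightarrow> tabloid \<Rightarrow> complex" where
  "polytabloid D t T =
     (\<Sum>\<pi> \<in> column_group D t. if row_entries D (\<pi> \<circ> t) = T then of_int (sign \<pi>) else 0)"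

definition fun_scale :: "complex \<Rightarrow> ('a \<Rightarrow> complex) \<Rightarrow> 'a \<Rightarrow> complex" where
  "fun_scale a f = (\<lambda>x. a * f x)"

global_interpretation cfun: vector_space "fun_scale :: complex \<Rightarrow> ('a \<Rightarrow> complex) \<Rightarrow> 'a \<Rightarrow> complex"
  by unfold_locales (auto simp: fun_scale_def algebra_simps)

definition specht :: "diagram \<Rightarrow> (tabloid \<Rightarrow> complex) set" where
  "specht D = cfun.span (polytabloid D ` tableaux D)"

text \<open>The linear action that sends (the indicator of) a tabloid \<open>T\<close> to \<open>\<sigma> T\<close>.\<close>

definition perm_action :: "(nat \<Rightarrow> nat) \<Rightarrow> (tabloid \<Rightarrow> complex) \<Rightarrow> tabloid \<Rightarrow> complex" where
  "perm_action \<sigma> f = (\<lambda>T. f (\<lambda>i. inv \<sigma> ` T i))"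

text \<open>
  Trace of a linear map \<open>A\<close> that preserves a finite-dimensional subspace \<open>V\<close>; it does not depend on
  the chosen basis.
\<close>

definition trace_on :: "('a \<Rightarrow> complex) set \<Rightarrow> (('a \<Rightarrow> complex) \<Rightarrow> 'a \<Rightarrow> complex) \<Rightarrow> complex" where
  "trace_on V A =
     (let B = (SOME B. B \<subseteq> V \<and> cfun.independent B \<and> cfun.span B = V)
      in \<Sum>b \<in> B. cfun.representation B (A b) b)"

definition norm_character :: "diagram \<Rightarrow> (nat \<Rightarrow> nat) \<Rightarrow> complex" where
  "norm_character D \<sigma> = trace_on (specht D) (perm_action \<sigma>) / of_nat (cfun.dim (specht D))"


section \<open>Positive definite functions\<close>

definition central :: "nat \<Rightarrow> ((nat \<Rightarrow> nat) \<Rightarrow> complex) \<Rightarrow> bool" where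
  "central q \<psi> \<longleftrightarrow> (\<forall>\<sigma> \<in> sym_group q. \<forall>\<tau> \<in> sym_group q. \<psi> (\<tau> \<circ> \<sigma> \<circ> inv \<tau>) = \<psi> \<sigma>)"

definition positive_definite :: "nat \<Rightarrow> ((nat \<Rightarrow> nat) \<Rightarrow> complex) \<Rightarrow> bool" where
  "positive_definite q \<psi> \<longleftrightarrow>
     (\<forall>z :: (nat \<Rightarrow> nat) \<Rightarrow> complex.
        (\<Sum>\<sigma> \<in> sym_group q. \<Sum>\<tau> \<in> sym_group q. z \<sigma> * cnj (z \<tau>) * \<psi> (inv \<tau> \<circ> \<sigma>)) \<in> \<real>\<^sub>\<ge>\<^sub>0)"

text \<open>
  The coefficients \<open>p\<^sub>D\<close> in the expansion of \<open>\<psi>\<close> into normalized irreducible characters, extended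
  by 0 to sets of boxes that are not diagrams with \<open>q\<close> boxes.
\<close>

definition weights :: "nat \<Rightarrow> ((nat \<Rightarrow> nat) \<Rightarrow> complex) \<Rightarrow> diagram \<Rightarrow> real" where
  "weights q \<psi> = (THE p.
     (\<forall>D. 0 \<le> p D) \<and> (\<forall>D. D \<notin> young_diagrams q \<longrightarrow> p D = 0) \<and>
     (\<Sum>D \<in> young_diagrams q. p D) = 1 \<and>
     (\<forall>\<sigma> \<in> sym_group q.
        \<psi> \<sigma> = (\<Sum>D \<in> young_diagrams q. complex_of_real (p D) * norm_character D \<sigma>)))"

definition diagram_prob :: "nat \<Rightarrow> ((nat \<Rightarrow> nat) \<Rightarrow> complex) \<Rightarrow> diagram set \<Rightarrow> real" where
  "diagram_prob q \<psi> V = (\<Sum>D \<in> V. weights q \<psi> D)"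

definition supported_on :: "nat \<Rightarrow> ((nat \<Rightarrow> nat) \<Rightarrow> complex) \<Rightarrow> real \<Rightarrow> diagram set \<Rightarrow> bool" where
  "supported_on q \<psi> \<gamma> V \<longleftrightarrow> diagram_prob q \<psi> V > 1 - \<gamma>"

text \<open>
  The part of the class \<open>\<F>\<close> consisting of functions on the symmetric group of degree \<open>q\<close>; the
  degree is a parameter because it cannot be recovered from a HOL function.
\<close>

definition F_class ::
    "nat \<Rightarrow> (nat \<Rightarrow> real) \<Rightarrow> real \<Rightarrow> nat \<Rightarrow> ((nat \<Rightarrow> nat) \<Rightarrow> complex) set" where
  "F_class n c \<delta> q = {\<psi>. central q \<psi> \<and> positive_definite q \<psi> \<and> \<psi> id = 1 \<and>
     (\<forall>l \<in> {1..n}. \<forall>\<rho> \<in> sym_group q. perm_length q \<rho> = l \<longrightarrow>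
        norm (\<psi> \<rho>) \<le> c l * real q powr (- real l / 2)) \<and>
     (\<forall>l \<le> n. \<forall>\<rho> \<in> sym_group q. \<forall>\<sigma> \<in> sym_group q.
        perm_support \<rho> \<inter> perm_support \<sigma> = {} \<and> perm_length q (\<rho> \<circ> \<sigma>) = l \<longrightarrow>
        norm (\<psi> (\<rho> \<circ> \<sigma>) - \<psi> \<rho> * \<psi> \<sigma>) \<le> \<delta> * real q powr (- real l / 2))}"


section \<open>Transition measures\<close>

text \<open>Points of the region are pairs \<open>(s, t)\<close>, with \<open>s\<close> running along the column index.\<close>

definition region :: "diagram \<Rightarrow> (real \<times> real) set" where
  "region D = (\<Union>(i, j) \<in> D. {real j - 1..real j} \<times> {real i - 1..real i})"

text \<open>
  Since \<open>s + t \<ge> \<bar>s - t\<bar>\<close> on the region, adding \<open>\<bar>u\<bar>\<close> to the set changes the supremum only where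
  no point of the region lies above \<open>u\<close>.
\<close>

definition profile :: "diagram \<Rightarrow> real \<Rightarrow> real" where
  "profile D u = Sup (insert \<bar>u\<bar> {s + t | s t. (s, t) \<in> region D \<and> s - t = u})"

definition profile_sigma :: "diagram \<Rightarrow> real \<Rightarrow> real" where
  "profile_sigma D u = (profile D u - \<bar>u\<bar>) / 2"

text \<open>
  The derivative of \<open>profile_sigma D\<close> exists outside a finite set; the value of \<open>deriv\<close> on that set
  does not affect the integral.
\<close>

definition transition_measure :: "diagram \<Rightarrow> real measure" where
  "transition_measure D = (THE M.
     prob_space M \<and> sets M = sets borel \<and> (\<exists>C. compact C \<and> (AE x in M. x \<in> C)) \<and>
     (\<forall>z :: complex. z \<notin> \<real> \<longrightarrow>
        1 / z * exp (LINT x|lborel. 1 / (complex_of_real x - z)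
                                      * complex_of_real (deriv (profile_sigma D) x))
        = (LINT x|M. 1 / (z - complex_of_real x))))"

definition moment :: "nat \<Rightarrow> diagram \<Rightarrow> real" where
  "moment l D = (LINT x|transition_measure D. x ^ l)"

definition mean_moment :: "nat \<Rightarrow> nat \<Rightarrow> ((nat \<Rightarrow> nat) \<Rightarrow> complex) \<Rightarrow> real" where
  "mean_moment l q \<psi> = (\<Sum>D \<in> young_diagrams q. weights q \<psi> D * moment l D)"

end

(*
  The l-th moment of the transition measure of a diagram D with q boxes is the scalar by which the
  central element A_l = E(X^l) of the group algebra of S_q acts on the Specht module of D; here X is
  the sum of the transpositions (i, q+1), i <= q, and E discards the permutations that move q+1.
  Indeed, evaluation at the row reading tabloid is an eigenvector of all Jucys-Murphy elements, with
  the contents of the boxes as eigenvalues, and with s = (q, q+1), X = s Y s + s one has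
    (z - X)^-1 = s (z - Y)^-1 s + (z - Y)^-1 s (z - Y)^-1 + (z - Y)^-1 (z - X)^-1 (z - Y)^-1,
  so applying E multiplies the generating function by (z - c)^2 / ((z - c)^2 - 1) for a box of
  content c.  The profile of D is a sum of hat functions centred at the contents, which gives the
  same product for the Cauchy transform.

  The scalars of the A_l separate diagrams.  Hence the normalized characters are linearly independent,
  Lagrange interpolation in the A_l yields the projections that read off their coefficients, and as
  there are no more conjugacy classes than diagrams they span the class functions.

  Therefore the variance of the l-th moment under the measure of psi is psi(A_l^2) - psi(A_l)^2, a
  sum over pairs of words in star transpositions.  By the genus bound a pair with disjoint letters
  contributes at most delta q^(l - b), where b is the number of letters, and any other pair
  O(q^(l - b - 1)); summing over words gives O((delta + 1/q) q^l), and Chebyshev's inequality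
  concludes.
*)
theory Submission
  imports Defs "HOL-Complex_Analysis.Complex_Analysis" "HOL-Library.Poly_Mapping"
begin

hide_const (open) Finite_Cartesian_Product.transpose

section \<open>Cycle counts\<close>

text \<open>\<open>weights\<close> and \<open>transition_measure\<close> are definite descriptions,
  so existence and uniqueness of both must be settled before any moment can be computed; most of the
  development serves this. Scalars are read off at a single tabloid: a Specht vector vanishes
  outside the translates of the reading tabloid, so an equivariant operator is determined by its
  values there. Nonnegative coefficients come from choosing the interpolating elements self-adjoint.
  The extra factor 1/q for pairs of words with a common letter rests on giving the second word its
  own star point q + 2. This is possible because the products kept by E fix the star point; a shared
  letter then merges two orbits, and the genus bound gains one. With eps = delta + 1/q, a variance
  of at most B eps q^l and a squared threshold K^2 eps^(1/2) q^l leave probability (B / K^2)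
  eps^(1/2) for each l. This fixes the exponents 1/2 and 1/4, and K^2 = n B + 1 absorbs the at most
  n values of l.\<close>

lemma orbit_eq_of_mem:
  assumes "permutation p" "y \<in> orbit p x"
  shows "orbit p y = orbit p x"
  using assms by (meson orbit_swap orbit_trans permutation_self_in_orbit subsetI subset_antisym)

lemma permutation_comp_transpose:
  "permutation p \<Longrightarrow> permutation (p \<circ> transpose a b)"
  by (simp add: permutation_compose permutation_swap_id)

lemma orbit_comp_transpose_avoiding:
  assumes p: "permutation p" and "a \<notin> orbit p x" "b \<notin> orbit p x"
  shows "orbit (p \<circ> transpose a b) x = orbit p x"
proof (rule orbit_cong0[where A="orbit p x"])
  show "x \<in> orbit p x" using p by (rule permutation_self_in_orbit)
  show "p \<circ> transpose a b \<in> orbit p x \<rightarrow> orbit p x"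
    using assms by (auto simp: Transposition.transpose_def intro: orbit.step split: if_splits)
  show "\<And>y. y \<in> orbit p x \<Longrightarrow> (p \<circ> transpose a b) y = p y"
    using assms by (auto simp: Transposition.transpose_def)
qed

text \<open>The product sends \<open>b\<close> to \<open>p a\<close> and then follows the cycle of
  \<open>a\<close> under \<open>p\<close>, which never meets \<open>b\<close>, until it arrives at
  \<open>a\<close>.\<close>

lemma orbit_comp_transpose_merge:
  assumes p: "permutation p" and nb: "b \<notin> orbit p a"
  shows "a \<in> orbit (p \<circ> transpose a b) b"
proof -
  let ?p = "p \<circ> transpose a b"
  have "y \<in> orbit ?p b" if "y \<in> orbit p a" for y
    using that
  proof induction
    case base
    show ?case using orbit.base[of ?p b] by (simp add: comp_def)
  next
    case (step y)
    have "y \<noteq> b" using step nb by auto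
    show ?case
    proof (cases "y = a")
      case True
      then show ?thesis using orbit.base[of ?p b] by (simp add: comp_def)
    next
      case False
      then have "?p y = p y" using \<open>y \<noteq> b\<close> by (simp add: Transposition.transpose_def)
      then show ?thesis using orbit.step[OF step.IH] by (simp add: comp_def)
    qed
  qed
  then show ?thesis using permutation_self_in_orbit[OF p] by blast
qed

text \<open>These cycles are common to \<open>p\<close> and \<open>p \<circ> transpose a b\<close>.
  The two cycle counts can therefore differ only through the one or two cycles containing
  \<open>a\<close> and \<open>b\<close>.\<close>

definition orbits_avoiding :: "nat \<Rightarrow> (nat \<Rightarrow> nat) \<Rightarrow> nat \<Rightarrow> nat \<Rightarrow> nat set set" where
  "orbits_avoiding q p a b = {X \<in> orbit p ` {1..q}. a \<notin> X \<and> b \<notin> X}"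

lemma num_cycles_avoiding:
  assumes p: "permutation p" and ab: "a \<in> {1..q}" "b \<in> {1..q}"
  shows "num_cycles q p = card (orbits_avoiding q p a b) + (if b \<in> orbit p a then 1 else 2)"
proof -
  have "orbit p ` {1..q} = orbits_avoiding q p a b \<union> {orbit p a, orbit p b}"
    using ab orbit_eq_of_mem[OF p] unfolding orbits_avoiding_def by (auto; blast)
  moreover have "orbits_avoiding q p a b \<inter> {orbit p a, orbit p b} = {}"
    using permutation_self_in_orbit[OF p] unfolding orbits_avoiding_def by auto
  moreover have "finite (orbits_avoiding q p a b)" unfolding orbits_avoiding_def by simp
  ultimately have "num_cycles q p = card (orbits_avoiding q p a b) + card {orbit p a, orbit p b}"
    unfolding num_cycles_def by (metis card_Un_disjoint finite.emptyI finite.insertI)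
  moreover have "orbit p a = orbit p b \<longleftrightarrow> b \<in> orbit p a"
    using orbit_eq_of_mem[OF p] permutation_self_in_orbit[OF p] by metis
  ultimately show ?thesis by (auto simp: card_insert_if)
qed

lemma orbits_avoiding_comp_transpose:
  assumes "permutation p"
  shows "orbits_avoiding q (p \<circ> transpose a b) a b = orbits_avoiding q p a b"
proof -
  have sub: "orbits_avoiding q p a b \<subseteq> orbits_avoiding q (p \<circ> transpose a b) a b"
    if "permutation p" for p
    using orbit_comp_transpose_avoiding[OF that] unfolding orbits_avoiding_def
    by (smt (verit) image_iff mem_Collect_eq subsetI)
  have "p \<circ> transpose a b \<circ> transpose a b = p" by (simp add: comp_assoc)
  then show ?thesis
    using sub[OF assms] sub[OF permutation_comp_transpose[OF assms], of a b] by simp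
qed

lemma num_cycles_le: "num_cycles q p \<le> q"
  unfolding num_cycles_def by (metis card_atLeastAtMost card_image_le diff_Suc_1 finite_atLeastAtMost)

lemma perm_length_comp_transpose:
  assumes "permutation p" "a \<in> {1..q}" "b \<in> {1..q}"
  shows "perm_length q (p \<circ> transpose a b) \<le> perm_length q p + 1"
    and "perm_length q p \<le> perm_length q (p \<circ> transpose a b) + 1"
  using num_cycles_avoiding[OF assms]
    num_cycles_avoiding[OF permutation_comp_transpose[OF assms(1), of a b] assms(2,3)]
    orbits_avoiding_comp_transpose[OF assms(1), of q a b]
  unfolding perm_length_def by (auto split: if_splits)

lemma perm_length_comp_transpose_merge:
  assumes p: "permutation p" "a \<in> {1..q}" "b \<in> {1..q}" and nb: "b \<notin> orbit p a"
  shows "perm_length q (p \<circ> transpose a b) = perm_length q p + 1"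
proof -
  let ?p = "p \<circ> transpose a b"
  have "b \<in> orbit ?p a"
    using orbit_comp_transpose_merge[OF p(1) nb] permutation_comp_transpose[OF p(1), of a b]
    by (meson orbit_swap permutation_self_in_orbit)
  then show ?thesis
    using num_cycles_avoiding[OF p] nb num_cycles_le[of q p]
      num_cycles_avoiding[OF permutation_comp_transpose[OF p(1), of a b] p(2,3)]
      orbits_avoiding_comp_transpose[OF p(1), of q a b]
    unfolding perm_length_def by auto
qed

lemma perm_length_comp_transpose_fixed:
  assumes "permutation p" "a \<in> {1..q}" "b \<in> {1..q}" "p a = a" "a \<noteq> b"
  shows "perm_length q (p \<circ> transpose a b) = perm_length q p + 1"
  using perm_length_comp_transpose_merge[OF assms(1-3)] assms(4,5) orbit_eq_singleton_iff[of p a]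
  by auto

text \<open>The added point is a cycle of its own, so degree and cycle count both grow by one.
  Lengths of star words on q + 1 or q + 2 points can thus be compared with lengths in S_q.\<close>

lemma perm_length_Suc:
  assumes "p permutes {1..q}"
  shows "perm_length (Suc q) p = perm_length q p"
proof -
  have "p (Suc q) = Suc q" using assms by (simp add: permutes_def)
  then have "orbit p (Suc q) = {Suc q}" using orbit_eq_singleton_iff by metis
  moreover have "{1..Suc q} = insert (Suc q) {1..q}" by auto
  moreover have "{Suc q} \<notin> orbit p ` {1..q}"
    using permutes_orbit_subset[OF assms] by (metis (no_types, lifting) atLeastAtMost_iff image_iff insert_subset not_less_eq_eq order_refl)
  ultimately have "num_cycles (Suc q) p = Suc (num_cycles q p)"
    unfolding num_cycles_def by simp
  then show ?thesis unfolding perm_length_def by simp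
qed

lemma perm_length_id: "perm_length q id = 0"
proof -
  have "orbit id ` {1..q} = (\<lambda>x. {x}) ` {1..q}"
    using orbit_eq_singleton_iff[of id] by (intro image_cong) simp_all
  then show ?thesis unfolding perm_length_def num_cycles_def by (simp add: card_image)
qed

section \<open>Products of star transpositions\<close>

text \<open>The monomials in the expansion of a power of the sum of all transpositions
  \<open>(x, s)\<close>; the head of the list is the leftmost factor.\<close>

definition star_word :: "nat \<Rightarrow> nat list \<Rightarrow> nat \<Rightarrow> nat" where
  "star_word s xs = foldr (\<lambda>x p. transpose x s \<circ> p) xs id"

lemma star_word_simps [simp]:
  "star_word s [] = id"
  "star_word s (x # xs) = transpose x s \<circ> star_word s xs"
  by (simp_all add: star_word_def)

lemma star_word_append: "star_word s (xs @ ys) = star_word s xs \<circ> star_word s ys"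
  by (induction xs) (simp_all add: comp_assoc)

lemma star_word_outside: "y \<notin> set xs \<Longrightarrow> y \<noteq> s \<Longrightarrow> star_word s xs y = y"
  by (induction xs) auto

lemma star_word_image: "star_word s xs ` insert s (set xs) = insert s (set xs)"
proof -
  have "star_word s xs permutes (insert s (set xs))"
  proof (induction xs)
    case Nil
    show ?case unfolding star_word_simps by (rule permutes_id)
  next
    case (Cons x xs)
    have "star_word s xs permutes (insert s (set (x # xs)))"
      by (rule permutes_subset[OF Cons]) auto
    then show ?case unfolding star_word_simps by (intro permutes_compose permutes_swap_id) auto
  qed
  then show ?thesis by (rule permutes_image)
qed

lemma star_word_permutes:
  "set xs \<subseteq> A \<Longrightarrow> s \<in> A \<Longrightarrow> star_word s xs permutes A"
proof (induction xs)
  case Nil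
  then show ?case unfolding star_word_simps by (intro permutes_id)
next
  case (Cons x xs)
  then show ?case unfolding star_word_simps by (intro permutes_compose permutes_swap_id) auto
qed

lemma orbit_subset_invariant:
  assumes "x \<in> A" "\<And>y. y \<in> A \<Longrightarrow> p y \<in> A"
  shows "orbit p x \<subseteq> A"
proof
  fix y assume "y \<in> orbit p x"
  then show "y \<in> A" by induction (use assms in auto)
qed

text \<open>
  Both inequalities are instances of the genus bound: if \<open>m\<close> transpositions generate a group whose
  orbits on \<open>N\<close> points number \<open>\<kappa>\<close>, their product \<open>p\<close> satisfies \<open>m + \<bar>p\<bar> \<ge> 2 (N - \<kappa>)\<close>.
\<close>

lemma star_words_genus:
  fixes q :: nat
  defines "P \<equiv> \<lambda>xs ys. star_word (q + 1) xs \<circ> star_word (q + 2) ys"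
  assumes "set xs \<subseteq> {1..q}" "set ys \<subseteq> {1..q}"
  shows "2 * (card (set xs \<union> set ys) + (if set xs \<inter> set ys = {} then 0 else 1))
    \<le> length xs + length ys + perm_length (q + 2) (P xs ys)"
proof -
  let ?N = "q + 2"
  let ?L = "perm_length ?N"
  have perm: "permutation (P xs ys)" if "set xs \<subseteq> {1..q}" "set ys \<subseteq> {1..q}" for xs ys
  proof -
    have "star_word (q + 1) xs permutes {1..?N}" "star_word (q + 2) ys permutes {1..?N}"
      by (rule star_word_permutes; use that in force)+
    then show ?thesis unfolding P_def
      by (meson finite_atLeastAtMost permutation_permutes permutes_compose)
  qed
  have snocy: "P xs (ys @ [y]) = P xs ys \<circ> transpose y (q + 2)" for xs ys y
    unfolding P_def by (simp add: star_word_append comp_assoc)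
  have snocx: "P (xs @ [x]) [] = P xs [] \<circ> transpose x (q + 1)" for xs x
    unfolding P_def by (simp add: star_word_append)
  have fixed: "P xs ys y = y" if "y \<notin> set xs \<union> set ys" "y \<le> q" for xs ys y
    unfolding P_def using that by (simp add: star_word_outside)
  \<comment> \<open>A new letter is still a fixed point of the product, so word length and
    permutation length both grow by one, which pays for the new point. A repeated letter lowers the
    permutation length by at most one, which the longer word compensates.\<close>
  have base: "2 * card (set xs) \<le> length xs + ?L (P xs [])" if "set xs \<subseteq> {1..q}" for xs
    using that
  proof (induction xs rule: rev_induct)
    case (snoc x xs)
    have IH: "2 * card (set xs) \<le> length xs + ?L (P xs [])" using snoc by simp
    have pm: "permutation (P xs [])" using perm snoc.prems by simp
    have x: "x \<in> {1..?N}" "q + 1 \<in> {1..?N}" using snoc.prems by auto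
    show ?case
    proof (cases "x \<in> set xs")
      case True
      then show ?thesis using IH perm_length_comp_transpose(2)[OF pm x]
        by (simp add: snocx insert_absorb comp_def)
    next
      case False
      have "?L (P xs [] \<circ> transpose x (q + 1)) = ?L (P xs []) + 1"
        by (rule perm_length_comp_transpose_fixed[OF pm x]) (use False fixed snoc.prems in auto)
      then show ?thesis using IH False by (simp add: snocx comp_def)
    qed
  qed simp
  show ?thesis using assms(3)
  proof (induction ys rule: rev_induct)
    case Nil
    then show ?case using base[OF assms(2)] by simp
  next
    case (snoc y ys)
    have IH: "2 * (card (set xs \<union> set ys) + (if set xs \<inter> set ys = {} then 0 else 1))
      \<le> length xs + length ys + ?L (P xs ys)" using snoc by simp
    have pm: "permutation (P xs ys)" using perm snoc.prems assms by simp
    have y: "y \<in> {1..?N}" "q + 2 \<in> {1..?N}" using snoc.prems by auto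
    show ?case
    proof (cases "y \<in> set xs \<union> set ys")
      case False
      have "?L (P xs ys \<circ> transpose y (q + 2)) = ?L (P xs ys) + 1"
        by (rule perm_length_comp_transpose_fixed[OF pm y]) (use False fixed snoc.prems in auto)
      then show ?thesis using IH False by (simp add: snocy comp_def)
    next
      case True
      show ?thesis
      proof (cases "set xs \<inter> set ys = {} \<and> y \<in> set xs")
        case True
        \<comment> \<open>Here \<open>y\<close> is the first letter shared by the two words, and the
          left side grows by two. The product so far maps \<open>insert (q + 2) (set ys)\<close>
          into itself, so \<open>y\<close> and \<open>q + 2\<close> lie in different cycles and the
          new transposition must merge them.\<close>
        have inv: "P xs ys z \<in> insert (q + 2) (set ys)" if "z \<in> insert (q + 2) (set ys)" for z
        proof -
          have z: "star_word (q + 2) ys z \<in> insert (q + 2) (set ys)"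
            using star_word_image[of "q + 2" ys] that by blast
          then have "star_word (q + 1) xs (star_word (q + 2) ys z) = star_word (q + 2) ys z"
            using True assms(2) snoc.prems by (intro star_word_outside) auto
          then show ?thesis using z unfolding P_def by simp
        qed
        have "y \<notin> orbit (P xs ys) (q + 2)"
          using orbit_subset_invariant[of "q + 2" "insert (q + 2) (set ys)" "P xs ys", OF _ inv]
            True snoc.prems by auto
        then have "?L (P xs ys \<circ> transpose (q + 2) y) = ?L (P xs ys) + 1"
          by (intro perm_length_comp_transpose_merge[OF pm y(2) y(1)])
        moreover have "set xs \<union> set (ys @ [y]) = set xs \<union> set ys" using True by auto
        ultimately show ?thesis using IH True by (simp add: snocy transpose_commute comp_def)
      next
        case False
        then have eq: "(set xs \<inter> set (ys @ [y]) = {}) = (set xs \<inter> set ys = {})"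
          using True by auto
        have "set xs \<union> set (ys @ [y]) = set xs \<union> set ys" using True by auto
        then show ?thesis using IH perm_length_comp_transpose(2)[OF pm y] eq by (simp add: snocy comp_def)
      qed
    qed
  qed
qed

lemma perm_length_star_word_le:
  assumes "set xs \<subseteq> {1..N}" "s \<in> {1..N}"
  shows "perm_length N (star_word s xs) \<le> length xs"
  using assms(1)
proof (induction xs rule: rev_induct)
  case (snoc x xs)
  have "permutation (star_word s xs)"
    using snoc.prems assms(2) star_word_permutes[of xs "{1..N}" s] permutation_permutes by auto
  then show ?case using snoc assms(2) perm_length_comp_transpose(1)[of "star_word s xs" x N s]
    by (auto simp: star_word_append comp_def)
qed (simp add: perm_length_id)

text \<open>Conjugation by \<open>transpose s s'\<close> changes the star point of a word, and it
  leaves a permutation that fixes both \<open>s\<close> and \<open>s'\<close> unchanged.\<close>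

lemma star_word_change_star:
  assumes "star_word s xs s = s" "s \<notin> set xs" "s' \<notin> set xs"
  shows "star_word s' xs = star_word s xs"
proof -
  have conj: "star_word s' xs = transpose s s' \<circ> star_word s xs \<circ> transpose s s'"
    using assms(2,3)
  proof (induction xs)
    case (Cons x xs)
    have "transpose x s' = transpose s s' \<circ> transpose x s \<circ> transpose s s'"
      using Cons.prems by (auto simp: Transposition.transpose_def fun_eq_iff)
    then show ?case using Cons by (simp add: fun_eq_iff)
  qed simp
  have s': "star_word s xs s' = s'" if "s' \<noteq> s" using assms that by (simp add: star_word_outside)
  have inj: "inj (star_word s xs)"
    using star_word_permutes[of xs UNIV s] permutes_inj by auto
  show ?thesis
  proof
    fix y
    show "star_word s' xs y = star_word s xs y"
    proof (cases "y = s \<or> y = s'")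
      case True
      then show ?thesis using conj s' assms(1) by (auto simp: Transposition.transpose_def)
    next
      case False
      then have "star_word s xs y \<noteq> s"
        using assms(1) injD[OF inj, of y s] by auto
      moreover have "star_word s xs y \<noteq> s'"
        using s' assms(1) injD[OF inj, of y s'] False by (cases "s' = s") auto
      ultimately show ?thesis using conj False by (simp add: Transposition.transpose_def)
    qed
  qed
qed

section \<open>Counting words\<close>

lemma finite_words: "finite {xs :: nat list. set xs \<subseteq> {1..q} \<and> length xs = m}"
  by (rule finite_lists_length_eq) simp

lemma sum_words_Suc:
  fixes F :: "nat list \<Rightarrow> 'a :: comm_monoid_add"
  shows "(\<Sum>xs | set xs \<subseteq> {1..q} \<and> length xs = Suc m. F xs) =
    (\<Sum>xs | set xs \<subseteq> {1..q} \<and> length xs = m. \<Sum>x\<in>{1..q}. F (x # xs))"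
proof -
  have "{xs. set xs \<subseteq> {1..q} \<and> length xs = Suc m} =
    (\<lambda>(xs, x). x # xs) ` ({xs. set xs \<subseteq> {1..q} \<and> length xs = m} \<times> {1..q})"
    by (auto simp: image_iff length_Suc_conv)
  moreover have "inj_on (\<lambda>(xs, x). x # xs) ({xs. set xs \<subseteq> {1..q} \<and> length xs = m} \<times> {1..q})"
    by (auto simp: inj_on_def)
  ultimately show ?thesis
    by (simp add: sum.reindex sum.cartesian_product case_prod_unfold)
qed

text \<open>Prefixing a letter multiplies the sum by at most \<open>m + 1\<close>: the at most
  \<open>m\<close> letters already present keep the weight, and the at most \<open>q\<close> new
  ones each carry a factor 1/q. The bound is uniform in \<open>q\<close>.\<close>

lemma sum_words_distinct_letters:
  assumes "q \<ge> 1"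
  shows "(\<Sum>xs | set xs \<subseteq> {1..q} \<and> length xs = m. (1 / real q) ^ card (set xs)) \<le> fact m"
proof (induction m)
  case 0
  have "{xs :: nat list. set xs \<subseteq> {1..q} \<and> length xs = 0} = {[]}" by auto
  then show ?case by simp
next
  case (Suc m)
  let ?W = "{xs. set xs \<subseteq> {1..q} \<and> length xs = m}"
  have "(\<Sum>x\<in>{1..q}. (1 / real q) ^ card (set (x # xs))) \<le> real (Suc m) * (1 / real q) ^ card (set xs)"
    if xs: "xs \<in> ?W" for xs
  proof -
    let ?r = "(1 / real q) ^ card (set xs)"
    have "{1..q} = set xs \<union> ({1..q} - set xs)" using xs by auto
    then have "(\<Sum>x\<in>{1..q}. (1 / real q) ^ card (set (x # xs))) =
      (\<Sum>x\<in>set xs. (1 / real q) ^ card (set (x # xs))) +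
      (\<Sum>x\<in>{1..q} - set xs. (1 / real q) ^ card (set (x # xs)))"
      by (metis (no_types, lifting) Diff_disjoint List.finite_set finite_Diff finite_atLeastAtMost sum.union_disjoint)
    also have "\<dots> = (\<Sum>x\<in>set xs. ?r) + (\<Sum>x\<in>{1..q} - set xs. 1 / real q * ?r)"
      by (intro arg_cong2[where f="(+)"] sum.cong) (auto simp: insert_absorb)
    also have "\<dots> = real (card (set xs)) * ?r + real (card ({1..q} - set xs)) * (1 / real q * ?r)"
      by simp
    also have "\<dots> \<le> real m * ?r + real q * (1 / real q * ?r)"
    proof (intro add_mono mult_right_mono)
      show "real (card (set xs)) \<le> real m" using xs card_length[of xs] by auto
      have "card ({1..q} - set xs) \<le> card {1..q}" by (intro card_mono) auto
      then show "real (card ({1..q} - set xs)) \<le> real q" by simp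
    qed auto
    also have "\<dots> = real (Suc m) * ?r" using assms by (simp add: algebra_simps)
    finally show ?thesis .
  qed
  then have "(\<Sum>xs | set xs \<subseteq> {1..q} \<and> length xs = Suc m. (1 / real q) ^ card (set xs))
    \<le> (\<Sum>xs\<in>?W. real (Suc m) * (1 / real q) ^ card (set xs))"
    unfolding sum_words_Suc by (rule sum_mono)
  also have "\<dots> = real (Suc m) * (\<Sum>xs\<in>?W. (1 / real q) ^ card (set xs))"
    by (simp only: sum_distrib_left)
  also have "\<dots> \<le> real (Suc m) * fact m" using Suc by (intro mult_left_mono) auto
  finally show ?case by (simp add: algebra_simps)
qed

section \<open>Cycle types and conjugacy\<close>

lemma sym_group_permutation: "p \<in> sym_group q \<Longrightarrow> permutation p"
  unfolding sym_group_def using permutation_permutes by auto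

lemma funpow_eq_iff_cong_card_orbit:
  assumes p: "permutation p"
  shows "(p ^^ k) x = (p ^^ m) x \<longleftrightarrow> k mod card (orbit p x) = m mod card (orbit p x)"
proof -
  let ?n = "funpow_dist1 p x x"
  have x: "x \<in> orbit p x" using p by (rule permutation_self_in_orbit)
  have per: "(p ^^ ?n) x = x" using x by (rule funpow_dist1_prop)
  have inj: "inj_on (\<lambda>n. (p ^^ n) x) {0..<?n}" by (rule inj_on_funpow_dist1[OF x])
  have "card (orbit p x) = ?n"
    using orbit_conv_funpow_dist1[OF x] card_image[OF inj] by simp
  moreover have "(p ^^ k) x = (p ^^ (k mod ?n)) x" for k
    using per by (simp add: funpow_mod_eq)
  moreover have "k mod ?n \<in> {0..<?n}" for k by simp
  ultimately show ?thesis using inj unfolding inj_on_def by metis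
qed

lemma orbits_subset:
  assumes "p \<in> sym_group q" "X \<in> orbit p ` {1..q}"
  shows "X \<subseteq> {1..q}"
proof -
  obtain x where "X = orbit p x" "x \<in> {1..q}" using assms(2) by (rule imageE)
  then show ?thesis using assms(1) permutes_orbit_subset[of p "{1..q}" x] unfolding sym_group_def by simp
qed

lemma orbits_partition:
  assumes "p \<in> sym_group q"
  shows "(\<Sum>X\<in>orbit p ` {1..q}. card X) = q"
proof -
  note p = sym_group_permutation[OF assms]
  have U: "\<Union> (orbit p ` {1..q}) = {1..q}"
  proof
    show "\<Union> (orbit p ` {1..q}) \<subseteq> {1..q}"
      by (intro Union_least orbits_subset[OF assms])
    show "{1..q} \<subseteq> \<Union> (orbit p ` {1..q})"
      using permutation_self_in_orbit[OF p] by (intro subsetI UN_I)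
  qed
  have "card (\<Union> (orbit p ` {1..q})) = (\<Sum>X\<in>orbit p ` {1..q}. card X)"
  proof (rule card_Union_disjoint)
    show "pairwise disjnt (orbit p ` {1..q})"
    proof (rule pairwiseI)
      fix X Y assume "X \<in> orbit p ` {1..q}" "Y \<in> orbit p ` {1..q}" "X \<noteq> Y"
      then obtain x y where xy: "X = orbit p x" "Y = orbit p y" by blast
      have "X = Y" if "z \<in> X" "z \<in> Y" for z
        using orbit_eq_of_mem[OF p, of z x] orbit_eq_of_mem[OF p, of z y] that xy by simp
      then show "disjnt X Y" using \<open>X \<noteq> Y\<close> unfolding disjnt_iff by blast
    qed
    show "\<And>A. A \<in> orbit p ` {1..q} \<Longrightarrow> finite A"
      using permutation_self_in_orbit[OF p] finite_orbit by (metis imageE)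
  qed
  then show ?thesis using U by simp
qed

text \<open>The partition formed by the cycle lengths, described through its columns: column
  \<open>j\<close> has one box for each cycle of length at least \<open>j\<close>. No sorting of
  cycles is involved.\<close>

definition cycle_diagram :: "nat \<Rightarrow> (nat \<Rightarrow> nat) \<Rightarrow> diagram" where
  "cycle_diagram q p =
     {(i, j). 1 \<le> i \<and> 1 \<le> j \<and> i \<le> card {X \<in> orbit p ` {1..q}. j \<le> card X}}"

lemma cycle_diagram_in_young_diagrams:
  assumes "p \<in> sym_group q"
  shows "cycle_diagram q p \<in> young_diagrams q"
proof -
  let ?O = "orbit p ` {1..q}"
  let ?N = "\<lambda>j. card {X \<in> ?O. j \<le> card X}"
  have mono: "?N j \<le> ?N j'" if "j' \<le> j" for j j' using that by (intro card_mono) auto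
  note O = orbits_subset[OF assms]
  have card_le: "card X \<le> q" if "X \<in> ?O" for X using card_mono[OF _ O[OF that]] by simp
  have 0: "?N j = 0" if "j > q" for j using card_le that by force
  have eq: "cycle_diagram q p = prod.swap ` (SIGMA j:{1..q}. {1..?N j})"
  proof -
    have "(i, j) \<in> cycle_diagram q p \<longleftrightarrow> j \<in> {1..q} \<and> i \<in> {1..?N j}" for i j
      using 0[of j] unfolding cycle_diagram_def mem_Collect_eq case_prod_conv atLeastAtMost_iff
      by linarith
    then show ?thesis by (auto simp: image_iff simp del: atLeastAtMost_iff)
  qed
  have "card (cycle_diagram q p) = card (SIGMA j:{1..q}. {1..?N j})"
    unfolding eq by (intro card_image) auto
  also have "\<dots> = (\<Sum>j\<in>{1..q}. ?N j)" by (subst card_SigmaI) auto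
  also have "\<dots> = (\<Sum>j\<in>{1..q}. \<Sum>X\<in>?O. if j \<le> card X then 1 else 0)"
    by (simp only: card_eq_sum sum.inter_filter[OF finite_imageI[OF finite_atLeastAtMost]])
  also have "\<dots> = (\<Sum>X\<in>?O. \<Sum>j\<in>{1..q}. if j \<le> card X then 1 else 0)" by (rule sum.swap)
  also have "\<dots> = (\<Sum>X\<in>?O. card X)"
  proof (intro sum.cong refl)
    fix X assume "X \<in> ?O"
    then have "{1..q} \<inter> {j. j \<le> card X} = {1..card X}" using card_le by force
    then show "(\<Sum>j\<in>{1..q}. if j \<le> card X then 1 else 0) = card X"
      by (simp add: sum.If_cases)
  qed
  also have "\<dots> = q" by (rule orbits_partition[OF assms])
  finally have "card (cycle_diagram q p) = q" .
  moreover have "finite (cycle_diagram q p)" unfolding eq by simp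
  moreover have "\<forall>(i, j)\<in>cycle_diagram q p. 1 \<le> i \<and> 1 \<le> j \<and>
      (\<forall>i'\<in>{1..i}. \<forall>j'\<in>{1..j}. (i', j') \<in> cycle_diagram q p)"
    unfolding cycle_diagram_def using mono by clarsimp (meson le_trans)
  ultimately show ?thesis unfolding young_diagrams_def by blast
qed

lemma cycle_diagram_eq_card:
  assumes "cycle_diagram q p = cycle_diagram q p'" "j \<ge> 1"
  shows "card {X \<in> orbit p ` {1..q}. j \<le> card X} = card {X \<in> orbit p' ` {1..q}. j \<le> card X}"
    (is "?a = ?b")
proof -
  have "1 \<le> i \<and> i \<le> ?a \<longleftrightarrow> 1 \<le> i \<and> i \<le> ?b" for i
    using assms unfolding cycle_diagram_def set_eq_iff by auto
  from this[of ?a] this[of ?b] show ?thesis by auto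
qed

text \<open>Cycles of equal length are matched by a bijection, each cycle receives a base point, and
  \<open>\<tau>\<close> sends the k-th iterate of a base point under \<open>p\<close> to the k-th
  iterate of the matching base point under \<open>p'\<close>.\<close>

lemma conjugate_of_cycle_diagram_eq:
  assumes p: "p \<in> sym_group q" and p': "p' \<in> sym_group q"
    and eq: "cycle_diagram q p = cycle_diagram q p'"
  shows "\<exists>\<tau>\<in>sym_group q. \<tau> \<circ> p \<circ> inv \<tau> = p'"
proof -
  note pp = sym_group_permutation[OF p] and pp' = sym_group_permutation[OF p']
  let ?O = "\<lambda>p. orbit p ` {1..q}"
  \<comment> \<open>The number of cycles of length exactly \<open>j\<close> is the difference of two
    consecutive columns of the cycle diagram.\<close>
  have split: "card {X \<in> ?O p. j \<le> card X} =
      card {X \<in> ?O p. card X = j} + card {X \<in> ?O p. Suc j \<le> card X}" for p :: "nat \<Rightarrow> nat" and j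
  proof -
    have "{X \<in> ?O p. j \<le> card X} = {X \<in> ?O p. card X = j} \<union> {X \<in> ?O p. Suc j \<le> card X}" by auto
    then show ?thesis by (simp add: card_Un_disjoint disjoint_iff)
  qed
  have pos: "card X \<ge> 1" if X: "X \<in> ?O p" and pm: "permutation p" for X p
  proof -
    obtain x where "X = orbit p x" using X by blast
    then have "x \<in> X" "finite X"
      using permutation_self_in_orbit[OF pm, of x] finite_orbit by auto
    then show ?thesis by (metis One_nat_def Suc_leI card_gt_0_iff empty_iff)
  qed
  have "card {X \<in> ?O p. card X = j} = card {X \<in> ?O p'. card X = j}" for j
  proof (cases "j \<ge> 1")
    case True
    then show ?thesis using split[of p j] split[of p' j] cycle_diagram_eq_card[OF eq, of j]
      cycle_diagram_eq_card[OF eq, of "Suc j"] by simp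
  next
    case False
    then have "{X \<in> ?O p. card X = j} = {}" "{X \<in> ?O p'. card X = j} = {}"
      using pos[OF _ pp] pos[OF _ pp'] by force+
    then show ?thesis by (simp only:)
  qed
  then have "\<forall>j. \<exists>h. bij_betw h {X \<in> ?O p. card X = j} {X \<in> ?O p'. card X = j}"
    by (intro allI finite_same_card_bij) auto
  from choice[OF this] obtain h
    where h: "\<And>j. bij_betw (h j) {X \<in> ?O p. card X = j} {X \<in> ?O p'. card X = j}"
    by blast
  define \<Phi> where "\<Phi> X = h (card X) X" for X
  have \<Phi>: "\<Phi> X \<in> ?O p' \<and> card (\<Phi> X) = card X" if "X \<in> ?O p" for X
    using bij_betwE[OF h[of "card X"]] that unfolding \<Phi>_def by blast
  have \<Phi>_inj: "X = Y" if "X \<in> ?O p" "Y \<in> ?O p" "\<Phi> X = \<Phi> Y" for X Y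
  proof -
    have "card X = card Y" using \<Phi> that by metis
    then show ?thesis
      using inj_onD[OF bij_betw_imp_inj_on[OF h[of "card X"]], of X Y] that
      unfolding \<Phi>_def by auto
  qed
  \<comment> \<open>The base point is a function of the cycle as a set, so all points of one cycle
    share it.\<close>
  define b where "b X = (SOME x. x \<in> X)" for X :: "nat set"
  have b: "b X \<in> X \<and> orbit p (b X) = X" if X: "X \<in> ?O p" and pm: "permutation p" for X p
  proof -
    obtain x where x: "X = orbit p x" using X by blast
    then have "x \<in> X" using permutation_self_in_orbit[OF pm] by simp
    then have "b X \<in> X" unfolding b_def by (rule someI)
    then show ?thesis using orbit_eq_of_mem[OF pm] x by auto
  qed
  define k where "k y = (SOME k. (p ^^ k) (b (orbit p y)) = y)" for y
  have k: "(p ^^ k y) (b (orbit p y)) = y" if "y \<in> {1..q}" for y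
  proof -
    have "orbit p (b (orbit p y)) = orbit p y" using b[OF _ pp, of "orbit p y"] that by auto
    then have "y \<in> orbit p (b (orbit p y))" using permutation_self_in_orbit[OF pp] by simp
    then have "\<exists>k. (p ^^ k) (b (orbit p y)) = y" using funpow_dist_prop by metis
    then show ?thesis unfolding k_def by (rule someI_ex)
  qed
  define \<tau> where "\<tau> y = (if y \<in> {1..q} then (p' ^^ k y) (b (\<Phi> (orbit p y))) else y)" for y
  have base: "orbit p (b (orbit p y)) = orbit p y"
    "orbit p' (b (\<Phi> (orbit p y))) = \<Phi> (orbit p y)"
    "card (\<Phi> (orbit p y)) = card (orbit p y)" "\<Phi> (orbit p y) \<in> ?O p'" if "y \<in> {1..q}" for y
    using b[OF _ pp, of "orbit p y"] b[OF _ pp', of "\<Phi> (orbit p y)"] \<Phi>[of "orbit p y"] that by auto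
  have orb: "orbit p' (\<tau> y) = \<Phi> (orbit p y)" if "y \<in> {1..q}" for y
  proof -
    have "b (\<Phi> (orbit p y)) \<in> orbit p' (b (\<Phi> (orbit p y)))"
      by (rule permutation_self_in_orbit[OF pp'])
    then have "\<tau> y \<in> orbit p' (b (\<Phi> (orbit p y)))"
      unfolding \<tau>_def using that by (auto intro: funpow_in_orbit)
    then show ?thesis using orbit_eq_of_mem[OF pp'] base(2)[OF that] by blast
  qed
  \<comment> \<open>Matching cycles have the same length, so exponents agree modulo the period on
    one side exactly when they do on the other. This gives injectivity of \<open>\<tau>\<close> and
    makes the arbitrary choice of the exponents \<open>k\<close> harmless.\<close>
  have cong: "(p' ^^ m) (b (\<Phi> (orbit p y))) = (p' ^^ n) (b (\<Phi> (orbit p y))) \<longleftrightarrow>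
      (p ^^ m) (b (orbit p y)) = (p ^^ n) (b (orbit p y))" if "y \<in> {1..q}" for m n y
    unfolding funpow_eq_iff_cong_card_orbit[OF pp] funpow_eq_iff_cong_card_orbit[OF pp']
    using base[OF that] by simp
  have range: "\<tau> y \<in> {1..q}" if "y \<in> {1..q}" for y
  proof -
    have "\<tau> y \<in> \<Phi> (orbit p y)" using orb[OF that] permutation_self_in_orbit[OF pp'] by metis
    moreover have "\<Phi> (orbit p y) \<subseteq> {1..q}"
      by (rule orbits_subset[OF p' base(4)[OF that]])
    ultimately show ?thesis by blast
  qed
  have inj: "inj_on \<tau> {1..q}"
  proof (rule inj_onI)
    fix y z assume yz: "y \<in> {1..q}" "z \<in> {1..q}" "\<tau> y = \<tau> z"
    then have "\<Phi> (orbit p y) = \<Phi> (orbit p z)" using orb by metis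
    then have o: "orbit p y = orbit p z" by (rule \<Phi>_inj[OF imageI[OF yz(1)] imageI[OF yz(2)]])
    have "(p' ^^ k y) (b (\<Phi> (orbit p y))) = (p' ^^ k z) (b (\<Phi> (orbit p z)))"
      using yz(3) unfolding \<tau>_def if_P[OF yz(1)] if_P[OF yz(2)] .
    then have "(p ^^ k y) (b (orbit p y)) = (p ^^ k z) (b (orbit p z))"
      using cong[OF yz(1)] unfolding o by blast
    then show "y = z" unfolding k[OF yz(1)] k[OF yz(2)] .
  qed
  have "bij_betw \<tau> {1..q} {1..q}"
    using inj range by (simp add: bij_betw_def endo_inj_surj image_subset_iff)
  then have perm: "\<tau> permutes {1..q}" by (rule bij_imp_permutes) (auto simp: \<tau>_def)
  have comm: "\<tau> (p y) = p' (\<tau> y)" for y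
  proof (cases "y \<in> {1..q}")
    case True
    then have py: "p y \<in> {1..q}" using p permutes_in_image[of p "{1..q}" y] unfolding sym_group_def by blast
    have o: "orbit p (p y) = orbit p y" by (rule permutation_orbit_step[OF pp])
    have "(p ^^ k (p y)) (b (orbit p y)) = (p ^^ Suc (k y)) (b (orbit p y))"
      using k[OF py] k[OF True] o by simp
    then have "(p' ^^ k (p y)) (b (\<Phi> (orbit p y))) = (p' ^^ Suc (k y)) (b (\<Phi> (orbit p y)))"
      using cong[OF True] by blast
    then show ?thesis using True py o unfolding \<tau>_def by simp
  next
    case False
    then have "p y = y" "p' y = y" using p p' unfolding sym_group_def permutes_def by auto
    then show ?thesis using False unfolding \<tau>_def by auto
  qed
  have "\<tau> \<circ> p \<circ> inv \<tau> = p' \<circ> (\<tau> \<circ> inv \<tau>)" using comm by (simp add: fun_eq_iff)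
  then have "\<tau> \<circ> p \<circ> inv \<tau> = p'" using permutes_inv_o(1)[OF perm] by simp
  then show ?thesis using perm unfolding sym_group_def by blast
qed

section \<open>Specht modules\<close>

lemma perm_action_add: "perm_action \<sigma> (f + g) = perm_action \<sigma> f + perm_action \<sigma> g"
  by (simp add: perm_action_def fun_eq_iff)

lemma perm_action_scale: "perm_action \<sigma> (fun_scale a f) = fun_scale a (perm_action \<sigma> f)"
  by (simp add: perm_action_def fun_scale_def)

lemma perm_action_id: "perm_action id f = f"
  by (simp add: perm_action_def)

lemma perm_action_comp:
  assumes "bij \<sigma>" "bij \<tau>"
  shows "perm_action (\<sigma> \<circ> \<tau>) f = perm_action \<sigma> (perm_action \<tau> f)"
  using o_inv_distrib[OF assms] by (simp add: perm_action_def image_comp)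

lemma row_entries_comp: "row_entries D (\<sigma> \<circ> t) = (\<lambda>i. \<sigma> ` row_entries D t i)"
  by (auto simp: row_entries_def fun_eq_iff)

lemma column_entries_comp: "column_entries D (\<sigma> \<circ> t) j = \<sigma> ` column_entries D t j"
  by (auto simp: column_entries_def)

lemma finite_sym_group: "finite (sym_group q)"
  unfolding sym_group_def by (simp add: finite_permutations)

lemma finite_column_group: "finite (column_group D t)"
  unfolding column_group_def using finite_sym_group by simp

lemma sym_group_comp: "\<sigma> \<in> sym_group q \<Longrightarrow> \<tau> \<in> sym_group q \<Longrightarrow> \<sigma> \<circ> \<tau> \<in> sym_group q"
  unfolding sym_group_def by (simp add: permutes_compose)

lemma sym_group_inv: "\<sigma> \<in> sym_group q \<Longrightarrow> inv \<sigma> \<in> sym_group q"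
  unfolding sym_group_def by (simp add: permutes_inv)

lemma sym_group_inverses:
  assumes "\<sigma> \<in> sym_group q"
  shows "bij \<sigma>" "inv \<sigma> \<circ> \<sigma> = id" "\<sigma> \<circ> inv \<sigma> = id" "inv (inv \<sigma>) = \<sigma>"
    "\<And>x. inv \<sigma> (\<sigma> x) = x" "\<And>x. \<sigma> (inv \<sigma> x) = x"
proof -
  have s: "\<sigma> permutes {1..q}" using assms unfolding sym_group_def by simp
  show "bij \<sigma>" using s by (rule permutes_bij)
  show "inv \<sigma> \<circ> \<sigma> = id" "\<sigma> \<circ> inv \<sigma> = id" using permutes_inv_o[OF s] by auto
  show "inv (inv \<sigma>) = \<sigma>" using permutes_inv_inv[OF s] .
  show "\<And>x. inv \<sigma> (\<sigma> x) = x" "\<And>x. \<sigma> (inv \<sigma> x) = x" using permutes_inverses[OF s] by auto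
qed

lemma sign_conjugate:
  assumes "\<sigma> \<in> sym_group q" "\<pi> \<in> sym_group q"
  shows "sign (inv \<sigma> \<circ> \<pi> \<circ> \<sigma>) = sign \<pi>"
proof -
  have perm: "permutation \<sigma>" "permutation \<pi>" "permutation (inv \<sigma>)"
    using assms sym_group_inv permutation_permutes unfolding sym_group_def
    by (auto intro: permutation_inverse)
  then have "sign (inv \<sigma> \<circ> \<pi> \<circ> \<sigma>) = sign \<sigma> * sign \<pi> * sign \<sigma>"
    by (simp add: sign_compose permutation_compose sign_inverse)
  then show ?thesis using perm sign_idempotent[of \<sigma>] by (simp add: mult.assoc mult.left_commute)
qed

lemma tableaux_comp:
  "\<sigma> \<in> sym_group (card D) \<Longrightarrow> t \<in> tableaux D \<Longrightarrow> \<sigma> \<circ> t \<in> tableaux D"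
  unfolding tableaux_def sym_group_def
  by (auto intro: bij_betw_trans permutes_imp_bij)

text \<open>Conjugation by \<open>\<sigma>\<close> identifies the column groups of \<open>t\<close>
  and \<open>\<sigma> \<circ> t\<close> and preserves signs.\<close>

lemma perm_action_polytabloid:
  assumes s: "\<sigma> \<in> sym_group (card D)"
  shows "perm_action \<sigma> (polytabloid D t) = polytabloid D (\<sigma> \<circ> t)"
proof
  fix T
  note inv = sym_group_inverses[OF s]
  have inj: "inj (inv \<sigma>)" "inj \<sigma>" using inv(1) bij_imp_bij_inv bij_is_inj by auto
  let ?c = "\<lambda>\<pi>. inv \<sigma> \<circ> \<pi> \<circ> \<sigma>"
  have bij: "bij_betw ?c (column_group D (\<sigma> \<circ> t)) (column_group D t)"
  proof (rule bij_betw_byWitness[where f' = "\<lambda>\<pi>. \<sigma> \<circ> \<pi> \<circ> inv \<sigma>"])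
    show "\<forall>\<pi>\<in>column_group D (\<sigma> \<circ> t). \<sigma> \<circ> ?c \<pi> \<circ> inv \<sigma> = \<pi>"
      "\<forall>\<pi>\<in>column_group D t. ?c (\<sigma> \<circ> \<pi> \<circ> inv \<sigma>) = \<pi>"
      using inv(5,6) by (auto simp: fun_eq_iff)
    show "?c ` column_group D (\<sigma> \<circ> t) \<subseteq> column_group D t"
    proof
      fix \<rho> assume "\<rho> \<in> ?c ` column_group D (\<sigma> \<circ> t)"
      then obtain \<pi> where \<pi>: "\<pi> \<in> column_group D (\<sigma> \<circ> t)" "\<rho> = ?c \<pi>" by blast
      have "\<rho> ` column_entries D t j = column_entries D t j" for j
      proof -
        have "\<pi> ` (\<sigma> ` column_entries D t j) = \<sigma> ` column_entries D t j"
          using \<pi>(1) unfolding column_group_def column_entries_comp by blast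
        then have "inv \<sigma> ` (\<pi> ` (\<sigma> ` column_entries D t j)) = column_entries D t j"
          by (simp add: image_image inv(5))
        then show ?thesis unfolding \<pi>(2) by (simp add: image_image comp_def)
      qed
      then show "\<rho> \<in> column_group D t"
        using \<pi> s sym_group_comp sym_group_inv unfolding column_group_def by auto
    qed
    show "(\<lambda>\<pi>. \<sigma> \<circ> \<pi> \<circ> inv \<sigma>) ` column_group D t \<subseteq> column_group D (\<sigma> \<circ> t)"
    proof
      fix \<rho> assume "\<rho> \<in> (\<lambda>\<pi>. \<sigma> \<circ> \<pi> \<circ> inv \<sigma>) ` column_group D t"
      then obtain \<pi> where \<pi>: "\<pi> \<in> column_group D t" "\<rho> = \<sigma> \<circ> \<pi> \<circ> inv \<sigma>" by blast
      have "\<rho> ` (\<sigma> ` column_entries D t j) = \<sigma> ` column_entries D t j" for j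
      proof -
        have "\<pi> ` column_entries D t j = column_entries D t j"
          using \<pi>(1) unfolding column_group_def by blast
        then have "\<sigma> ` (\<pi> ` (inv \<sigma> ` (\<sigma> ` column_entries D t j))) = \<sigma> ` column_entries D t j"
          by (simp add: image_image[of "inv \<sigma>"] inv(5))
        then show ?thesis unfolding \<pi>(2) by (simp add: image_image comp_def)
      qed
      then show "\<rho> \<in> column_group D (\<sigma> \<circ> t)"
        using \<pi> s sym_group_comp sym_group_inv unfolding column_group_def column_entries_comp by auto
    qed
  qed
  have "polytabloid D t (\<lambda>i. inv \<sigma> ` T i) =
    (\<Sum>\<pi>\<in>column_group D (\<sigma> \<circ> t).
       if row_entries D (?c \<pi> \<circ> t) = (\<lambda>i. inv \<sigma> ` T i) then of_int (sign (?c \<pi>)) else 0)"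
    unfolding polytabloid_def by (rule sum.reindex_bij_betw[OF bij, symmetric])
  also have "\<dots> = polytabloid D (\<sigma> \<circ> t) T"
    unfolding polytabloid_def
  proof (intro sum.cong refl)
    fix \<pi> assume "\<pi> \<in> column_group D (\<sigma> \<circ> t)"
    then have "\<pi> \<in> sym_group (card D)" unfolding column_group_def by simp
    then have sg: "sign (?c \<pi>) = sign \<pi>" by (rule sign_conjugate[OF s])
    have "?c \<pi> \<circ> t = inv \<sigma> \<circ> (\<pi> \<circ> (\<sigma> \<circ> t))" by (simp add: comp_assoc)
    then have "row_entries D (?c \<pi> \<circ> t) = (\<lambda>i. inv \<sigma> ` row_entries D (\<pi> \<circ> (\<sigma> \<circ> t)) i)"
      by (simp only: row_entries_comp)
    then have "row_entries D (?c \<pi> \<circ> t) = (\<lambda>i. inv \<sigma> ` T i) \<longleftrightarrow> row_entries D (\<pi> \<circ> (\<sigma> \<circ> t)) = T"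
      using inj_image_eq_iff[OF inj(1)] by (simp add: fun_eq_iff)
    then show "(if row_entries D (?c \<pi> \<circ> t) = (\<lambda>i. inv \<sigma> ` T i) then of_int (sign (?c \<pi>)) else 0) =
      (if row_entries D (\<pi> \<circ> (\<sigma> \<circ> t)) = T then of_int (sign \<pi>) else (0::complex))"
      using sg by simp
  qed
  finally show "perm_action \<sigma> (polytabloid D t) T = polytabloid D (\<sigma> \<circ> t) T"
    by (simp add: perm_action_def)
qed

lemma perm_action_specht:
  assumes s: "\<sigma> \<in> sym_group (card D)" and f: "f \<in> specht D"
  shows "perm_action \<sigma> f \<in> specht D"
  using f unfolding specht_def
proof (induction rule: cfun.span_induct)
  show "cfun.subspace {f. perm_action \<sigma> f \<in> cfun.span (polytabloid D ` tableaux D)}"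
  proof (rule cfun.subspaceI)
    have "perm_action \<sigma> 0 = 0" by (simp add: perm_action_def fun_eq_iff)
    then show "0 \<in> {f. perm_action \<sigma> f \<in> cfun.span (polytabloid D ` tableaux D)}"
      by (simp add: cfun.span_zero)
  qed (auto simp: perm_action_add perm_action_scale cfun.span_add cfun.span_scale)
next
  fix g assume "g \<in> polytabloid D ` tableaux D"
  then obtain t where "t \<in> tableaux D" "g = polytabloid D t" by blast
  then show "perm_action \<sigma> g \<in> cfun.span (polytabloid D ` tableaux D)"
    using perm_action_polytabloid[OF s] tableaux_comp[OF s] by (auto intro!: cfun.span_base)
qed

lemma young_diagram_pos: "D \<in> young_diagrams q \<Longrightarrow> (i, j) \<in> D \<Longrightarrow> 1 \<le> i \<and> 1 \<le> j"
  unfolding young_diagrams_def by fast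

lemma young_diagram_down:
  "D \<in> young_diagrams q \<Longrightarrow> (i, j) \<in> D \<Longrightarrow> 1 \<le> i' \<Longrightarrow> i' \<le> i \<Longrightarrow> 1 \<le> j' \<Longrightarrow> j' \<le> j \<Longrightarrow> (i', j') \<in> D"
  unfolding young_diagrams_def by fastforce

lemma young_diagram_card: "D \<in> young_diagrams q \<Longrightarrow> card D = q"
  and young_diagram_finite: "D \<in> young_diagrams q \<Longrightarrow> finite D"
  unfolding young_diagrams_def by auto

lemma row_entries_swap:
  assumes inj: "inj_on t D" and b: "(r, j) \<in> D" "(r', j) \<in> D" "r \<noteq> r'"
  shows "row_entries D (transpose (t (r, j)) (t (r', j)) \<circ> t) =
    (row_entries D t)(r := insert (t (r', j)) (row_entries D t r - {t (r, j)}),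
                      r' := insert (t (r, j)) (row_entries D t r' - {t (r', j)}))"
    (is "row_entries D (?s \<circ> t) = ?R")
proof
  fix i
  have fix_other: "?s (t b) = t b" if "b \<in> D" "b \<noteq> (r, j)" "b \<noteq> (r', j)" for b
    using inj_onD[OF inj, of b "(r, j)"] inj_onD[OF inj, of b "(r', j)"] that assms
    by (auto simp: Transposition.transpose_def)
  have mem: "y \<in> row_entries D (?s \<circ> t) i \<longleftrightarrow> (\<exists>b\<in>D. fst b = i \<and> y = ?s (t b))" for y
    unfolding row_entries_def by auto
  have mem': "y \<in> row_entries D t i \<longleftrightarrow> (\<exists>b\<in>D. fst b = i \<and> y = t b)" for y i
    unfolding row_entries_def by auto
  have eqt: "t b = t b' \<longleftrightarrow> b = b'" if "b \<in> D" "b' \<in> D" for b b'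
    using inj that by (meson inj_on_eq_iff)
  show "row_entries D (?s \<circ> t) i = ?R i"
  proof (intro set_eqI)
    fix y
    show "y \<in> row_entries D (?s \<circ> t) i \<longleftrightarrow> y \<in> ?R i"
    proof (cases "i = r \<or> i = r'")
      case False
      have "?s (t b) = t b" if "b \<in> D" "fst b = i" for b using that False by (intro fix_other) auto
      then have "y \<in> row_entries D (?s \<circ> t) i \<longleftrightarrow> y \<in> row_entries D t i"
        unfolding mem mem' by metis
      then show ?thesis using False by simp
    next
      case True
      define r1 r2 where "r1 = i" and "r2 = (if i = r then r' else r)"
      have D: "(r1, j) \<in> D" "(r2, j) \<in> D" "r1 \<noteq> r2" using True b unfolding r1_def r2_def by auto
      have s1: "?s (t (r1, j)) = t (r2, j)" using True unfolding r1_def r2_def by auto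
      have R: "?R i = insert (t (r2, j)) (row_entries D t r1 - {t (r1, j)})"
        using True b unfolding r1_def r2_def by auto
      have oth: "?s (t b) = t b" if "b \<in> D" "fst b = r1" "b \<noteq> (r1, j)" for b
      proof (rule fix_other[OF that(1)])
        show "b \<noteq> (r, j)" "b \<noteq> (r', j)" using that True unfolding r1_def by auto
      qed
      have "y \<in> row_entries D (?s \<circ> t) i \<longleftrightarrow>
          y = t (r2, j) \<or> (\<exists>b\<in>D. fst b = r1 \<and> b \<noteq> (r1, j) \<and> y = t b)"
        unfolding mem using s1 oth D(1) unfolding r1_def by (metis fst_conv)
      also have "\<dots> \<longleftrightarrow> y \<in> ?R i"
        unfolding R insert_iff Diff_iff mem' using eqt[OF _ D(1)] by auto
      finally show ?thesis .
    qed
  qed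
qed

text \<open>
  The tabloids in the sum arise by merging \<open>k\<close> into the row \<open>r'\<close> and then moving one entry of the
  merged row back.  In a polytabloid the terms cancel in pairs, because the entry sitting in row
  \<open>r\<close> of a given column can be exchanged with the entry of the same column in row \<open>r'\<close>.
\<close>

lemma polytabloid_row_relation:
  assumes D: "D \<in> young_diagrams q" and t: "t \<in> tableaux D"
    and r: "1 \<le> r'" "r' < r" and k: "k \<in> T r" and fin: "finite (T r')"
    and disj: "\<And>i j. i \<noteq> j \<Longrightarrow> T i \<inter> T j = {}"
  shows "(\<Sum>x\<in>insert k (T r'). polytabloid D t (\<lambda>i. transpose x k ` T i)) = 0"
proof -
  let ?X = "insert k (T r')"
  \<comment> \<open>\<open>U x\<close> is the tabloid in which \<open>k\<close> has joined row
    \<open>r'\<close> and \<open>x\<close> has left it for row \<open>r\<close>; this is the effect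
    of \<open>transpose x k\<close> on \<open>T\<close>.\<close>
  define U where "U x = T(r := insert x (T r - {k}), r' := ?X - {x})" for x
  have kr': "k \<notin> T r'" using disj[of r r'] k r by auto
  have U: "(\<lambda>i. transpose x k ` T i) = U x" if x: "x \<in> ?X" for x
  proof
    fix i
    have im: "transpose x k ` A = (if k \<in> A then (if x \<in> A then A else insert x (A - {k}))
        else (if x \<in> A then insert k (A - {x}) else A))" for A
      by (auto simp: Transposition.transpose_def image_iff split: if_splits)
    have "k \<notin> T i" if "i \<noteq> r" using disj[OF that] k by auto
    moreover have "x \<notin> T i" if "i \<noteq> r" "i \<noteq> r'"
      using disj[OF that(1)] disj[OF that(2)] k x by auto
    moreover have "x \<in> T r \<Longrightarrow> x = k" using disj[of r r'] x r by auto
    ultimately show "transpose x k ` T i = U x i"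
      using k kr' x r unfolding U_def im by auto
  qed
  have inj: "inj_on t D" using t unfolding tableaux_def by (auto simp: bij_betw_def)
  let ?C = "column_group D t"
  define J where "J = {j. (r, j) \<in> D}"
  have finJ: "finite J"
    using finite_subset[of J "snd ` D"] young_diagram_finite[OF D] unfolding J_def by force
  \<comment> \<open>The sum over \<open>x\<close> becomes a sum over the column \<open>j\<close> in
    which \<open>x\<close> stands in row \<open>r\<close>. The cancellation is carried out for each
    fixed column.\<close>
  define Q where "Q j \<pi> \<longleftrightarrow> \<pi> (t (r, j)) \<in> ?X \<and> row_entries D (\<pi> \<circ> t) = U (\<pi> (t (r, j)))" for j \<pi>
  have injC: "inj \<pi>" if "\<pi> \<in> ?C" for \<pi>
    using that sym_group_inverses(1) bij_is_inj unfolding column_group_def by blast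
  have cnt: "(\<Sum>x\<in>?X. if row_entries D (\<pi> \<circ> t) = U x then a else 0) = (\<Sum>j\<in>J. if Q j \<pi> then a else 0)"
    if \<pi>: "\<pi> \<in> ?C" for \<pi> and a :: complex
  proof -
    let ?h = "\<lambda>j. \<pi> (t (r, j))"
    have injh: "inj_on ?h J"
      using injD[OF injC[OF \<pi>]] inj_onD[OF inj] unfolding J_def inj_on_def by blast
    have img: "{x \<in> ?X. row_entries D (\<pi> \<circ> t) = U x} = ?h ` {j \<in> J. Q j \<pi>}"
    proof (intro equalityI subsetI)
      fix x assume x: "x \<in> {x \<in> ?X. row_entries D (\<pi> \<circ> t) = U x}"
      then have "x \<in> row_entries D (\<pi> \<circ> t) r" using r unfolding U_def by auto
      then obtain j where "(r, j) \<in> D" "x = ?h j" unfolding row_entries_def by auto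
      then show "x \<in> ?h ` {j \<in> J. Q j \<pi>}" using x unfolding J_def Q_def by auto
    qed (auto simp: Q_def)
    have "(\<Sum>x\<in>?X. if row_entries D (\<pi> \<circ> t) = U x then a else 0) =
        (\<Sum>x\<in>{x \<in> ?X. row_entries D (\<pi> \<circ> t) = U x}. a)"
      using fin by (subst sum.inter_filter) auto
    also have "\<dots> = (\<Sum>j\<in>{j \<in> J. Q j \<pi>}. a)"
      unfolding img by (subst sum.reindex[OF inj_on_subset[OF injh]]) auto
    also have "\<dots> = (\<Sum>j\<in>J. if Q j \<pi> then a else 0)"
      using finJ by (subst sum.inter_filter) auto
    finally show ?thesis .
  qed
  have zero: "(\<Sum>\<pi>\<in>?C. if Q j \<pi> then of_int (sign \<pi>) else (0::complex)) = 0" if j: "j \<in> J" for j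
  proof -
    let ?u = "t (r, j)" and ?v = "t (r', j)"
    have b: "(r, j) \<in> D" "(r', j) \<in> D"
      using j r young_diagram_down[OF D, of r j r' j] young_diagram_pos[OF D, of r j]
      unfolding J_def by auto
    have uv: "?u \<noteq> ?v" using inj_onD[OF inj _ b] r by auto
    have rng: "?u \<in> {1..card D}" "?v \<in> {1..card D}"
      using t b unfolding tableaux_def by (auto dest: bij_betwE)
    let ?s = "transpose ?u ?v"
    have s: "?s \<in> sym_group (card D)"
      unfolding sym_group_def using rng by (simp add: permutes_swap_id)
    have col: "?s ` column_entries D t j' = column_entries D t j'" for j'
    proof -
      have "?u \<in> column_entries D t j' \<longleftrightarrow> ?v \<in> column_entries D t j'"
        unfolding column_entries_def using inj_on_image_mem_iff[OF inj b(1)]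
          inj_on_image_mem_iff[OF inj b(2)] b by auto
      then show ?thesis by (intro transpose_image_eq)
    qed
    have inC: "\<pi> \<circ> ?s \<in> ?C" if "\<pi> \<in> ?C" for \<pi>
    proof -
      have "(\<pi> \<circ> ?s) ` column_entries D t j' = \<pi> ` column_entries D t j'" for j'
        unfolding image_comp[symmetric] col ..
      then show ?thesis using that s sym_group_comp unfolding column_group_def by simp
    qed
    have invol: "\<pi> \<circ> ?s \<circ> ?s = \<pi>" for \<pi> :: "nat \<Rightarrow> nat" by (simp add: comp_assoc)
    have bij: "bij_betw (\<lambda>\<pi>. \<pi> \<circ> ?s) ?C ?C"
      by (rule bij_betw_byWitness[where f' = "\<lambda>\<pi>. \<pi> \<circ> ?s"]) (use inC invol in auto)
    have sgn: "sign (\<pi> \<circ> ?s) = - sign \<pi>" if "\<pi> \<in> ?C" for \<pi>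
    proof -
      have "permutation \<pi>"
        using that permutation_permutes unfolding column_group_def sym_group_def by auto
      then show ?thesis using uv by (simp add: sign_compose sign_swap_id permutation_swap_id)
    qed
    \<comment> \<open>Exchanging the two entries \<open>x\<close>, \<open>y\<close> of column
      \<open>j\<close> turns the tabloid \<open>U x\<close> into \<open>U y\<close>. Since
      \<open>y\<close> came from the merged row, this is again one of the tabloids of the
      relation.\<close>
    have Qs: "Q j (\<pi> \<circ> ?s)" if \<pi>: "\<pi> \<in> ?C" and Q: "Q j \<pi>" for \<pi>
    proof -
      let ?x = "\<pi> ?u" and ?y = "\<pi> ?v"
      have x: "?x \<in> ?X" and R: "row_entries D (\<pi> \<circ> t) = U ?x" using Q unfolding Q_def by auto
      have xy: "?x \<noteq> ?y" using injD[OF injC[OF \<pi>]] uv by metis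
      have "?y \<in> row_entries D (\<pi> \<circ> t) r'" unfolding row_entries_def using b by force
      then have y: "?y \<in> ?X" using R r unfolding U_def by auto
      have "\<pi> \<circ> ?s \<circ> t = transpose ?x ?y \<circ> (\<pi> \<circ> t)"
        using injD[OF injC[OF \<pi>]] by (auto simp: fun_eq_iff Transposition.transpose_def)
      moreover have "inj_on (\<pi> \<circ> t) D"
        using inj injC[OF \<pi>] by (meson comp_inj_on inj_on_subset subset_UNIV)
      ultimately have "row_entries D (\<pi> \<circ> ?s \<circ> t) =
          (U ?x)(r := insert ?y (U ?x r - {?x}), r' := insert ?x (U ?x r' - {?y}))"
        using row_entries_swap[of "\<pi> \<circ> t" D r j r'] b r R by simp
      also have "\<dots> = U ?y"
      proof -
        have "?x \<notin> T r - {k}" using x disj[of r r'] r by auto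
        moreover have "insert ?x (?X - {?x} - {?y}) = ?X - {?y}" using x xy by auto
        ultimately show ?thesis using r unfolding U_def by (auto simp: fun_eq_iff)
      qed
      finally show ?thesis using y unfolding Q_def by simp
    qed
    have Qiff: "Q j (\<pi> \<circ> ?s) \<longleftrightarrow> Q j \<pi>" if "\<pi> \<in> ?C" for \<pi>
      using Qs[OF that] Qs[OF inC[OF that]] unfolding invol by blast
    let ?S = "\<Sum>\<pi>\<in>?C. if Q j \<pi> then of_int (sign \<pi>) else (0::complex)"
    have "?S = (\<Sum>\<pi>\<in>?C. if Q j (\<pi> \<circ> ?s) then of_int (sign (\<pi> \<circ> ?s)) else 0)"
      by (rule sum.reindex_bij_betw[OF bij, symmetric])
    also have "\<dots> = (\<Sum>\<pi>\<in>?C. - (if Q j \<pi> then of_int (sign \<pi>) else 0))"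
      by (intro sum.cong refl) (simp add: Qiff sgn)
    also have "\<dots> = - ?S" by (simp add: sum_negf)
    finally show "?S = 0" by simp
  qed
  have "(\<Sum>x\<in>?X. polytabloid D t (\<lambda>i. transpose x k ` T i)) =
      (\<Sum>x\<in>?X. \<Sum>\<pi>\<in>?C. if row_entries D (\<pi> \<circ> t) = U x then of_int (sign \<pi>) else 0)"
    by (intro sum.cong refl) (simp only: U polytabloid_def)
  also have "\<dots> = (\<Sum>\<pi>\<in>?C. \<Sum>x\<in>?X. if row_entries D (\<pi> \<circ> t) = U x then of_int (sign \<pi>) else 0)"
    by (rule sum.swap)
  also have "\<dots> = (\<Sum>\<pi>\<in>?C. \<Sum>j\<in>J. if Q j \<pi> then of_int (sign \<pi>) else 0)"
    by (intro sum.cong refl cnt)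
  also have "\<dots> = (\<Sum>j\<in>J. \<Sum>\<pi>\<in>?C. if Q j \<pi> then of_int (sign \<pi>) else 0)"
    by (rule sum.swap)
  also have "\<dots> = 0" by (intro sum.neutral ballI zero)
  finally show ?thesis .
qed

lemma specht_row_relation:
  assumes D: "D \<in> young_diagrams q" and f: "f \<in> specht D"
    and r: "1 \<le> r'" "r' < r" and k: "k \<in> T r" and fin: "finite (T r')"
    and disj: "\<And>i j. i \<noteq> j \<Longrightarrow> T i \<inter> T j = {}"
  shows "(\<Sum>x\<in>insert k (T r'). f (\<lambda>i. transpose x k ` T i)) = 0"
  using f unfolding specht_def
proof (induction rule: cfun.span_induct)
  show "cfun.subspace {f. (\<Sum>x\<in>insert k (T r'). f (\<lambda>i. transpose x k ` T i)) = 0}"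
    by (rule cfun.subspaceI)
      (auto simp: sum.distrib fun_scale_def sum_distrib_left[symmetric] simp del: sum.insert sum.insert_if)
next
  fix g assume "g \<in> polytabloid D ` tableaux D"
  then show "(\<Sum>x\<in>insert k (T r'). g (\<lambda>i. transpose x k ` T i)) = 0"
    using polytabloid_row_relation[OF D _ r k fin disj] by blast
qed

lemma sum_fun_app: "(\<Sum>x\<in>A. F x) y = (\<Sum>x\<in>A. F x y :: 'b :: comm_monoid_add)"
  by (induction A rule: infinite_finite_induct) auto

section \<open>The row reading tabloid and the eigenvalues of the Jucys-Murphy elements\<close>

definition row_reading :: "diagram \<Rightarrow> nat \<times> nat \<Rightarrow> nat" where
  "row_reading D b = card {b' \<in> D. fst b' < fst b \<or> fst b' = fst b \<and> snd b' \<le> snd b}"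

lemma row_reading_less:
  assumes "finite D" "b' \<in> D" "fst b < fst b' \<or> fst b = fst b' \<and> snd b < snd b'"
  shows "row_reading D b < row_reading D b'"
  unfolding row_reading_def using assms by (intro psubset_card_mono psubsetI) auto

lemma row_reading_less_iff:
  assumes "finite D" "b \<in> D" "b' \<in> D"
  shows "row_reading D b < row_reading D b' \<longleftrightarrow>
    fst b < fst b' \<or> fst b = fst b' \<and> snd b < snd b'"
proof
  assume less: "row_reading D b < row_reading D b'"
  show "fst b < fst b' \<or> fst b = fst b' \<and> snd b < snd b'"
  proof (rule ccontr)
    assume "\<not> (fst b < fst b' \<or> fst b = fst b' \<and> snd b < snd b')"
    then consider "b = b'" | "fst b' < fst b \<or> fst b' = fst b \<and> snd b' < snd b"
      by (metis linorder_neqE_nat prod_eqI)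
    then show False
    proof cases
      case 2
      then show False using row_reading_less[OF assms(1,2), of b'] less by simp
    qed (use less in simp)
  qed
qed (rule row_reading_less[OF assms(1,3)])

lemma row_reading_tableau:
  assumes fin: "finite D"
  shows "row_reading D \<in> tableaux D"
proof -
  have inj: "inj_on (row_reading D) D"
  proof (rule inj_onI, rule ccontr)
    fix b b' assume b: "b \<in> D" "b' \<in> D" "row_reading D b = row_reading D b'" "b \<noteq> b'"
    then have "(fst b < fst b' \<or> fst b = fst b' \<and> snd b < snd b') \<or>
        (fst b' < fst b \<or> fst b' = fst b \<and> snd b' < snd b)"
      by (metis linorder_neqE_nat prod_eqI)
    then show False using row_reading_less[OF fin b(2), of b] row_reading_less[OF fin b(1), of b'] b(3)
      by auto
  qed
  have "row_reading D b \<in> {1..card D}" if "b \<in> D" for b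
  proof -
    have "{b' \<in> D. fst b' < fst b \<or> fst b' = fst b \<and> snd b' \<le> snd b} \<noteq> {}" using that by blast
    then have "row_reading D b \<ge> 1"
      unfolding row_reading_def using fin by (simp add: Suc_le_eq card_gt_0_iff del: Collect_empty_eq)
    moreover have "row_reading D b \<le> card D"
      unfolding row_reading_def using fin by (intro card_mono) auto
    ultimately show ?thesis by simp
  qed
  then have "row_reading D ` D \<subseteq> {1..card D}" by blast
  then have "row_reading D ` D = {1..card D}"
    by (intro card_subset_eq) (simp_all add: card_image[OF inj])
  then show ?thesis using inj unfolding tableaux_def bij_betw_def by simp
qed

lemma row_entries_disjoint:
  assumes "t \<in> tableaux D" "i \<noteq> j"
  shows "row_entries D t i \<inter> row_entries D t j = {}"
proof -
  have "inj_on t D" using assms(1) unfolding tableaux_def bij_betw_def by simp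
  then show ?thesis using assms(2) unfolding row_entries_def by (auto dest: inj_onD)
qed

definition reading_tabloid :: "diagram \<Rightarrow> tabloid" where
  "reading_tabloid D = row_entries D (row_reading D)"

text \<open>
  Evaluation at the row reading tabloid is a simultaneous eigenvector of the transposed
  Jucys-Murphy elements: the smaller entries of the row of \<open>k\<close> contribute \<open>j - 1\<close>, each of the
  \<open>r - 1\<close> rows above it contributes \<open>-1\<close>.
\<close>

lemma jucys_murphy_eigen:
  assumes D: "D \<in> young_diagrams q" and f: "f \<in> specht D" and b: "(r, j) \<in> D"
  defines "k \<equiv> row_reading D (r, j)" and "T \<equiv> reading_tabloid D"
  shows "(\<Sum>i\<in>{1..<k}. f (\<lambda>s. transpose i k ` T s)) = (of_nat j - of_nat r) * f T"
proof -
  let ?t = "row_reading D"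
  note fin = young_diagram_finite[OF D]
  have t: "?t \<in> tableaux D" by (rule row_reading_tableau[OF fin])
  then have inj: "inj_on ?t D" and img: "?t ` D = {1..q}"
    using young_diagram_card[OF D] unfolding tableaux_def bij_betw_def by auto
  have rj: "1 \<le> r" "1 \<le> j" using young_diagram_pos[OF D b] by auto
  have disj: "T s \<inter> T s' = {}" if "s \<noteq> s'" for s s'
    unfolding T_def reading_tabloid_def by (rule row_entries_disjoint[OF t that])
  have finT: "finite (T s)" for s
    unfolding T_def reading_tabloid_def row_entries_def using fin by simp
  have kT: "k \<in> T r" unfolding k_def T_def reading_tabloid_def row_entries_def using b by force
  let ?R = "?t ` ({r} \<times> {1..<j})"
  have RD: "{r} \<times> {1..<j} \<subseteq> D" using young_diagram_down[OF D b] rj by force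
  have RT: "?R \<subseteq> T r" using RD unfolding T_def reading_tabloid_def row_entries_def by auto
  have "k \<le> q" using img b unfolding k_def by (metis atLeastAtMost_iff imageI)
  have union: "{1..<k} = (\<Union>s\<in>{1..<r}. T s) \<union> ?R"
  proof (intro equalityI subsetI)
    fix i assume i: "i \<in> {1..<k}"
    then have "i \<in> ?t ` D" using \<open>k \<le> q\<close> unfolding img by simp
    then obtain b' where b': "b' \<in> D" "i = ?t b'" by blast
    have "fst b' < r \<or> fst b' = r \<and> snd b' < j"
      using row_reading_less_iff[OF fin b'(1) b] i b' unfolding k_def by simp
    then show "i \<in> (\<Union>s\<in>{1..<r}. T s) \<union> ?R"
    proof
      assume "fst b' < r"
      moreover have "1 \<le> fst b'" using young_diagram_pos[OF D] b'(1) by (metis prod.collapse)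
      ultimately show ?thesis using b' unfolding T_def reading_tabloid_def row_entries_def by auto
    next
      assume "fst b' = r \<and> snd b' < j"
      moreover have "1 \<le> snd b'" using young_diagram_pos[OF D] b'(1) by (metis prod.collapse)
      ultimately have "b' \<in> {r} \<times> {1..<j}" by (cases b') auto
      then show ?thesis using b' by blast
    qed
  next
    fix i assume "i \<in> (\<Union>s\<in>{1..<r}. T s) \<union> ?R"
    then obtain b' where b': "b' \<in> D" "i = ?t b'" "fst b' < r \<or> fst b' = r \<and> snd b' < j"
      using RD unfolding T_def reading_tabloid_def row_entries_def by fastforce
    then have "i < k" using row_reading_less_iff[OF fin b'(1) b] unfolding k_def by simp
    moreover have "i \<in> {1..q}" using b' img by blast
    ultimately show "i \<in> {1..<k}" by simp
  qed
  have "(\<Sum>i\<in>(\<Union>s\<in>{1..<r}. T s). f (\<lambda>s. transpose i k ` T s)) =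
      (\<Sum>s\<in>{1..<r}. \<Sum>i\<in>T s. f (\<lambda>s. transpose i k ` T s))"
    using finT disj by (intro sum.UNION_disjoint) auto
  also have "\<dots> = (\<Sum>s\<in>{1..<r}. - f T)"
  proof (intro sum.cong refl)
    fix s assume s: "s \<in> {1..<r}"
    have "k \<notin> T s" using disj[of s r] kT s by auto
    moreover have "(\<Sum>x\<in>insert k (T s). f (\<lambda>i. transpose x k ` T i)) = 0"
      using s by (intro specht_row_relation[OF D f, where T = T and r = r] kT finT disj) auto
    \<comment> \<open>The term for \<open>x = k\<close> is \<open>f T\<close>, because
      \<open>transpose k k\<close> is the identity; the remaining terms of row \<open>s\<close>
      therefore add up to \<open>- f T\<close>.\<close>
    ultimately have "f (\<lambda>i. transpose k k ` T i) + (\<Sum>x\<in>T s. f (\<lambda>i. transpose x k ` T i)) = 0"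
      using finT by simp
    then show "(\<Sum>i\<in>T s. f (\<lambda>s. transpose i k ` T s)) = - f T"
      unfolding add_eq_0_iff by simp
  qed
  finally have A: "(\<Sum>i\<in>(\<Union>s\<in>{1..<r}. T s). f (\<lambda>s. transpose i k ` T s)) = - (of_nat (r - 1) * f T)"
    by simp
  have "f (\<lambda>s. transpose i k ` T s) = f T" if "i \<in> ?R" for i
  proof -
    have "transpose i k ` T s = T s" for s
    proof (cases "s = r")
      case True
      then show ?thesis using RT that kT by (intro transpose_image_eq) auto
    next
      case False
      then show ?thesis using disj[OF False] RT that kT by (intro transpose_image_eq) auto
    qed
    then show ?thesis by simp
  qed
  then have "(\<Sum>i\<in>?R. f (\<lambda>s. transpose i k ` T s)) = of_nat (card ?R) * f T" by simp
  also have "card ?R = j - 1" by (subst card_image[OF inj_on_subset[OF inj RD]]) simp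
  finally have B: "(\<Sum>i\<in>?R. f (\<lambda>s. transpose i k ` T s)) = of_nat (j - 1) * f T" .
  have "(\<Union>s\<in>{1..<r}. T s) \<inter> ?R = {}" using RT disj[of _ r] by fastforce
  then have "(\<Sum>i\<in>{1..<k}. f (\<lambda>s. transpose i k ` T s)) = - (of_nat (r - 1) * f T) + of_nat (j - 1) * f T"
    unfolding union using finT A B by (subst sum.union_disjoint) auto
  then show ?thesis using rj by (simp add: of_nat_diff algebra_simps)
qed

section \<open>Specht vectors are determined on one orbit of tabloids\<close>

lemma tableaux_transitive:
  assumes "t \<in> tableaux D" "t' \<in> tableaux D"
  obtains h where "h \<in> sym_group (card D)" "\<And>b. b \<in> D \<Longrightarrow> h (t b) = t' b"
proof -
  let ?g = "t' \<circ> inv_into D t"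
  let ?h = "\<lambda>i. if i \<in> {1..card D} then ?g i else i"
  have "bij_betw ?g {1..card D} {1..card D}"
    using assms unfolding tableaux_def by (auto intro: bij_betw_trans bij_betw_inv_into)
  then have "bij_betw ?h {1..card D} {1..card D}" by (rule bij_betw_cong[THEN iffD1, rotated]) simp
  then have "?h permutes {1..card D}" by (rule bij_imp_permutes) auto
  moreover have "?h (t b) = t' b" if "b \<in> D" for b
    using assms(1) that unfolding tableaux_def by (auto simp: bij_betw_def inv_into_f_f)
  ultimately show thesis using that unfolding sym_group_def by blast
qed

lemma row_entries_cong: "(\<And>b. b \<in> D \<Longrightarrow> t b = t' b) \<Longrightarrow> row_entries D t = row_entries D t'"
  unfolding row_entries_def by (auto intro!: image_cong)

text \<open>Any two tableaux of the same shape differ by a permutation of the entries, so every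
  tabloid occurring in a polytabloid is a translate of the reading tabloid.\<close>

lemma specht_support:
  assumes D: "D \<in> young_diagrams q" and f: "f \<in> specht D"
    and T: "\<And>h. h \<in> sym_group q \<Longrightarrow> T \<noteq> (\<lambda>i. h ` reading_tabloid D i)"
  shows "f T = 0"
  using f unfolding specht_def
proof (induction rule: cfun.span_induct)
  show "cfun.subspace {f. f T = 0}" by (rule cfun.subspaceI) (auto simp: fun_scale_def)
next
  fix g assume "g \<in> polytabloid D ` tableaux D"
  then obtain t where t: "t \<in> tableaux D" and g: "g = polytabloid D t" by blast
  have "row_entries D (\<pi> \<circ> t) \<noteq> T" if "\<pi> \<in> column_group D t" for \<pi>
  proof -
    have "\<pi> \<circ> t \<in> tableaux D" using that t tableaux_comp unfolding column_group_def by auto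
    then obtain h where h: "h \<in> sym_group (card D)" "\<And>b. b \<in> D \<Longrightarrow> h (row_reading D b) = (\<pi> \<circ> t) b"
      using tableaux_transitive[OF row_reading_tableau[OF young_diagram_finite[OF D]]] by blast
    have "row_entries D (\<pi> \<circ> t) = row_entries D (h \<circ> row_reading D)"
      using h(2) by (intro row_entries_cong) simp
    then show ?thesis
      using T[of h] h(1) young_diagram_card[OF D] unfolding row_entries_comp reading_tabloid_def by auto
  qed
  then show "g T = 0" unfolding g polytabloid_def by (intro sum.neutral) auto
qed

text \<open>A column permutation that also preserves every row fixes each entry, since row and
  column determine the box. Only the identity contributes, so Specht modules are nonzero.\<close>

lemma polytabloid_leading_coeff:
  assumes t: "t \<in> tableaux D"
  shows "polytabloid D t (row_entries D t) = 1"
proof -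
  have bij: "bij_betw t D {1..card D}" using t unfolding tableaux_def by simp
  have iff: "row_entries D (\<pi> \<circ> t) = row_entries D t \<longleftrightarrow> \<pi> = id" if \<pi>: "\<pi> \<in> column_group D t" for \<pi>
  proof
    assume row: "row_entries D (\<pi> \<circ> t) = row_entries D t"
    have "\<pi> i = i" for i
    proof (cases "i \<in> {1..card D}")
      case True
      then obtain b where b: "b \<in> D" "i = t b" using bij unfolding bij_betw_def by blast
      have "\<pi> i \<in> row_entries D (\<pi> \<circ> t) (fst b)" unfolding row_entries_def using b by auto
      then obtain b1 where b1: "b1 \<in> D" "fst b1 = fst b" "\<pi> i = t b1"
        unfolding row row_entries_def by auto
      have "\<pi> i \<in> \<pi> ` column_entries D t (snd b)" unfolding column_entries_def using b by auto
      also have "\<dots> = column_entries D t (snd b)" using \<pi> unfolding column_group_def by simp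
      finally obtain b2 where b2: "b2 \<in> D" "snd b2 = snd b" "\<pi> i = t b2"
        unfolding column_entries_def by auto
      have "b1 = b2" using bij b1 b2 unfolding bij_betw_def by (metis inj_onD)
      then have "b1 = b" using b1 b2 by (simp add: prod_eq_iff)
      then show ?thesis using b b1 by simp
    next
      case False
      then show ?thesis using \<pi> unfolding column_group_def sym_group_def permutes_def by simp
    qed
    then show "\<pi> = id" by auto
  qed simp
  have id: "id \<in> column_group D t" unfolding column_group_def sym_group_def by (simp add: permutes_id)
  have "polytabloid D t (row_entries D t) = (\<Sum>\<pi>\<in>column_group D t. if \<pi> = id then 1 else 0)"
    unfolding polytabloid_def by (intro sum.cong refl) (auto simp: iff)
  also have "\<dots> = 1" using id finite_column_group by simp
  finally show ?thesis .
qed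

lemma specht_nonzero:
  assumes "D \<in> young_diagrams q"
  obtains f where "f \<in> specht D" "f (reading_tabloid D) = 1"
proof
  have t: "row_reading D \<in> tableaux D" by (rule row_reading_tableau[OF young_diagram_finite[OF assms]])
  show "polytabloid D (row_reading D) \<in> specht D"
    unfolding specht_def using t by (intro cfun.span_base) auto
  show "polytabloid D (row_reading D) (reading_tabloid D) = 1"
    unfolding reading_tabloid_def by (rule polytabloid_leading_coeff[OF t])
qed

text \<open>Takes the place of Schur's lemma. The value of \<open>A f\<close> at a translate of the
  reading tabloid is, by equivariance, the value of \<open>A\<close> applied to a translated vector
  at the reading tabloid itself, where \<open>A\<close> is known; elsewhere both sides
  vanish.\<close>

lemma specht_scalar:
  assumes D: "D \<in> young_diagrams q" and f: "f \<in> specht D"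
    and A: "\<And>f. f \<in> specht D \<Longrightarrow> A f \<in> specht D"
    and comm: "\<And>f h. f \<in> specht D \<Longrightarrow> h \<in> sym_group q \<Longrightarrow> A (perm_action h f) = perm_action h (A f)"
    and a: "\<And>f. f \<in> specht D \<Longrightarrow> A f (reading_tabloid D) = a * f (reading_tabloid D)"
  shows "A f = fun_scale a f"
proof
  fix T
  show "A f T = fun_scale a f T"
  proof (cases "\<exists>h\<in>sym_group q. T = (\<lambda>i. h ` reading_tabloid D i)")
    case True
    then obtain h where h: "h \<in> sym_group q" and T: "T = (\<lambda>i. h ` reading_tabloid D i)" by blast
    have app: "g T = perm_action (inv h) g (reading_tabloid D)" for g :: "tabloid \<Rightarrow> complex"
      unfolding perm_action_def T sym_group_inverses(4)[OF h] ..
    have pf: "perm_action (inv h) f \<in> specht D"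
      using perm_action_specht[of "inv h" D f] sym_group_inv[OF h] f young_diagram_card[OF D] by simp
    have "A f T = A (perm_action (inv h) f) (reading_tabloid D)"
      unfolding app using comm[OF f sym_group_inv[OF h]] by simp
    also have "\<dots> = a * f T" unfolding app by (rule a[OF pf])
    finally show ?thesis by (simp add: fun_scale_def)
  next
    case False
    then show ?thesis using specht_support[OF D f] specht_support[OF D A[OF f]]
      by (simp add: fun_scale_def)
  qed
qed

text \<open>Tableaux are total functions, so a shape has infinitely many of them. The polytabloid
  sees only the restriction to \<open>D\<close>, which leaves finitely many possibilities.\<close>

lemma finite_polytabloids:
  assumes "finite D"
  shows "finite (polytabloid D ` tableaux D)"
proof (rule finite_subset)
  show "polytabloid D ` tableaux D \<subseteq> polytabloid D ` (D \<rightarrow>\<^sub>E {1..card D})"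
  proof
    fix g assume "g \<in> polytabloid D ` tableaux D"
    then obtain t where t: "t \<in> tableaux D" "g = polytabloid D t" by blast
    have c: "column_entries D (restrict t D) = column_entries D t"
      unfolding column_entries_def by (auto simp: fun_eq_iff)
    have r: "row_entries D (\<pi> \<circ> restrict t D) = row_entries D (\<pi> \<circ> t)" for \<pi> :: "nat \<Rightarrow> nat"
      by (rule row_entries_cong) simp
    have "g = polytabloid D (restrict t D)"
      unfolding t(2) polytabloid_def column_group_def c r ..
    moreover have "restrict t D \<in> D \<rightarrow>\<^sub>E {1..card D}"
      using t(1) unfolding tableaux_def by (auto dest: bij_betwE)
    ultimately show "g \<in> polytabloid D ` (D \<rightarrow>\<^sub>E {1..card D})" by blast
  qed
  show "finite (polytabloid D ` (D \<rightarrow>\<^sub>E {1..card D}))"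
    using assms by (intro finite_imageI finite_PiE) auto
qed

section \<open>Traces and normalized characters\<close>

text \<open>The same choice term as in \<open>trace_on\<close>, so that the trace is literally a sum
  over this basis.\<close>

definition specht_basis :: "diagram \<Rightarrow> (tabloid \<Rightarrow> complex) set" where
  "specht_basis D = (SOME B. B \<subseteq> specht D \<and> cfun.independent B \<and> cfun.span B = specht D)"

lemma specht_basis:
  "specht_basis D \<subseteq> specht D" "cfun.independent (specht_basis D)"
  "cfun.span (specht_basis D) = specht D"
proof -
  obtain B where B: "B \<subseteq> specht D" "cfun.independent B" "specht D \<subseteq> cfun.span B"
    "card B = cfun.dim (specht D)"
    by (rule cfun.basis_exists[of "specht D"])
  have "cfun.span B \<subseteq> specht D"
    using B(1) unfolding specht_def by (metis cfun.span_mono cfun.span_span)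
  with B have "\<exists>B. B \<subseteq> specht D \<and> cfun.independent B \<and> cfun.span B = specht D" by blast
  from someI_ex[OF this] show "specht_basis D \<subseteq> specht D" "cfun.independent (specht_basis D)"
    "cfun.span (specht_basis D) = specht D"
    unfolding specht_basis_def by auto
qed

lemma finite_specht_basis:
  assumes "finite D"
  shows "finite (specht_basis D)"
proof -
  have "specht_basis D \<subseteq> cfun.span (polytabloid D ` tableaux D)"
    using specht_basis(1)[of D] unfolding specht_def .
  from cfun.independent_span_bound[OF finite_polytabloids[OF assms] specht_basis(2) this]
  show ?thesis ..
qed

lemma dim_specht: "cfun.dim (specht D) = card (specht_basis D)"
proof (rule cfun.dim_eq_card)
  show "cfun.span (specht_basis D) = cfun.span (specht D)"
    unfolding specht_basis(3) unfolding specht_def cfun.span_span ..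
qed (rule specht_basis(2))

lemma dim_specht_pos:
  assumes "D \<in> young_diagrams q"
  shows "cfun.dim (specht D) > 0"
proof -
  obtain f where f: "f \<in> specht D" "f (reading_tabloid D) = 1" using specht_nonzero[OF assms] .
  have "specht_basis D \<noteq> {}"
  proof
    assume "specht_basis D = {}"
    then have "specht D = {0}" using specht_basis(3) by (metis cfun.span_empty)
    then show False using f by auto
  qed
  then show ?thesis
    unfolding dim_specht using finite_specht_basis[OF young_diagram_finite[OF assms]]
    by (simp add: card_gt_0_iff)
qed

lemma trace_on_specht:
  "trace_on (specht D) A =
    (\<Sum>b\<in>specht_basis D. cfun.representation (specht_basis D) (A b) b)"
  unfolding trace_on_def specht_basis_def Let_def ..

lemma perm_action_sum_scale:
  "perm_action \<sigma> (\<Sum>x\<in>A. fun_scale (r x) (F x)) = (\<Sum>x\<in>A. fun_scale (r x) (perm_action \<sigma> (F x)))"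
  by (rule ext) (simp add: perm_action_def fun_scale_def sum_fun_app)

lemma specht_sum_scale:
  "(\<And>x. x \<in> A \<Longrightarrow> F x \<in> specht D) \<Longrightarrow> (\<Sum>x\<in>A. fun_scale (r x) (F x)) \<in> specht D"
  unfolding specht_def by (intro cfun.span_sum cfun.span_scale)

lemma representation_sum_scale:
  assumes "\<And>x. x \<in> A \<Longrightarrow> F x \<in> specht D"
  shows "cfun.representation (specht_basis D) (\<Sum>x\<in>A. fun_scale (r x) (F x)) b =
    (\<Sum>x\<in>A. r x * cfun.representation (specht_basis D) (F x) b)"
proof -
  have "cfun.representation (specht_basis D) (\<Sum>x\<in>A. fun_scale (r x) (F x)) =
    (\<lambda>b. \<Sum>x\<in>A. cfun.representation (specht_basis D) (fun_scale (r x) (F x)) b)"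
  proof (rule cfun.representation_sum[OF specht_basis(2)])
    show "fun_scale (r x) (F x) \<in> cfun.span (specht_basis D)" if "x \<in> A" for x
      using assms[OF that] specht_basis(3)[of D] by (intro cfun.span_scale) simp
  qed
  moreover have "cfun.representation (specht_basis D) (fun_scale (r x) (F x)) =
      (\<lambda>b. r x * cfun.representation (specht_basis D) (F x) b)" if "x \<in> A" for x
    using assms that specht_basis by (intro cfun.representation_scale) auto
  ultimately show ?thesis by simp
qed

lemma trace_on_specht_commute:
  assumes D: "D \<in> young_diagrams q" and s: "\<sigma> \<in> sym_group q" "\<tau> \<in> sym_group q"
  shows "trace_on (specht D) (perm_action (\<sigma> \<circ> \<tau>)) = trace_on (specht D) (perm_action (\<tau> \<circ> \<sigma>))"
proof -
  let ?B = "specht_basis D" and ?rep = "cfun.representation (specht_basis D)"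
  note fin = finite_specht_basis[OF young_diagram_finite[OF D]]
  have B: "b \<in> specht D" if "b \<in> ?B" for b using specht_basis(1) that by blast
  have inv: "perm_action \<sigma> b \<in> specht D" if "\<sigma> \<in> sym_group q" "b \<in> specht D" for \<sigma> b
    using perm_action_specht that young_diagram_card[OF D] by blast
  have "trace_on (specht D) (perm_action (\<sigma> \<circ> \<tau>)) =
      (\<Sum>b\<in>?B. \<Sum>c\<in>?B. ?rep (perm_action \<tau> b) c * ?rep (perm_action \<sigma> c) b)"
    if s: "\<sigma> \<in> sym_group q" "\<tau> \<in> sym_group q" for \<sigma> \<tau>
    unfolding trace_on_specht
  proof (intro sum.cong refl)
    fix b assume b: "b \<in> ?B"
    have e: "perm_action \<tau> b = (\<Sum>c\<in>?B. fun_scale (?rep (perm_action \<tau> b) c) c)"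
      using cfun.sum_representation_eq[OF specht_basis(2) _ fin subset_refl, of "perm_action \<tau> b"]
        inv[OF s(2) B[OF b]] specht_basis(3)[of D] by simp
    have "perm_action (\<sigma> \<circ> \<tau>) b = perm_action \<sigma> (perm_action \<tau> b)"
      by (rule perm_action_comp[OF sym_group_inverses(1)[OF s(1)] sym_group_inverses(1)[OF s(2)]])
    also have "\<dots> = perm_action \<sigma> (\<Sum>c\<in>?B. fun_scale (?rep (perm_action \<tau> b) c) c)"
      by (rule arg_cong[OF e])
    also have "\<dots> = (\<Sum>c\<in>?B. fun_scale (?rep (perm_action \<tau> b) c) (perm_action \<sigma> c))"
      by (rule perm_action_sum_scale)
    finally have d: "perm_action (\<sigma> \<circ> \<tau>) b = \<dots>" .
    have "?rep (\<Sum>c\<in>?B. fun_scale (?rep (perm_action \<tau> b) c) (perm_action \<sigma> c)) b =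
        (\<Sum>c\<in>?B. ?rep (perm_action \<tau> b) c * ?rep (perm_action \<sigma> c) b)"
      by (rule representation_sum_scale) (rule inv[OF s(1) B])
    then show "?rep (perm_action (\<sigma> \<circ> \<tau>) b) b =
        (\<Sum>c\<in>?B. ?rep (perm_action \<tau> b) c * ?rep (perm_action \<sigma> c) b)"
      unfolding d .
  qed
  note tr = this
  show ?thesis unfolding tr[OF s] tr[OF s(2,1)]
    by (subst sum.swap) (simp add: mult.commute)
qed

lemma norm_character_central:
  assumes D: "D \<in> young_diagrams q" and s: "\<sigma> \<in> sym_group q" "\<tau> \<in> sym_group q"
  shows "norm_character D (\<tau> \<circ> \<sigma> \<circ> inv \<tau>) = norm_character D \<sigma>"
proof -
  have "inv \<tau> \<circ> (\<tau> \<circ> \<sigma>) = \<sigma>"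
    using sym_group_inverses(5)[OF s(2)] by (simp add: fun_eq_iff)
  then show ?thesis
    using trace_on_specht_commute[OF D sym_group_comp[OF s(2,1)] sym_group_inv[OF s(2)]]
    unfolding norm_character_def by simp
qed

text \<open>The trace of the scalar operator is \<open>a\<close> times the dimension, and the
  normalization divides by the dimension, which is positive.\<close>

lemma norm_character_scalar:
  assumes D: "D \<in> young_diagrams q" and G: "G \<subseteq> sym_group q"
    and scal: "\<And>f. f \<in> specht D \<Longrightarrow> (\<Sum>g\<in>G. fun_scale (x g) (perm_action g f)) = fun_scale a f"
  shows "(\<Sum>g\<in>G. x g * norm_character D g) = a"
proof -
  let ?B = "specht_basis D" and ?rep = "cfun.representation (specht_basis D)"
  have B: "b \<in> specht D" if "b \<in> ?B" for b using specht_basis(1) that by blast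
  have inv: "perm_action g b \<in> specht D" if "g \<in> G" "b \<in> specht D" for g b
    using perm_action_specht that G young_diagram_card[OF D] by blast
  have "(\<Sum>g\<in>G. x g * trace_on (specht D) (perm_action g)) =
      (\<Sum>b\<in>?B. \<Sum>g\<in>G. x g * ?rep (perm_action g b) b)"
    unfolding trace_on_specht by (subst sum.swap) (simp add: sum_distrib_left)
  also have "\<dots> = (\<Sum>b\<in>?B. a)"
  proof (intro sum.cong refl)
    fix b assume b: "b \<in> ?B"
    have "(\<Sum>g\<in>G. x g * ?rep (perm_action g b) b) = ?rep (fun_scale a b) b"
      using representation_sum_scale[of G "\<lambda>g. perm_action g b" D x b] inv B[OF b] scal[OF B[OF b]]
      by simp
    also have "\<dots> = a * ?rep b b"
      using B[OF b] specht_basis by (subst cfun.representation_scale) auto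
    also have "\<dots> = a" using cfun.representation_basis[OF specht_basis(2) b] by simp
    finally show "(\<Sum>g\<in>G. x g * ?rep (perm_action g b) b) = a" .
  qed
  also have "\<dots> = of_nat (cfun.dim (specht D)) * a" by (simp add: dim_specht)
  finally show ?thesis
    using dim_specht_pos[OF D] unfolding norm_character_def
    by (simp add: sum_divide_distrib[symmetric] field_simps)
qed

lemma id_in_sym_group: "id \<in> sym_group q"
  unfolding sym_group_def mem_Collect_eq by (rule permutes_id)

lemma norm_character_id:
  assumes "D \<in> young_diagrams q"
  shows "norm_character D id = 1"
proof -
  have "(\<Sum>g\<in>{id}. fun_scale 1 (perm_action g f)) = fun_scale 1 f" for f
    by (simp add: perm_action_id)
  moreover have "{id} \<subseteq> sym_group q" using id_in_sym_group by simp
  ultimately have "(\<Sum>g\<in>{id}. 1 * norm_character D g) = 1"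
    by (intro norm_character_scalar[OF assms, where x = "\<lambda>_. 1"]) simp_all
  then show ?thesis by simp
qed

section \<open>The group algebra of finitary permutations\<close>

text \<open>
  The group is written additively because the ring structure on \<open>poly_mapping\<close> is defined for
  additive monoids of exponents.
\<close>

typedef fperm = "{\<sigma> :: nat \<Rightarrow> nat. permutation \<sigma>}"
  morphisms app Abs_fperm
  using permutation_id by blast

setup_lifting type_definition_fperm

instantiation fperm :: group_add
begin

lift_definition zero_fperm :: fperm is id by (rule permutation_id)
lift_definition plus_fperm :: "fperm \<Rightarrow> fperm \<Rightarrow> fperm" is "(\<circ>)" by (rule permutation_compose)
lift_definition uminus_fperm :: "fperm \<Rightarrow> fperm" is inv by (rule permutation_inverse)
definition minus_fperm :: "fperm \<Rightarrow> fperm \<Rightarrow> fperm" where "minus_fperm g h = g + (- h)"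

instance
proof
  fix a b c :: fperm
  show "a + b + c = a + (b + c)" by transfer (rule comp_assoc)
  show "0 + a = a" by transfer simp
  show "a + 0 = a" by transfer simp
  show "- a + a = 0" by transfer (simp add: permutation_inverse_works)
  show "a + - b = a - b" by (simp add: minus_fperm_def)
qed

end

lemma app_zero: "app 0 = id" by (rule zero_fperm.rep_eq)
lemma app_plus: "app (g + h) = app g \<circ> app h" by (rule plus_fperm.rep_eq)
lemma app_uminus: "app (- g) = inv (app g)" by (rule uminus_fperm.rep_eq)
lemma bij_app: "bij (app g)" using app[of g] by (simp add: permutation_bijective)

definition Sym :: "nat \<Rightarrow> fperm set" where
  "Sym q = {g. app g \<in> sym_group q}"

lemma Sym_zero: "0 \<in> Sym q"
  unfolding Sym_def mem_Collect_eq app_zero by (rule id_in_sym_group)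

lemma Sym_plus: "g \<in> Sym q \<Longrightarrow> h \<in> Sym q \<Longrightarrow> g + h \<in> Sym q"
  unfolding Sym_def mem_Collect_eq app_plus by (rule sym_group_comp)

lemma Sym_uminus: "g \<in> Sym q \<Longrightarrow> - g \<in> Sym q"
  unfolding Sym_def mem_Collect_eq app_uminus by (rule sym_group_inv)

lemma Sym_uminus_iff: "- g \<in> Sym q \<longleftrightarrow> g \<in> Sym q"
  using Sym_uminus[of g q] Sym_uminus[of "- g" q] by auto

lemma Sym_plus_left_iff: "g \<in> Sym q \<Longrightarrow> g + h \<in> Sym q \<longleftrightarrow> h \<in> Sym q"
  using Sym_plus[of g q h] Sym_plus[OF Sym_uminus, of g q "g + h"] by (auto simp: add.assoc[symmetric])

lemma Sym_plus_right_iff: "g \<in> Sym q \<Longrightarrow> h + g \<in> Sym q \<longleftrightarrow> h \<in> Sym q"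
  using Sym_plus[of h q g] Sym_plus[OF _ Sym_uminus, of "h + g" q g] by (auto simp: add.assoc)

lemma Sym_mono: "p \<le> q \<Longrightarrow> Sym p \<subseteq> Sym q"
  unfolding Sym_def sym_group_def by (auto intro: permutes_subset)

lemma app_Sym: "app ` Sym q = sym_group q"
proof
  show "sym_group q \<subseteq> app ` Sym q"
  proof
    fix \<sigma> assume s: "\<sigma> \<in> sym_group q"
    then have "permutation \<sigma>" by (rule sym_group_permutation)
    then have "app (Abs_fperm \<sigma>) = \<sigma>" by (intro Abs_fperm_inverse) simp
    then show "\<sigma> \<in> app ` Sym q" using s unfolding Sym_def by (metis imageI mem_Collect_eq)
  qed
qed (auto simp: Sym_def)

lemma inj_on_app: "inj_on app A"
  by (auto intro!: inj_onI simp: app_inject)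

lemma finite_Sym: "finite (Sym q)"
  using finite_imageD[OF _ inj_on_app, of "Sym q"] finite_sym_group[of q] unfolding app_Sym .

lift_definition swap :: "nat \<Rightarrow> nat \<Rightarrow> fperm" is transpose by (rule permutation_swap_id)

lemma app_swap: "app (swap a b) = transpose a b" by (rule swap.rep_eq)

lemma swap_Sym: "a \<in> {1..q} \<Longrightarrow> b \<in> {1..q} \<Longrightarrow> swap a b \<in> Sym q"
  unfolding Sym_def sym_group_def by (simp add: app_swap permutes_swap_id)

lemma swap_twice: "swap a b + swap a b = 0"
  unfolding app_inject[symmetric] app_plus app_swap app_zero by simp

lemma plus_swap: "g + swap a b = swap (app g a) (app g b) + g"
proof -
  have "app g (transpose a b x) = transpose (app g a) (app g b) (app g x)" for x
    using bij_is_inj[OF bij_app[of g]] by (auto simp: Transposition.transpose_def dest: injD)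
  then show ?thesis
    unfolding app_inject[symmetric] app_plus app_swap by (simp add: fun_eq_iff)
qed

type_synonym galg = "fperm \<Rightarrow>\<^sub>0 complex"

abbreviation gel :: "fperm \<Rightarrow> galg" where "gel g \<equiv> Poly_Mapping.single g 1"

definition lin :: "(fperm \<Rightarrow> complex) \<Rightarrow> galg \<Rightarrow> complex" where
  "lin \<phi> x = (\<Sum>g\<in>Poly_Mapping.keys x. Poly_Mapping.lookup x g * \<phi> g)"

lemma lin_superset:
  assumes "finite A" "Poly_Mapping.keys x \<subseteq> A"
  shows "lin \<phi> x = (\<Sum>g\<in>A. Poly_Mapping.lookup x g * \<phi> g)"
  unfolding lin_def using assms by (intro sum.mono_neutral_left) (auto simp: in_keys_iff)

lemma lin_zero [simp]: "lin \<phi> 0 = 0" by (simp add: lin_def)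

lemma lin_single [simp]: "lin \<phi> (Poly_Mapping.single g a) = a * \<phi> g"
  by (cases "a = 0") (auto simp: lin_def)

lemma lin_one [simp]: "lin \<phi> 1 = \<phi> 0"
  using lin_single[of \<phi> 0 1] by simp

lemma lin_add [simp]: "lin \<phi> (x + y) = lin \<phi> x + lin \<phi> y"
proof -
  let ?A = "Poly_Mapping.keys x \<union> Poly_Mapping.keys y"
  have "lin \<phi> (x + y) = (\<Sum>g\<in>?A. Poly_Mapping.lookup (x + y) g * \<phi> g)"
    using Poly_Mapping.keys_add[of x y] by (intro lin_superset) auto
  also have "\<dots> = (\<Sum>g\<in>?A. Poly_Mapping.lookup x g * \<phi> g) + (\<Sum>g\<in>?A. Poly_Mapping.lookup y g * \<phi> g)"
    by (simp add: lookup_add distrib_right sum.distrib)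
  also have "\<dots> = lin \<phi> x + lin \<phi> y"
    by (intro arg_cong2[where f="(+)"] lin_superset[symmetric]) auto
  finally show ?thesis .
qed

lemma lin_sum: "lin \<phi> (\<Sum>i\<in>I. F i) = (\<Sum>i\<in>I. lin \<phi> (F i))"
  by (induction I rule: infinite_finite_induct) auto

lemma galg_expansion: "x = (\<Sum>g\<in>Poly_Mapping.keys x. Poly_Mapping.single g (Poly_Mapping.lookup x g))"
proof (rule poly_mapping_eqI)
  fix k
  have "Poly_Mapping.lookup (\<Sum>g\<in>Poly_Mapping.keys x. Poly_Mapping.single g (Poly_Mapping.lookup x g)) k =
      (\<Sum>g\<in>Poly_Mapping.keys x. if g = k then Poly_Mapping.lookup x g else 0)"
    unfolding lookup_sum by (intro sum.cong refl) (simp add: lookup_single when_def)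
  then show "Poly_Mapping.lookup x k = Poly_Mapping.lookup (\<Sum>g\<in>Poly_Mapping.keys x. Poly_Mapping.single g (Poly_Mapping.lookup x g)) k"
    by (auto simp: in_keys_iff)
qed

definition alg :: "nat \<Rightarrow> galg set" where
  "alg q = {x. Poly_Mapping.keys x \<subseteq> Sym q}"

lemma galg_induct [consumes 1, case_names zero add single]:
  assumes x: "Poly_Mapping.keys x \<subseteq> G"
    and zero: "P 0" and add: "\<And>x y. P x \<Longrightarrow> P y \<Longrightarrow> P (x + y)"
    and single: "\<And>g a. g \<in> G \<Longrightarrow> P (Poly_Mapping.single g a)"
  shows "P (x :: galg)"
proof -
  have "P (\<Sum>g\<in>A. Poly_Mapping.single g (Poly_Mapping.lookup x g))" if "A \<subseteq> G" for A
    using that by (induction A rule: infinite_finite_induct) (auto simp: zero intro: add single)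
  then show ?thesis using x galg_expansion[of x] by metis
qed

lemma galg_induct_UNIV [case_names zero add single]:
  assumes "P 0" "\<And>x y. P x \<Longrightarrow> P y \<Longrightarrow> P (x + y)"
    and "\<And>g a. P (Poly_Mapping.single g a)"
  shows "P (x :: galg)"
  using subset_UNIV[of "Poly_Mapping.keys x"] by (induction x rule: galg_induct) (use assms in auto)

lemma alg_zero: "0 \<in> alg q" by (simp add: alg_def)
lemma alg_single: "g \<in> Sym q \<Longrightarrow> Poly_Mapping.single g a \<in> alg q"
  by (simp add: alg_def)
lemma alg_one: "1 \<in> alg q" using alg_single[OF Sym_zero, of 1] by simp
lemma alg_add: "x \<in> alg q \<Longrightarrow> y \<in> alg q \<Longrightarrow> x + y \<in> alg q"
  unfolding alg_def using Poly_Mapping.keys_add[of x y] by auto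
lemma alg_mult: "x \<in> alg q \<Longrightarrow> y \<in> alg q \<Longrightarrow> x * y \<in> alg q"
  unfolding alg_def using keys_mult[of x y] Sym_plus by fastforce
lemma alg_power: "x \<in> alg q \<Longrightarrow> x ^ l \<in> alg q"
  by (induction l) (auto intro: alg_one alg_mult)
lemma alg_sum: "(\<And>i. i \<in> I \<Longrightarrow> F i \<in> alg q) \<Longrightarrow> (\<Sum>i\<in>I. F i) \<in> alg q"
  by (induction I rule: infinite_finite_induct) (auto intro: alg_zero alg_add)
lemma alg_keys: "x \<in> alg q \<Longrightarrow> Poly_Mapping.keys x \<subseteq> Sym q" by (simp add: alg_def)

lemma lin_single_mult: "lin \<phi> (Poly_Mapping.single h a * x) = a * lin (\<lambda>g. \<phi> (h + g)) x"
  by (induction x rule: galg_induct_UNIV) (auto simp: distrib_left mult_single)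

lemma lin_mult_single: "lin \<phi> (x * Poly_Mapping.single h a) = lin (\<lambda>g. \<phi> (g + h)) x * a"
  by (induction x rule: galg_induct_UNIV) (auto simp: distrib_right mult_single)

lemma lin_mult: "lin \<phi> (x * y) = lin (\<lambda>g. lin (\<lambda>h. \<phi> (g + h)) y) x"
  by (induction x rule: galg_induct_UNIV) (auto simp: distrib_right lin_single_mult)

lemma lin_cong: "(\<And>g. g \<in> Poly_Mapping.keys x \<Longrightarrow> \<phi> g = \<psi> g) \<Longrightarrow> lin \<phi> x = lin \<psi> x"
  by (simp add: lin_def)

lemma lin_scale: "lin (\<lambda>g. a * \<phi> g) x = a * lin \<phi> x"
  by (simp add: lin_def sum_distrib_left algebra_simps)

lemma lin_fun_add: "lin (\<lambda>g. \<phi> g + \<psi> g) x = lin \<phi> x + lin \<psi> x"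
  by (simp add: lin_def sum.distrib algebra_simps)

lemma lin_fun_sum: "lin (\<lambda>g. \<Sum>i\<in>I. \<phi> i g) x = (\<Sum>i\<in>I. lin (\<phi> i) x)"
  by (induction I rule: infinite_finite_induct) (auto simp: lin_fun_add, auto simp: lin_def)

lemma lookup_mult_lin_left: "Poly_Mapping.lookup (x * y) k = lin (\<lambda>g. Poly_Mapping.lookup y (- g + k)) x"
proof -
  have eq: "(g :: fperm) = - h + k \<longleftrightarrow> k = h + g" for g h
    by (metis add.assoc add.left_neutral add.right_inverse left_minus)
  have "Poly_Mapping.lookup (Poly_Mapping.single h a * y) k = a * Poly_Mapping.lookup y (- h + k)" for h a
    by (induction y rule: galg_induct_UNIV)
      (auto simp: distrib_left mult_single lookup_add lookup_single when_def eq)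
  then show ?thesis
    by (induction x rule: galg_induct_UNIV) (auto simp: distrib_right lookup_add)
qed

lemma lookup_mult_lin_right: "Poly_Mapping.lookup (x * y) k = lin (\<lambda>g. Poly_Mapping.lookup x (k - g)) y"
proof -
  have eq: "(g :: fperm) = k - h \<longleftrightarrow> k = g + h" for g h by (auto simp: algebra_simps)
  have "Poly_Mapping.lookup (x * Poly_Mapping.single h a) k = Poly_Mapping.lookup x (k - h) * a" for h a
    by (induction x rule: galg_induct_UNIV)
      (auto simp: distrib_right mult_single lookup_add lookup_single when_def eq)
  then show ?thesis
    by (induction y rule: galg_induct_UNIV) (auto simp: distrib_left lookup_add)
qed

text \<open>Self-adjointness for the involution of the group algebra that inverts group elements and
  conjugates coefficients. For such \<open>x\<close>, the value of a positive definite function at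
  \<open>x * x\<close> is nonnegative.\<close>

definition hermitian :: "galg \<Rightarrow> bool" where
  "hermitian x \<longleftrightarrow> (\<forall>g. Poly_Mapping.lookup x (- g) = cnj (Poly_Mapping.lookup x g))"

lemma hermitian_add: "hermitian x \<Longrightarrow> hermitian y \<Longrightarrow> hermitian (x + y)"
  by (simp add: hermitian_def lookup_add)

lemma hermitian_sum: "(\<And>i. i \<in> I \<Longrightarrow> hermitian (F i)) \<Longrightarrow> hermitian (\<Sum>i\<in>I. F i)"
  by (simp add: hermitian_def lookup_sum)

lemma hermitian_real: "hermitian (Poly_Mapping.single 0 (of_real a))"
  by (auto simp: hermitian_def lookup_single when_def)

lemma hermitian_swap: "hermitian (gel (swap a b))"
proof -
  have "- swap a b = swap a b" using swap_twice by (metis add_eq_0_iff)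
  then have "swap a b = - g \<longleftrightarrow> swap a b = g" for g by (metis minus_minus)
  then show ?thesis by (auto simp: hermitian_def lookup_single when_def)
qed

text \<open>The involution reverses products, so the adjoint of \<open>x * y\<close> is
  \<open>y * x\<close>; commutation brings it back.\<close>

lemma hermitian_mult:
  assumes x: "hermitian x" and y: "hermitian y" and comm: "x * y = y * x"
  shows "hermitian (x * y)"
  unfolding hermitian_def
proof
  fix k
  have bij: "bij_betw uminus (Poly_Mapping.keys x) (Poly_Mapping.keys x)"
    by (rule bij_betw_byWitness[where f' = uminus])
      (use x in \<open>auto simp: hermitian_def in_keys_iff\<close>)
  have y': "Poly_Mapping.lookup y (- g + - k) = cnj (Poly_Mapping.lookup y (k + g))" for g
    using y unfolding hermitian_def by (metis minus_add)
  have "Poly_Mapping.lookup (x * y) (- k) = (\<Sum>g\<in>Poly_Mapping.keys x. Poly_Mapping.lookup x g * Poly_Mapping.lookup y (- g + - k))"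
    unfolding lookup_mult_lin_left lin_def ..
  also have "\<dots> = (\<Sum>g\<in>Poly_Mapping.keys x. Poly_Mapping.lookup x (- g) * Poly_Mapping.lookup y (g + - k))"
    using sum.reindex_bij_betw[OF bij, of "\<lambda>g. Poly_Mapping.lookup x g * Poly_Mapping.lookup y (- g + - k)"] by simp
  also have "\<dots> = (\<Sum>g\<in>Poly_Mapping.keys x. cnj (Poly_Mapping.lookup x g * Poly_Mapping.lookup y (k - g)))"
    using x y'[of "- _"] by (simp add: hermitian_def)
  also have "\<dots> = cnj (Poly_Mapping.lookup (y * x) k)"
    unfolding lookup_mult_lin_right lin_def by (simp add: mult.commute)
  finally show "Poly_Mapping.lookup (x * y) (- k) = cnj (Poly_Mapping.lookup (x * y) k)" using comm by simp
qed

lemma hermitian_power: "hermitian x \<Longrightarrow> hermitian (x ^ l)"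
proof (induction l)
  case 0
  then show ?case using hermitian_real[of 1] by simp
next
  case (Suc l)
  then show ?case by (auto intro!: hermitian_mult simp: power_commutes)
qed

section \<open>Jucys-Murphy elements\<close>

definition jm :: "nat \<Rightarrow> galg" where
  "jm k = (\<Sum>i\<in>{1..<k}. gel (swap i k))"

lemma jm_alg: "k \<le> q \<Longrightarrow> jm k \<in> alg q"
  unfolding jm_def by (intro alg_sum alg_single swap_Sym) auto

lemma hermitian_jm: "hermitian (jm k)"
  unfolding jm_def by (intro hermitian_sum hermitian_swap)

text \<open>Conjugation by a permutation of \<open>{1..q}\<close> only permutes the transpositions
  \<open>(i, q + 1)\<close> among themselves.\<close>

lemma jm_commute:
  assumes "x \<in> alg q"
  shows "x * jm (Suc q) = jm (Suc q) * x"
  using alg_keys[OF assms]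
proof (induction x rule: galg_induct)
  case (single g a)
  then have g: "app g permutes {1..q}" unfolding Sym_def sym_group_def by simp
  then have fix_: "app g (Suc q) = Suc q" by (simp add: permutes_def)
  have "Poly_Mapping.single g a * jm (Suc q) =
      (\<Sum>i\<in>{1..q}. Poly_Mapping.single (swap (app g i) (Suc q) + g) a)"
    unfolding jm_def by (simp add: sum_distrib_left mult_single plus_swap fix_ atLeastLessThanSuc_atLeastAtMost)
  also have "\<dots> = (\<Sum>i\<in>{1..q}. Poly_Mapping.single (swap i (Suc q) + g) a)"
    by (rule sum.reindex_bij_betw[OF permutes_imp_bij[OF g]])
  also have "\<dots> = jm (Suc q) * Poly_Mapping.single g a"
    unfolding jm_def by (simp add: sum_distrib_right mult_single atLeastLessThanSuc_atLeastAtMost)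
  finally show ?case .
qed (auto simp: distrib_left distrib_right)

lemma jm_Suc:
  assumes "q \<ge> 1"
  defines "s \<equiv> gel (swap q (Suc q))"
  shows "jm (Suc q) = s * jm q * s + s"
proof -
  have "s * gel (swap i q) * s = gel (swap i (Suc q))" if "i \<in> {1..<q}" for i
  proof -
    have "swap q (Suc q) + swap i q = swap i (Suc q) + swap q (Suc q)"
      using plus_swap[of "swap q (Suc q)" i q] that by (simp add: app_swap Transposition.transpose_def)
    then show ?thesis
      unfolding s_def by (simp add: mult_single add.assoc swap_twice)
  qed
  then have "s * jm q * s = (\<Sum>i\<in>{1..<q}. gel (swap i (Suc q)))"
    unfolding jm_def by (simp add: sum_distrib_left sum_distrib_right)
  moreover have "{1..<Suc q} = insert q {1..<q}" using assms(1) by auto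
  ultimately show ?thesis unfolding jm_def s_def by (simp add: add.commute)
qed

text \<open>
  Expansion of \<open>(z - X)\<inverse> = s (z - Y)\<inverse> s + (z - Y)\<inverse> s (z - Y)\<inverse> + (z - Y)\<inverse> (z - X)\<inverse> (z - Y)\<inverse>\<close> in
  powers of \<open>1 / z\<close>.
\<close>

lemma jm_power_expansion:
  fixes X Y s :: "'a :: ring_1"
  assumes X: "X = s * Y * s + s" and s: "s * s = 1" and comm: "X * Y = Y * X"
  shows "X ^ l = s * Y ^ l * s + (\<Sum>a<l. Y ^ (l - 1 - a) * s * Y ^ a) +
    (\<Sum>a<l. \<Sum>b<l - 1 - a. Y ^ (a + b) * X ^ (l - 2 - a - b))"
proof -
  \<comment> \<open>The degenerate affine Hecke relation. Iterated, it moves \<open>s\<close> past a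
    power of \<open>X\<close>; it is used a second time after writing
    \<open>X ^ l = s * (s * X ^ l)\<close>, and this second use produces the double sum.\<close>
  have sX: "s * X = Y * s + 1"
    unfolding X distrib_left mult.assoc[symmetric] s by simp
  have comm': "X ^ m * Y ^ n = Y ^ n * X ^ m" for m n
    by (rule power_commuting_commutes[symmetric], rule power_commuting_commutes[symmetric])
      (rule comm)
  have sXl: "s * X ^ l = Y ^ l * s + (\<Sum>a<l. Y ^ a * X ^ (l - 1 - a))" for l
  proof (induction l)
    case (Suc l)
    have "s * X ^ Suc l = (s * X ^ l) * X" by (simp add: power_commutes mult.assoc)
    also have "\<dots> = Y ^ l * (s * X) + (\<Sum>a<l. Y ^ a * (X ^ (l - 1 - a) * X))"
      by (simp add: Suc distrib_right sum_distrib_right mult.assoc)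
    also have "(\<Sum>a<l. Y ^ a * (X ^ (l - 1 - a) * X)) = (\<Sum>a<l. Y ^ a * X ^ (l - a))"
    proof (intro sum.cong refl)
      fix a assume "a \<in> {..<l}"
      then have "l - a = Suc (l - 1 - a)" by simp
      then show "Y ^ a * (X ^ (l - 1 - a) * X) = Y ^ a * X ^ (l - a)"
        by (simp only: power_Suc power_commutes)
    qed
    finally show ?case
      by (simp add: sX distrib_left power_commutes mult.assoc[symmetric] add.assoc add.commute)
  qed simp
  have "X ^ l = s * (s * X ^ l)" by (simp add: mult.assoc[symmetric] s)
  also have "\<dots> = s * Y ^ l * s + (\<Sum>a<l. s * (X ^ (l - 1 - a) * Y ^ a))"
    unfolding sXl by (simp add: distrib_left sum_distrib_left mult.assoc comm')
  also have "(\<Sum>a<l. s * (X ^ (l - 1 - a) * Y ^ a)) =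
      (\<Sum>a<l. Y ^ (l - 1 - a) * s * Y ^ a + (\<Sum>b<l - 1 - a. Y ^ (a + b) * X ^ (l - 2 - a - b)))"
  proof (intro sum.cong refl)
    fix a assume "a \<in> {..<l}"
    have "s * (X ^ (l - 1 - a) * Y ^ a) = (s * X ^ (l - 1 - a)) * Y ^ a" by (simp add: mult.assoc)
    also have "\<dots> = Y ^ (l - 1 - a) * s * Y ^ a +
        (\<Sum>b<l - 1 - a. Y ^ b * X ^ (l - 1 - a - 1 - b) * Y ^ a)"
      by (simp add: sXl distrib_right sum_distrib_right)
    also have "(\<Sum>b<l - 1 - a. Y ^ b * X ^ (l - 1 - a - 1 - b) * Y ^ a) =
        (\<Sum>b<l - 1 - a. Y ^ (a + b) * X ^ (l - 2 - a - b))"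
    proof (intro sum.cong refl)
      fix b
      have "Y ^ b * X ^ (l - 1 - a - 1 - b) * Y ^ a = Y ^ b * (Y ^ a * X ^ (l - 1 - a - 1 - b))"
        by (simp add: mult.assoc comm')
      also have "\<dots> = Y ^ (a + b) * X ^ (l - 1 - a - 1 - b)"
        by (simp only: mult.assoc[symmetric] power_add[symmetric] add.commute)
      also have "\<dots> = Y ^ (a + b) * X ^ (l - 2 - a - b)" by (simp add: diff_right_commute)
      finally show "Y ^ b * X ^ (l - 1 - a - 1 - b) * Y ^ a = Y ^ (a + b) * X ^ (l - 2 - a - b)" .
    qed
    finally show "s * (X ^ (l - 1 - a) * Y ^ a) = Y ^ (l - 1 - a) * s * Y ^ a +
      (\<Sum>b<l - 1 - a. Y ^ (a + b) * X ^ (l - 2 - a - b))" .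
  qed
  finally show ?thesis by (simp add: sum.distrib add.assoc)
qed

text \<open>The linear extension of \<open>\<phi>\<close> evaluated after the map E, that is, after
  discarding all permutations outside S_q.\<close>

definition lin_on :: "nat \<Rightarrow> (fperm \<Rightarrow> complex) \<Rightarrow> galg \<Rightarrow> complex" where
  "lin_on q \<phi> = lin (\<lambda>g. if g \<in> Sym q then \<phi> g else 0)"

lemma lin_on_jm_mult:
  assumes "k \<le> q" and eig: "\<And>g. g \<in> Sym q \<Longrightarrow> (\<Sum>i\<in>{1..<k}. \<phi> (swap i k + g)) = c * \<phi> g"
  shows "lin_on q \<phi> (jm k * x) = c * lin_on q \<phi> x"
proof -
  have sw: "swap i k + g \<in> Sym q \<longleftrightarrow> g \<in> Sym q" if "i \<in> {1..<k}" for i g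
    using that assms(1) by (intro Sym_plus_left_iff swap_Sym) auto
  have "(\<Sum>i\<in>{1..<k}. if swap i k + g \<in> Sym q then \<phi> (swap i k + g) else 0) =
      c * (if g \<in> Sym q then \<phi> g else 0)" for g
    using eig[of g] sw by (cases "g \<in> Sym q") auto
  then show ?thesis
    unfolding lin_on_def jm_def sum_distrib_right lin_sum lin_single_mult mult_1
    by (simp add: lin_fun_sum[symmetric] lin_scale)
qed

lemma lin_on_jm_power_mult:
  assumes "k \<le> q" and eig: "\<And>g. g \<in> Sym q \<Longrightarrow> (\<Sum>i\<in>{1..<k}. \<phi> (swap i k + g)) = c * \<phi> g"
  shows "lin_on q \<phi> (jm k ^ l * x) = c ^ l * lin_on q \<phi> x"
proof (induction l)
  case (Suc l)
  have "lin_on q \<phi> (jm k ^ Suc l * x) = lin_on q \<phi> (jm k * (jm k ^ l * x))" by (simp add: mult.assoc)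
  then show ?case using lin_on_jm_mult[OF assms] Suc by simp
qed simp

text \<open>Conjugation by \<open>(q + 1, q + 2)\<close> lets the image of \<open>q + 2\<close> be
  decided by the image of \<open>q + 1\<close> under \<open>g\<close>, so the result stays in
  S_(q+1) only if \<open>g\<close> fixes \<open>q + 1\<close>; then the two commute. Hence
  restricting \<open>s * x * s\<close> to S_(q+1) amounts to restricting \<open>x\<close> to
  S_q.\<close>

lemma swap_conj_Sym:
  assumes "g \<in> Sym (Suc q)"
  defines "h \<equiv> swap (Suc q) (Suc (Suc q)) + g + swap (Suc q) (Suc (Suc q))"
  shows "h \<in> Sym (Suc q) \<longleftrightarrow> g \<in> Sym q" and "g \<in> Sym q \<Longrightarrow> h = g"
proof -
  have g: "app g permutes {1..Suc q}" using assms unfolding Sym_def sym_group_def by simp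
  have g2: "app g (Suc (Suc q)) = Suc (Suc q)" using g by (simp add: permutes_def)
  show hg: "h = g" if "g \<in> Sym q"
  proof -
    have "app g permutes {1..q}" using that unfolding Sym_def sym_group_def by simp
    then have "app g (Suc q) = Suc q" by (simp add: permutes_def)
    then have "g + swap (Suc q) (Suc (Suc q)) = swap (Suc q) (Suc (Suc q)) + g"
      using plus_swap[of g] g2 by simp
    then show ?thesis unfolding h_def add.assoc by (simp add: add.assoc[symmetric] swap_twice)
  qed
  show "h \<in> Sym (Suc q) \<longleftrightarrow> g \<in> Sym q"
  proof
    assume h: "h \<in> Sym (Suc q)"
    then have "app h (Suc (Suc q)) = Suc (Suc q)" unfolding Sym_def sym_group_def by (simp add: permutes_def)
    then have "transpose (Suc q) (Suc (Suc q)) (app g (Suc q)) = Suc (Suc q)"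
      unfolding h_def app_plus app_swap by simp
    then have "app g (Suc q) = Suc q"
      by (auto simp: Transposition.transpose_def split: if_splits)
    then have "app g permutes {1..q}"
      using g unfolding permutes_def by (metis atLeastAtMost_iff le_Suc_eq)
    then show "g \<in> Sym q" unfolding Sym_def sym_group_def by simp
  next
    assume "g \<in> Sym q"
    then show "h \<in> Sym (Suc q)" using hg assms(1) by simp
  qed
qed

text \<open>Applies the expansion of \<open>jm_power_expansion\<close> term by term. The first term
  restricts to S_q, the middle terms vanish because no element of S_(q+1) times \<open>s\<close>
  lies in S_(q+1), and in the double sum the powers of \<open>Y\<close> act by powers of the
  eigenvalue \<open>c\<close>.\<close>

lemma lin_on_jm_recursion:
  assumes eig: "\<And>g. g \<in> Sym (Suc q) \<Longrightarrow>
    (\<Sum>i\<in>{1..<Suc q}. \<phi> (swap i (Suc q) + g)) = c * \<phi> g"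
  shows "lin_on (Suc q) \<phi> (jm (Suc (Suc q)) ^ l) = lin_on q \<phi> (jm (Suc q) ^ l) +
    (\<Sum>a<l. \<Sum>b<l - 1 - a. c ^ (a + b) * lin_on (Suc q) \<phi> (jm (Suc (Suc q)) ^ (l - 2 - a - b)))"
proof -
  let ?X = "jm (Suc (Suc q))" and ?Y = "jm (Suc q)" and ?s = "gel (swap (Suc q) (Suc (Suc q)))"
  note Yalg = jm_alg[OF order_refl, of "Suc q"]
  note pow = lin_on_jm_power_mult[of "Suc q" "Suc q" \<phi> c, OF order_refl eig]
  have add: "lin_on (Suc q) \<phi> (x + y) = lin_on (Suc q) \<phi> x + lin_on (Suc q) \<phi> y" for x y
    by (simp add: lin_on_def)
  have sum: "lin_on (Suc q) \<phi> (\<Sum>i\<in>I. F i) = (\<Sum>i\<in>I. lin_on (Suc q) \<phi> (F i))" for F and I :: "nat set"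
    by (simp add: lin_on_def lin_sum)
  have "lin_on (Suc q) \<phi> (?s * x * ?s) = lin_on q \<phi> x" if "x \<in> alg (Suc q)" for x
    unfolding lin_on_def lin_mult_single mult.assoc lin_single_mult mult_1_left mult_1_right
  proof (rule lin_cong)
    fix g assume "g \<in> Poly_Mapping.keys x"
    then have "g \<in> Sym (Suc q)" using alg_keys[OF that] by blast
    from swap_conj_Sym[OF this]
    show "(if swap (Suc q) (Suc (Suc q)) + (g + swap (Suc q) (Suc (Suc q))) \<in> Sym (Suc q)
        then \<phi> (swap (Suc q) (Suc (Suc q)) + (g + swap (Suc q) (Suc (Suc q)))) else 0) =
      (if g \<in> Sym q then \<phi> g else 0)" by (simp add: add.assoc)
  qed
  then have 1: "lin_on (Suc q) \<phi> (?s * ?Y ^ l * ?s) = lin_on q \<phi> (?Y ^ l)"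
    using alg_power[OF Yalg] by blast
  have "lin_on (Suc q) \<phi> (?s * x) = 0" if "x \<in> alg (Suc q)" for x
  proof -
    have "swap (Suc q) (Suc (Suc q)) + g \<notin> Sym (Suc q)" if g: "g \<in> Sym (Suc q)" for g
    proof -
      have "swap (Suc q) (Suc (Suc q)) \<notin> Sym (Suc q)"
      proof
        assume "swap (Suc q) (Suc (Suc q)) \<in> Sym (Suc q)"
        then have "transpose (Suc q) (Suc (Suc q)) permutes {1..Suc q}"
          unfolding Sym_def sym_group_def mem_Collect_eq app_swap .
        from permutes_not_in[OF this, of "Suc (Suc q)"] show False by simp
      qed
      then show ?thesis using Sym_plus_right_iff[OF g] by simp
    qed
    then have "lin_on (Suc q) \<phi> (?s * x) = lin (\<lambda>g. 0) x"
      unfolding lin_on_def lin_single_mult mult_1_left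
      using alg_keys[OF that] by (intro lin_cong) auto
    then show ?thesis by (simp add: lin_def)
  qed
  then have 2: "lin_on (Suc q) \<phi> (?Y ^ m * ?s * ?Y ^ n) = 0" for m n
    using pow[of m "?s * ?Y ^ n"] alg_power[OF Yalg] by (simp add: mult.assoc)
  have "?X ^ l = ?s * ?Y ^ l * ?s + (\<Sum>a<l. ?Y ^ (l - 1 - a) * ?s * ?Y ^ a) +
    (\<Sum>a<l. \<Sum>b<l - 1 - a. ?Y ^ (a + b) * ?X ^ (l - 2 - a - b))"
  proof (rule jm_power_expansion)
    show "?X = ?s * ?Y * ?s + ?s" by (rule jm_Suc) simp
    show "?s * ?s = 1" by (simp add: mult_single swap_twice)
    show "?X * ?Y = ?Y * ?X" using jm_commute[OF Yalg] by simp
  qed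
  then have "lin_on (Suc q) \<phi> (?X ^ l) = lin_on (Suc q) \<phi> (?s * ?Y ^ l * ?s) +
      (\<Sum>a<l. lin_on (Suc q) \<phi> (?Y ^ (l - 1 - a) * ?s * ?Y ^ a)) +
      (\<Sum>a<l. \<Sum>b<l - 1 - a. lin_on (Suc q) \<phi> (?Y ^ (a + b) * ?X ^ (l - 2 - a - b)))"
    by (simp only: add sum)
  then show ?thesis by (simp only: 1 2 pow sum.neutral_const add_0_right)
qed

section \<open>Generating functions of the restricted powers\<close>

unbundle fps_syntax

definition box_content :: "nat \<times> nat \<Rightarrow> complex" where
  "box_content b = of_nat (snd b) - of_nat (fst b)"

text \<open>In the variable w = 1/z this is w^2 (z - c)^2. Subtracting \<open>fps_X^2\<close> yields
  w^2 ((z - c)^2 - 1), so quotients of the two are the factors of the Cauchy transform.\<close>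

definition content_factor :: "complex \<Rightarrow> complex fps" where
  "content_factor c = (1 - fps_const c * fps_X)^2"

text \<open>Induction on \<open>q\<close>. With G = 1 / (1 - c w), the recursion for the
  coefficients reads F' = F + w^2 G^2 F', and multiplying by (1 - c w)^2 contributes exactly one
  factor to each side.\<close>

lemma jm_moment_fps:
  assumes eig: "\<And>k g. k \<in> {1..q} \<Longrightarrow> g \<in> Sym q \<Longrightarrow>
    (\<Sum>i\<in>{1..<k}. \<phi> (swap i k + g)) = c k * \<phi> g"
  shows "Abs_fps (\<lambda>l. lin_on q \<phi> (jm (Suc q) ^ l)) *
      (\<Prod>k\<in>{1..q}. content_factor (c k) - fps_X^2) =
    fps_const (\<phi> 0) * (\<Prod>k\<in>{1..q}. content_factor (c k))"
  using eig
proof (induction q)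
  case 0
  have "jm (Suc 0) = 0" by (simp add: jm_def)
  then have "Abs_fps (\<lambda>l. lin_on 0 \<phi> (jm (Suc 0) ^ l)) = fps_const (\<phi> 0)"
    using Sym_zero by (intro fps_ext) (simp add: power_0_left lin_on_def)
  then show ?case by simp
next
  case (Suc q)
  let ?F = "Abs_fps (\<lambda>l. lin_on q \<phi> (jm (Suc q) ^ l))"
  let ?F' = "Abs_fps (\<lambda>l. lin_on (Suc q) \<phi> (jm (Suc (Suc q)) ^ l))"
  let ?c = "c (Suc q)" and ?G = "Abs_fps (\<lambda>n. c (Suc q) ^ n)"
  have IH: "?F * (\<Prod>k\<in>{1..q}. content_factor (c k) - fps_X^2) =
      fps_const (\<phi> 0) * (\<Prod>k\<in>{1..q}. content_factor (c k))"
    by (rule Suc.IH) (use Suc.prems Sym_mono[of q "Suc q"] in auto)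
  \<comment> \<open>The double sum over \<open>a\<close> and \<open>b\<close> is the convolution of
    two geometric series with ratio \<open>c\<close> and the series \<open>F'\<close>, delayed by
    two degrees.\<close>
  have rec: "?F' = ?F + fps_X^2 * (?G * (?G * ?F'))"
  proof (rule fps_ext)
    fix l
    have "(\<Sum>a<l. \<Sum>b<l - 1 - a. ?c ^ (a + b) * lin_on (Suc q) \<phi> (jm (Suc (Suc q)) ^ (l - 2 - a - b)))
        = (fps_X^2 * (?G * (?G * ?F'))) $ l"
    proof (cases "l < 2")
      case True
      then have z: "l - 1 - a = 0" for a by simp
      have "(\<Sum>a<l. \<Sum>b<l - 1 - a. ?c ^ (a + b) * lin_on (Suc q) \<phi> (jm (Suc (Suc q)) ^ (l - 2 - a - b))) = 0"
        unfolding z by simp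
      then show ?thesis using True by (simp add: fps_X_power_mult_nth)
    next
      case False
      define m where "m = l - 2"
      have l: "l = Suc (Suc m)" using False unfolding m_def by simp
      have "(\<Sum>a<l. \<Sum>b<l - 1 - a. ?c ^ (a + b) * lin_on (Suc q) \<phi> (jm (Suc (Suc q)) ^ (l - 2 - a - b))) =
          (\<Sum>a<Suc m. \<Sum>b<l - 1 - a. ?c ^ (a + b) * lin_on (Suc q) \<phi> (jm (Suc (Suc q)) ^ (l - 2 - a - b)))"
        unfolding l by simp
      also have "\<dots> = (\<Sum>a=0..m. \<Sum>b=0..m - a. ?c ^ (a + b) * lin_on (Suc q) \<phi> (jm (Suc (Suc q)) ^ (m - a - b)))"
        unfolding l by (intro sum.cong) (auto simp: Suc_diff_le)
      also have "\<dots> = (?G * (?G * ?F')) $ m"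
        by (simp add: fps_mult_nth sum_distrib_left power_add mult.assoc)
      finally show ?thesis using False by (simp add: fps_X_power_mult_nth m_def)
    qed
    then show "?F' $ l = (?F + fps_X^2 * (?G * (?G * ?F'))) $ l"
      using lin_on_jm_recursion[of q \<phi> ?c l] Suc.prems[of "Suc q"] by simp
  qed
  have G: "(1 - fps_const ?c * fps_X) * ?G = 1"
  proof (rule fps_ext)
    fix n
    have "((1 - fps_const ?c * fps_X) * ?G) $ n = ?G $ n - ?c * ((fps_X * ?G) $ n)"
      by (simp add: left_diff_distrib mult.assoc)
    also have "\<dots> = 1 $ n" by (cases n) simp_all
    finally show "((1 - fps_const ?c * fps_X) * ?G) $ n = 1 $ n" .
  qed
  have "content_factor ?c * ?F' = content_factor ?c * ?F +
      fps_X^2 * (((1 - fps_const ?c * fps_X) * ?G)^2 * ?F')"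
    by (subst rec) (simp add: content_factor_def algebra_simps power2_eq_square)
  then have step: "?F' * (content_factor ?c - fps_X^2) = ?F * content_factor ?c"
    unfolding G by (simp add: algebra_simps)
  have ins: "{1..Suc q} = insert (Suc q) {1..q}" by auto
  have "?F' * (\<Prod>k\<in>{1..Suc q}. content_factor (c k) - fps_X^2) =
      (?F' * (content_factor ?c - fps_X^2)) * (\<Prod>k\<in>{1..q}. content_factor (c k) - fps_X^2)"
    unfolding ins by (simp add: mult.assoc)
  also have "\<dots> = content_factor ?c * (?F * (\<Prod>k\<in>{1..q}. content_factor (c k) - fps_X^2))"
    unfolding step by (simp add: mult_ac)
  also have "\<dots> = fps_const (\<phi> 0) * (\<Prod>k\<in>{1..Suc q}. content_factor (c k))"
    unfolding IH ins by (simp add: mult_ac)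
  finally show ?case .
qed

text \<open>The power series in w = 1/z of z times the Cauchy transform
  \<open>cauchy_product D z\<close>.\<close>

definition moment_fps :: "diagram \<Rightarrow> complex fps" where
  "moment_fps D = (\<Prod>b\<in>D. content_factor (box_content b)) *
     inverse (\<Prod>b\<in>D. content_factor (box_content b) - fps_X^2)"

lemma content_denominator_nth_0: "(\<Prod>b\<in>D. content_factor (box_content b) - fps_X^2) $ 0 = 1"
proof -
  have "(content_factor c - fps_X^2) $ 0 = 1" for c
    by (simp add: content_factor_def fps_power_zeroth)
  then show ?thesis by (induction D rule: infinite_finite_induct) simp_all
qed

lemma moment_fps_eqI:
  assumes "F * (\<Prod>b\<in>D. content_factor (box_content b) - fps_X^2) =
    fps_const a * (\<Prod>b\<in>D. content_factor (box_content b))"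
  shows "F = fps_const a * moment_fps D"
proof -
  let ?d = "\<Prod>b\<in>D. content_factor (box_content b) - fps_X^2"
  have d: "inverse ?d * ?d = 1"
    by (rule inverse_mult_eq_1) (simp add: content_denominator_nth_0)
  have "F = F * ?d * inverse ?d" using d by (simp add: mult_ac)
  then show ?thesis unfolding assms moment_fps_def by (simp add: mult_ac)
qed

text \<open>The function sending \<open>g\<close> to the value of the translate of \<open>f\<close>
  by \<open>g\<close> at the reading tabloid meets the eigenvalue condition of
  \<open>jm_moment_fps\<close>: translates stay in the Specht module, and the eigenvalue for
  \<open>k\<close> is the content of the box numbered \<open>k\<close>.\<close>

lemma jm_moment_reading_tabloid:
  assumes D: "D \<in> young_diagrams q" and f: "f \<in> specht D"
  shows "lin_on q (\<lambda>g. perm_action (app g) f (reading_tabloid D)) (jm (Suc q) ^ l) =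
    moment_fps D $ l * f (reading_tabloid D)"
proof -
  let ?T = "reading_tabloid D" and ?t = "row_reading D"
  define c where "c k = box_content (inv_into D ?t k)" for k
  have bij: "bij_betw ?t D {1..q}"
    using row_reading_tableau[OF young_diagram_finite[OF D]] young_diagram_card[OF D]
    unfolding tableaux_def by simp
  have c: "c (?t b) = box_content b" if "b \<in> D" for b
    unfolding c_def using bij_betw_inv_into_left[OF bij that] by simp
  let ?\<phi> = "\<lambda>g. perm_action (app g) f ?T"
  have eig: "(\<Sum>i\<in>{1..<k}. ?\<phi> (swap i k + g)) = c k * ?\<phi> g"
    if k: "k \<in> {1..q}" and g: "g \<in> Sym q" for k g
  proof -
    have "k \<in> ?t ` D" using k bij unfolding bij_betw_def by blast
    then obtain b where b: "b \<in> D" "k = ?t b" by blast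
    have gf: "perm_action (app g) f \<in> specht D"
      using perm_action_specht[OF _ f] g young_diagram_card[OF D] unfolding Sym_def by blast
    have "?\<phi> (swap i k + g) = perm_action (app g) f (\<lambda>s. transpose i k ` ?T s)" for i
    proof -
      have "?\<phi> (swap i k + g) = perm_action (app (swap i k)) (perm_action (app g) f) ?T"
        unfolding app_plus using perm_action_comp[OF bij_app bij_app] by simp
      then show ?thesis by (simp add: perm_action_def app_swap)
    qed
    then have "(\<Sum>i\<in>{1..<k}. ?\<phi> (swap i k + g)) =
        (\<Sum>i\<in>{1..<?t b}. perm_action (app g) f (\<lambda>s. transpose i (?t b) ` ?T s))"
      unfolding b(2) by simp
    also have "\<dots> = box_content b * ?\<phi> g"
      using jucys_murphy_eigen[OF D gf, of "fst b" "snd b"] b(1) by (simp add: box_content_def)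
    finally show ?thesis using c[OF b(1)] b(2) by simp
  qed
  have re: "(\<Prod>k\<in>{1..q}. h (c k)) = (\<Prod>b\<in>D. h (box_content b))" for h :: "complex \<Rightarrow> complex fps"
    using prod.reindex_bij_betw[OF bij, of "\<lambda>k. h (c k)"] c by (simp add: cong: prod.cong)
  have "?\<phi> 0 = f ?T" unfolding app_zero perm_action_id ..
  then have "Abs_fps (\<lambda>l. lin_on q ?\<phi> (jm (Suc q) ^ l)) = fps_const (f ?T) * moment_fps D"
    using jm_moment_fps[of q ?\<phi> c, OF eig] re[of content_factor] re[of "\<lambda>c. content_factor c - fps_X^2"]
    by (intro moment_fps_eqI) simp
  then have "Abs_fps (\<lambda>l. lin_on q ?\<phi> (jm (Suc q) ^ l)) $ l = (fps_const (f ?T) * moment_fps D) $ l"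
    by simp
  then show ?thesis by (simp add: mult.commute)
qed

section \<open>The center of the group algebra\<close>

text \<open>The map E of the overview, with values in the group algebra itself.\<close>

definition restr :: "nat \<Rightarrow> galg \<Rightarrow> galg" where
  "restr q x = Poly_Mapping.mapp (\<lambda>g a. if g \<in> Sym q then a else 0) x"

lemma lookup_restr: "Poly_Mapping.lookup (restr q x) g = (if g \<in> Sym q then Poly_Mapping.lookup x g else 0)"
  by (auto simp: restr_def Poly_Mapping.lookup_mapp when_def in_keys_iff)

lemma restr_alg: "restr q x \<in> alg q"
  unfolding alg_def by (auto simp: in_keys_iff lookup_restr split: if_splits)

lemma lin_restr: "lin \<phi> (restr q x) = lin_on q \<phi> x"
proof -
  have "lin \<phi> (restr q x) = (\<Sum>g\<in>Poly_Mapping.keys x. Poly_Mapping.lookup (restr q x) g * \<phi> g)"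
    by (intro lin_superset) (auto simp: in_keys_iff lookup_restr split: if_splits)
  also have "\<dots> = lin_on q \<phi> x"
    unfolding lin_on_def lin_def by (intro sum.cong) (auto simp: lookup_restr)
  finally show ?thesis .
qed

lemma hermitian_restr: "hermitian x \<Longrightarrow> hermitian (restr q x)"
  by (simp add: hermitian_def lookup_restr Sym_uminus_iff)

definition center :: "nat \<Rightarrow> galg set" where
  "center q = {x \<in> alg q. \<forall>h\<in>Sym q. gel h * x = x * gel h}"

lemma center_alg: "x \<in> center q \<Longrightarrow> x \<in> alg q" by (simp add: center_def)

lemma center_commute:
  assumes x: "x \<in> center q" and y: "y \<in> alg q"
  shows "y * x = x * y"
  using alg_keys[OF y]
proof (induction y rule: galg_induct)
  case (single g a)
  have s: "Poly_Mapping.single g a = Poly_Mapping.single 0 a * gel g"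
    by (simp add: mult_single)
  have z: "Poly_Mapping.single 0 a * x = x * Poly_Mapping.single 0 a"
    by (induction x rule: galg_induct_UNIV) (auto simp: distrib_left distrib_right mult_single mult.commute)
  have "gel g * x = x * gel g" using x single unfolding center_def by blast
  then have "Poly_Mapping.single 0 a * (gel g * x) = Poly_Mapping.single 0 a * x * gel g"
    by (simp add: mult.assoc)
  also have "\<dots> = x * (Poly_Mapping.single 0 a * gel g)" unfolding z by (rule mult.assoc)
  finally show ?case unfolding s by (simp only: mult.assoc)
qed (auto simp: distrib_left distrib_right)

lemma center_add: "x \<in> center q \<Longrightarrow> y \<in> center q \<Longrightarrow> x + y \<in> center q"
  by (auto simp: center_def alg_add distrib_left distrib_right)

lemma center_mult: "x \<in> center q \<Longrightarrow> y \<in> center q \<Longrightarrow> x * y \<in> center q"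
proof -
  assume x: "x \<in> center q" and y: "y \<in> center q"
  have "gel h * (x * y) = x * y * gel h" if "h \<in> Sym q" for h
  proof -
    have "gel h * (x * y) = x * (gel h * y)"
      using x that unfolding center_def by (simp add: mult.assoc[symmetric])
    also have "\<dots> = x * y * gel h"
      using y that unfolding center_def by (simp add: mult.assoc)
    finally show ?thesis .
  qed
  then show ?thesis using x y alg_mult unfolding center_def by blast
qed

lemma center_const: "Poly_Mapping.single 0 a \<in> center q"
  by (auto simp: center_def mult_single intro: alg_single Sym_zero)

text \<open>Left and right translations by an element of S_q preserve both S_q and its complement,
  so cutting off coefficients outside S_q respects commutation with S_q.\<close>

lemma center_restr:
  assumes "\<And>h. h \<in> Sym q \<Longrightarrow> gel h * x = x * gel h"
  shows "restr q x \<in> center q"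
proof -
  have "gel h * restr q x = restr q x * gel h" if h: "h \<in> Sym q" for h
  proof (rule poly_mapping_eqI)
    fix k
    have "- h + k \<in> Sym q \<longleftrightarrow> k \<in> Sym q" "k - h \<in> Sym q \<longleftrightarrow> k \<in> Sym q"
      using Sym_plus_left_iff[of "- h" q k] Sym_plus_right_iff[of "- h" q k] h
      by (auto simp: Sym_uminus_iff)
    moreover have "Poly_Mapping.lookup (gel h * y) k = Poly_Mapping.lookup y (- h + k)"
        "Poly_Mapping.lookup (y * gel h) k = Poly_Mapping.lookup y (k - h)" for y
      unfolding lookup_mult_lin_left[of "gel h"] lookup_mult_lin_right[of y "gel h"] by simp_all
    moreover have "Poly_Mapping.lookup x (- h + k) = Poly_Mapping.lookup x (k - h)"
      using calculation(3,4) assms[OF h] by metis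
    ultimately show "Poly_Mapping.lookup (gel h * restr q x) k = Poly_Mapping.lookup (restr q x * gel h) k"
      by (simp add: lookup_restr)
  qed
  then show ?thesis unfolding center_def using restr_alg by blast
qed

definition moment_element :: "nat \<Rightarrow> nat \<Rightarrow> galg" where
  "moment_element q l = restr q (jm (Suc q) ^ l)"

lemma moment_element_center: "moment_element q l \<in> center q"
  unfolding moment_element_def
proof (rule center_restr)
  fix h assume "h \<in> Sym q"
  then have "gel h * jm (Suc q) = jm (Suc q) * gel h" by (intro jm_commute alg_single)
  then show "gel h * jm (Suc q) ^ l = jm (Suc q) ^ l * gel h"
    using power_commuting_commutes[of "jm (Suc q)" "gel h" l] by simp
qed

lemma hermitian_moment_element: "hermitian (moment_element q l)"
  unfolding moment_element_def by (intro hermitian_restr hermitian_power hermitian_jm)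

section \<open>Action of the group algebra on Specht modules\<close>

definition alg_action :: "galg \<Rightarrow> (tabloid \<Rightarrow> complex) \<Rightarrow> tabloid \<Rightarrow> complex" where
  "alg_action x f = (\<lambda>T. lin (\<lambda>g. perm_action (app g) f T) x)"

lemma alg_action_add: "alg_action (x + y) f = alg_action x f + alg_action y f"
  by (simp add: alg_action_def fun_eq_iff)

lemma alg_action_const: "alg_action (Poly_Mapping.single 0 a) f = fun_scale a f"
  unfolding alg_action_def fun_scale_def lin_single app_zero perm_action_id ..

lemma alg_action_eq_sum:
  "alg_action x f =
    (\<Sum>g\<in>Poly_Mapping.keys x. fun_scale (Poly_Mapping.lookup x g) (perm_action (app g) f))"
  by (rule ext) (simp add: alg_action_def lin_def fun_scale_def sum_fun_app)

lemma perm_action_app_plus: "perm_action (app (g + h)) f = perm_action (app g) (perm_action (app h) f)"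
  unfolding app_plus by (rule perm_action_comp[OF bij_app bij_app])

lemma perm_action_alg_action:
  "perm_action \<sigma> (alg_action y f) T = lin (\<lambda>h. perm_action \<sigma> (perm_action (app h) f) T) y"
  by (simp add: perm_action_def alg_action_def)

lemma alg_action_mult: "alg_action (x * y) f = alg_action x (alg_action y f)"
  unfolding alg_action_def[of "x * y"] alg_action_def[of x] lin_mult perm_action_alg_action
    perm_action_app_plus ..

lemma perm_action_app_specht:
  assumes "D \<in> young_diagrams q" "g \<in> Sym q" "f \<in> specht D"
  shows "perm_action (app g) f \<in> specht D"
  using perm_action_specht[OF _ assms(3)] assms(1,2) young_diagram_card unfolding Sym_def by blast

lemma alg_action_specht:
  assumes D: "D \<in> young_diagrams q" and x: "x \<in> alg q" and f: "f \<in> specht D"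
  shows "alg_action x f \<in> specht D"
  unfolding alg_action_eq_sum
  using perm_action_app_specht[OF D _ f] alg_keys[OF x] by (intro specht_sum_scale) auto

definition acts_by :: "diagram \<Rightarrow> galg \<Rightarrow> complex \<Rightarrow> bool" where
  "acts_by D x a \<longleftrightarrow> (\<forall>f\<in>specht D. alg_action x f = fun_scale a f)"

lemma acts_by_add: "acts_by D x a \<Longrightarrow> acts_by D y b \<Longrightarrow> acts_by D (x + y) (a + b)"
  by (auto simp: acts_by_def alg_action_add cfun.scale_left_distrib)

lemma acts_by_const: "acts_by D (Poly_Mapping.single 0 a) a"
  by (simp add: acts_by_def alg_action_const)

lemma acts_by_mult:
  assumes x: "acts_by D x a" and y: "acts_by D y b"
  shows "acts_by D (x * y) (a * b)"
  unfolding acts_by_def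
proof
  fix f assume f: "f \<in> specht D"
  then have "fun_scale b f \<in> specht D" unfolding specht_def by (rule cfun.span_scale)
  then show "alg_action (x * y) f = fun_scale (a * b) f"
    using x y f by (simp add: acts_by_def alg_action_mult)
qed

text \<open>Centrality supplies the equivariance required by \<open>specht_scalar\<close>, and the
  scalar has been computed at the reading tabloid.\<close>

lemma acts_by_moment_element:
  assumes D: "D \<in> young_diagrams q"
  shows "acts_by D (moment_element q l) (moment_fps D $ l)"
  unfolding acts_by_def
proof
  fix f assume f: "f \<in> specht D"
  let ?x = "moment_element q l"
  note cen = moment_element_center[of q l]
  show "alg_action ?x f = fun_scale (moment_fps D $ l) f"
  proof (rule specht_scalar[OF D f])
    show "alg_action ?x f \<in> specht D" if "f \<in> specht D" for f
      using that by (intro alg_action_specht[OF D center_alg[OF cen]])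
    show "alg_action ?x (perm_action h f) = perm_action h (alg_action ?x f)"
      if f: "f \<in> specht D" and h: "h \<in> sym_group q" for f h
    proof -
      obtain g where g: "g \<in> Sym q" "h = app g" using h app_Sym[of q] by blast
      have "alg_action (gel g) f = perm_action (app g) f" for f
        by (simp add: alg_action_def)
      moreover have "gel g * ?x = ?x * gel g" using cen g(1) unfolding center_def by blast
      ultimately show ?thesis unfolding g(2) by (metis alg_action_mult)
    qed
    show "alg_action ?x f (reading_tabloid D) = moment_fps D $ l * f (reading_tabloid D)"
      if f: "f \<in> specht D" for f
      unfolding alg_action_def moment_element_def lin_restr by (rule jm_moment_reading_tabloid[OF D f])
  qed
qed

lemma norm_character_acts_by:
  assumes D: "D \<in> young_diagrams q" and x: "x \<in> alg q" and a: "acts_by D x a"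
  shows "lin (\<lambda>g. norm_character D (app g)) x = a"
proof -
  let ?y = "\<lambda>\<sigma>. Poly_Mapping.lookup x (inv_into UNIV app \<sigma>)"
  have inv: "inv_into UNIV app (app g) = g" for g by (rule inv_into_f_f[OF inj_on_app]) simp
  let ?G = "app ` Poly_Mapping.keys x"
  have sum: "(\<Sum>\<sigma>\<in>?G. F \<sigma>) = (\<Sum>g\<in>Poly_Mapping.keys x. F (app g))" for F :: "_ \<Rightarrow> 'z :: comm_monoid_add"
    by (simp add: sum.reindex[OF inj_on_app])
  have "(\<Sum>\<sigma>\<in>?G. ?y \<sigma> * norm_character D \<sigma>) = a"
  proof (rule norm_character_scalar[OF D])
    show "?G \<subseteq> sym_group q" using alg_keys[OF x] app_Sym[of q] by blast
    show "(\<Sum>\<sigma>\<in>?G. fun_scale (?y \<sigma>) (perm_action \<sigma> f)) = fun_scale a f" if "f \<in> specht D" for f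
      using a that unfolding sum inv alg_action_eq_sum[symmetric] acts_by_def by blast
  qed
  then show ?thesis unfolding sum inv lin_def .
qed

section \<open>Profiles of diagrams\<close>

text \<open>A box with the largest sum of coordinates is a corner, so its removal leaves a
  diagram.\<close>

lemma young_diagram_induct [consumes 1, case_names empty insert]:
  assumes "D \<in> young_diagrams q"
    and empty: "P {}"
    and insert: "\<And>D b q. D \<in> young_diagrams q \<Longrightarrow> b \<notin> D \<Longrightarrow> insert b D \<in> young_diagrams (Suc q) \<Longrightarrow>
      P D \<Longrightarrow> P (insert b D)"
  shows "P D"
  using assms(1)
proof (induction q arbitrary: D)
  case 0
  then have "D = {}" using young_diagram_card young_diagram_finite by fastforce
  then show ?case using empty by simp
next
  case (Suc q)
  note fin = young_diagram_finite[OF Suc.prems]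
  have ne: "D \<noteq> {}" using young_diagram_card[OF Suc.prems] by auto
  let ?f = "\<lambda>b :: nat \<times> nat. fst b + snd b"
  have "Max (?f ` D) \<in> ?f ` D" using fin ne by (intro Max_in) auto
  then obtain b where b: "b \<in> D" "?f b = Max (?f ` D)" by (metis (no_types, lifting) imageE)
  have max: "?f b' \<le> ?f b" if "b' \<in> D" for b'
    unfolding b(2) using fin that by (intro Max_ge) auto
  have "D - {b} \<in> young_diagrams q"
    unfolding young_diagrams_def mem_Collect_eq
  proof (intro conjI)
    show "card (D - {b}) = q" using young_diagram_card[OF Suc.prems] b fin by simp
    show "\<forall>(i, j)\<in>D - {b}. 1 \<le> i \<and> 1 \<le> j \<and> (\<forall>i'\<in>{1..i}. \<forall>j'\<in>{1..j}. (i', j') \<in> D - {b})"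
    proof (rule ballI, rule case_prodI2)
      fix x i j assume "x \<in> D - {b}" "x = (i, j)"
      then have ij: "(i, j) \<in> D" "(i, j) \<noteq> b" by auto
      have "(i', j') \<in> D - {b}" if i': "i' \<in> {1..i}" "j' \<in> {1..j}" for i' j'
      proof -
        have "(i', j') \<in> D" using young_diagram_down[OF Suc.prems ij(1)] i' by simp
        moreover have "(i', j') \<noteq> b" using max[OF ij(1)] ij(2) i' by auto
        ultimately show ?thesis by simp
      qed
      then show "1 \<le> i \<and> 1 \<le> j \<and> (\<forall>i'\<in>{1..i}. \<forall>j'\<in>{1..j}. (i', j') \<in> D - {b})"
        using young_diagram_pos[OF Suc.prems ij(1)] by blast
    qed
  qed (use fin in simp)
  moreover have "insert b (D - {b}) = D" using b(1) by auto
  ultimately show ?case using insert[of "D - {b}" q b] Suc by simp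
qed

definition hat :: "real \<Rightarrow> real" where
  "hat v = max 0 (1 - \<bar>v\<bar>)"

abbreviation rcontent :: "nat \<times> nat \<Rightarrow> real" where
  "rcontent b \<equiv> real (snd b) - real (fst b)"

lemma mem_region:
  "(s, t) \<in> region D \<longleftrightarrow> (\<exists>i j. (i, j) \<in> D \<and> real j - 1 \<le> s \<and> s \<le> real j \<and> real i - 1 \<le> t \<and> t \<le> real i)"
  unfolding region_def by fastforce

lemma profile_eqI:
  assumes "y = \<bar>u\<bar> \<or> (\<exists>s t. (s, t) \<in> region D \<and> s - t = u \<and> y = s + t)"
    and "\<bar>u\<bar> \<le> y" "\<And>s t. (s, t) \<in> region D \<Longrightarrow> s - t = u \<Longrightarrow> s + t \<le> y"
  shows "profile D u = y"
  unfolding profile_def by (rule cSup_eq_maximum) (use assms in auto)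

text \<open>Seen in the rotated coordinates, the new box is a square over the interval of radius 1
  around its content. There the old profile is its lower boundary and the new profile its upper
  boundary; outside that interval nothing changes.\<close>

lemma profile_insert:
  assumes D: "D \<in> young_diagrams q" and ij: "(i, j) \<notin> D"
    and D': "insert (i, j) D \<in> young_diagrams (Suc q)"
  shows "profile (insert (i, j) D) u = profile D u + 2 * hat (u - (real j - real i))"
proof -
  define c where "c = real j - real i"
  \<comment> \<open>The height s + t of the lowest corner (j - 1, i - 1) of the new box.\<close>
  define h where "h = real i + real j - 2"
  have pos: "1 \<le> i" "1 \<le> j" using young_diagram_pos[OF D', of i j] by auto
  have out: "i' < i \<or> j' < j" if "(i', j') \<in> D" for i' j'
    using young_diagram_down[OF D that pos(1) _ pos(2)] ij by (meson not_less)
  have up: "(i - 1, j) \<in> D" if "i \<noteq> 1"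
    proof -
    have "1 \<le> i - 1" "i - 1 \<noteq> i" using that pos by auto
    then show ?thesis using young_diagram_down[OF D', of i j "i - 1" j] pos by auto
  qed
  have left: "(i, j - 1) \<in> D" if "j \<noteq> 1"
    proof -
    have "1 \<le> j - 1" "j - 1 \<noteq> j" using that pos by auto
    then show ?thesis using young_diagram_down[OF D', of i j i "j - 1"] pos by auto
  qed
  have D_le: "s + t \<le> h + \<bar>u - c\<bar>" if "(s, t) \<in> region D" "s - t = u" for s t
  proof -
    obtain i' j' where b: "(i', j') \<in> D" "s \<le> real j'" "t \<le> real i'"
      using \<open>(s, t) \<in> region D\<close> unfolding mem_region by blast
    from out[OF b(1)] have "t \<le> real i - 1 \<or> s \<le> real j - 1" using b by linarith
    then show ?thesis using that(2) unfolding h_def c_def by linarith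
  qed
  have abs_le: "\<bar>u\<bar> \<le> h + \<bar>u - c\<bar>" using pos unfolding h_def c_def by linarith
  have mem': "(s, t) \<in> region (insert (i, j) D) \<longleftrightarrow> (s, t) \<in> region D \<or>
      (real j - 1 \<le> s \<and> s \<le> real j \<and> real i - 1 \<le> t \<and> t \<le> real i)" for s t
    unfolding mem_region by auto
  show ?thesis
  proof (cases "\<bar>u - c\<bar> \<le> 1")
    case True
    have "profile D u = h + \<bar>u - c\<bar>"
    proof (rule profile_eqI)
      show "h + \<bar>u - c\<bar> = \<bar>u\<bar> \<or> (\<exists>s t. (s, t) \<in> region D \<and> s - t = u \<and> h + \<bar>u - c\<bar> = s + t)"
      proof (cases "u \<ge> c")
        case u: True
        show ?thesis
        \<comment> \<open>To the right of the content, the lower boundary is the edge t = i - 1. For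
          i = 1 it lies on the axis, where the profile is the absolute value; otherwise it belongs
          to the box in the preceding row. The other half exchanges rows and columns.\<close>
        proof (cases "i = 1")
          case True
          then show ?thesis using u pos unfolding h_def c_def by auto
        next
          case False
          have "(real i - 1 + u, real i - 1) \<in> region D"
            unfolding mem_region using up[OF False] u True pos
            by (intro exI[of _ "i - 1"] exI[of _ j]) (auto simp: c_def of_nat_diff)
          then show ?thesis using u unfolding h_def c_def
            by (intro disjI2 exI[of _ "real i - 1 + u"] exI[of _ "real i - 1"]) auto
        qed
      next
        case u: False
        show ?thesis
        proof (cases "j = 1")
          case True
          then show ?thesis using u pos unfolding h_def c_def by auto
        next
          case False
          have "(real j - 1, real j - 1 - u) \<in> region D"
            unfolding mem_region using left[OF False] u True pos
            by (intro exI[of _ i] exI[of _ "j - 1"]) (auto simp: c_def of_nat_diff)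
          then show ?thesis using u unfolding h_def c_def
            by (intro disjI2 exI[of _ "real j - 1"] exI[of _ "real j - 1 - u"]) auto
        qed
      qed
    qed (use abs_le D_le in auto)
    moreover have "profile (insert (i, j) D) u = h + 2 - \<bar>u - c\<bar>"
    proof (rule profile_eqI)
      show "h + 2 - \<bar>u - c\<bar> = \<bar>u\<bar> \<or>
        (\<exists>s t. (s, t) \<in> region (insert (i, j) D) \<and> s - t = u \<and> h + 2 - \<bar>u - c\<bar> = s + t)"
      proof (cases "u \<ge> c")
        case u: True
        have "(real j, real j - u) \<in> region (insert (i, j) D)"
          unfolding mem' using u True by (auto simp: c_def)
        then show ?thesis using u unfolding h_def c_def
          by (intro disjI2 exI[of _ "real j"] exI[of _ "real j - u"]) auto
      next
        case u: False
        have "(real i + u, real i) \<in> region (insert (i, j) D)"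
          unfolding mem' using u True by (auto simp: c_def)
        then show ?thesis using u unfolding h_def c_def
          by (intro disjI2 exI[of _ "real i + u"] exI[of _ "real i"]) auto
      qed
      show "s + t \<le> h + 2 - \<bar>u - c\<bar>" if "(s, t) \<in> region (insert (i, j) D)" "s - t = u" for s t
        using that D_le[of s t] True unfolding mem' h_def c_def by auto
    qed (use abs_le True in auto)
    ultimately show ?thesis using True unfolding hat_def c_def by (auto simp: max_def)
  next
    case False
    have "\<not> (real j - 1 \<le> s \<and> s \<le> real j \<and> real i - 1 \<le> t \<and> t \<le> real i)" if "s - t = u" for s t
      using False that unfolding c_def by linarith
    then have "{s + t | s t. (s, t) \<in> region (insert (i, j) D) \<and> s - t = u} =
        {s + t | s t. (s, t) \<in> region D \<and> s - t = u}"
      unfolding mem' by blast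
    then have "profile (insert (i, j) D) u = profile D u" unfolding profile_def by simp
    then show ?thesis using False unfolding hat_def c_def by (auto simp: max_def)
  qed
qed

lemma profile_sigma_eq:
  assumes "D \<in> young_diagrams q"
  shows "profile_sigma D u = (\<Sum>b\<in>D. hat (u - rcontent b))"
proof -
  have "profile D u = \<bar>u\<bar> + 2 * (\<Sum>b\<in>D. hat (u - rcontent b))"
    using assms
  proof (induction rule: young_diagram_induct)
    case empty
    have "profile {} u = \<bar>u\<bar>" by (rule profile_eqI) (auto simp: mem_region)
    then show ?case by simp
  next
    case (insert D b q)
    obtain i j where b: "b = (i, j)" by (cases b)
    show ?case
      using profile_insert[of D q i j u] insert young_diagram_finite[OF insert(1)] unfolding b by simp
  qed
  then show ?thesis by (simp add: profile_sigma_def)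
qed

definition hat_deriv :: "real \<Rightarrow> real" where
  "hat_deriv v = (if \<bar>v\<bar> < 1 then - sgn v else 0)"

lemma hat_has_derivative:
  assumes "v \<noteq> 0" "\<bar>v\<bar> \<noteq> 1"
  shows "(hat has_real_derivative hat_deriv v) (at v)"
proof -
  have *: "(hat has_real_derivative d) (at v)"
    if "v \<in> A" "open A" "\<And>x. x \<in> A \<Longrightarrow> g x = hat x" "(g has_real_derivative d) (at v)" for A g d
    using has_field_derivative_transform_within_open[OF that(4,2,1,3)] .
  consider "v < -1" | "v \<in> {-1<..<0}" | "v \<in> {0<..<1}" | "v > 1"
    using assms by fastforce
  then show ?thesis
  proof cases
    case 1
    then show ?thesis
      by (intro *[of "{..<-1}" "\<lambda>_. 0"]) (auto simp: hat_def hat_deriv_def)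
  next
    case 2
    then show ?thesis
      by (intro *[of "{-1<..<0}" "\<lambda>x. 1 + x"])
        (auto simp: hat_def hat_deriv_def intro!: derivative_eq_intros)
  next
    case 3
    then show ?thesis
      by (intro *[of "{0<..<1}" "\<lambda>x. 1 - x"])
        (auto simp: hat_def hat_deriv_def intro!: derivative_eq_intros)
  next
    case 4
    then show ?thesis
      by (intro *[of "{1<..}" "\<lambda>_. 0"]) (auto simp: hat_def hat_deriv_def)
  qed
qed

lemma deriv_profile_sigma:
  assumes D: "D \<in> young_diagrams q" and x: "x \<notin> \<int>"
  shows "deriv (profile_sigma D) x = (\<Sum>b\<in>D. hat_deriv (x - rcontent b))"
proof -
  have "((\<lambda>x. hat (x - rcontent b)) has_real_derivative hat_deriv (x - rcontent b)) (at x)" for b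
  proof -
    have int: "rcontent b + of_int k \<in> \<int>" for k by simp
    have "x - rcontent b \<noteq> of_int k" for k
    proof
      assume "x - rcontent b = of_int k"
      then have "x = rcontent b + of_int k" by linarith
      then show False using x int[of k] by blast
    qed
    from this[of 0] this[of 1] this[of "-1"]
    have "x - rcontent b \<noteq> 0" "\<bar>x - rcontent b\<bar> \<noteq> 1" by auto
    from hat_has_derivative[OF this] show ?thesis
      by (auto intro: DERIV_chain'[where g=hat and f="\<lambda>x. x - rcontent b" and D=1, simplified] intro!: derivative_eq_intros)
  qed
  then have "((\<lambda>x. \<Sum>b\<in>D. hat (x - rcontent b)) has_real_derivative
      (\<Sum>b\<in>D. hat_deriv (x - rcontent b))) (at x)"
    by (intro DERIV_sum) auto
  moreover have "profile_sigma D = (\<lambda>x. \<Sum>b\<in>D. hat (x - rcontent b))"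
    using profile_sigma_eq[OF D] by (intro ext)
  ultimately show ?thesis by (simp add: DERIV_imp_deriv)
qed

text \<open>For real x the number x - z has constant nonzero imaginary part and never meets the
  branch cut, so the principal logarithm is an antiderivative on the whole line.\<close>

lemma has_bochner_integral_resolvent:
  fixes a b :: real and z :: complex
  assumes z: "z \<notin> \<real>" and ab: "a \<le> b"
  shows "has_bochner_integral lborel (\<lambda>x. indicator {a..b} x *\<^sub>R (1 / (of_real x - z)))
    (Ln (of_real b - z) - Ln (of_real a - z))"
proof (rule has_bochner_integral_FTC_Icc[OF ab])
  have nz: "of_real x - z \<noteq> 0" for x using z by (metis Reals_of_real eq_iff_diff_eq_0)
  have nn: "of_real x - z \<notin> \<real>\<^sub>\<le>\<^sub>0" for x
  proof
    assume "of_real x - z \<in> \<real>\<^sub>\<le>\<^sub>0"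
    then have "of_real x - z \<in> \<real>" by (rule nonpos_Reals_subset_Reals[THEN subsetD])
    from Reals_diff[OF Reals_of_real[of x] this] show False using z by simp
  qed
  fix x
  have "((\<lambda>w. Ln (w - z)) has_field_derivative 1 / (of_real x - z)) (at (of_real x))"
    using nn by (auto intro!: derivative_eq_intros simp: divide_inverse)
  then show "((\<lambda>x. Ln (of_real x - z)) has_vector_derivative 1 / (of_real x - z)) (at x within {a..b})"
    by (rule has_vector_derivative_real_field)
  show "continuous_on {a..b} (\<lambda>x. 1 / (of_real x - z))"
    using nz by (intro continuous_intros) auto
qed

definition cauchy_product :: "diagram \<Rightarrow> complex \<Rightarrow> complex" where
  "cauchy_product D z = 1 / z * (\<Prod>b\<in>D. (z - box_content b)^2 / ((z - box_content b)^2 - 1))"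

text \<open>The derivative of a hat is 1 to the left and -1 to the right of its centre, so each box
  contributes a second difference of logarithms. Exponentiating gives the rational factor w^2 / ((w
  - 1)(w + 1)) with w = c - z.\<close>

lemma exp_integral_profile:
  assumes D: "D \<in> young_diagrams q" and z: "z \<notin> \<real>"
  shows "1 / z * exp (LINT x|lborel. 1 / (complex_of_real x - z) *
      complex_of_real (deriv (profile_sigma D) x)) = cauchy_product D z"
proof -
  let ?R = "\<lambda>x. 1 / (complex_of_real x - z)"
  let ?L = "\<lambda>x. Ln (complex_of_real x - z)"
  let ?g = "\<lambda>b x. indicator {rcontent b - 1..rcontent b} x *\<^sub>R ?R x -
    indicator {rcontent b..rcontent b + 1} x *\<^sub>R ?R x"
  let ?I = "\<lambda>b. (?L (rcontent b) - ?L (rcontent b - 1)) - (?L (rcontent b + 1) - ?L (rcontent b))"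
  have nz: "of_real x - z \<noteq> 0" for x using z by (metis Reals_of_real eq_iff_diff_eq_0)
  have eq: "?R x * complex_of_real (deriv (profile_sigma D) x) = (\<Sum>b\<in>D. ?g b x)" if "x \<notin> \<int>" for x
  proof -
    have "?R x * of_real (hat_deriv (x - rcontent b)) = ?g b x" for b
    proof -
      have int: "rcontent b + of_int k \<in> \<int>" for k by simp
      have "x \<noteq> rcontent b + of_int k" for k using int[of k] \<open>x \<notin> \<int>\<close> by metis
      from this[of 0] this[of 1] this[of "-1"] show ?thesis
        by (auto simp: hat_deriv_def indicator_def sgn_if)
    qed
    then show ?thesis
      unfolding deriv_profile_sigma[OF D that] by (simp add: sum_distrib_left)
  qed
  have "countable (\<int> :: real set)" unfolding Ints_def by simp
  then have "(LINT x|lborel. ?R x * complex_of_real (deriv (profile_sigma D) x)) =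
      (LINT x|lborel. (\<Sum>b\<in>D. ?g b x))"
  proof (rule integral_discrete_difference)
    show "emeasure lborel {x :: real} = 0" "{x} \<in> sets lborel" for x by simp_all
  qed (rule eq)
  also have "\<dots> = (\<Sum>b\<in>D. ?I b)"
    by (intro has_bochner_integral_integral_eq has_bochner_integral_sum has_bochner_integral_diff
        has_bochner_integral_resolvent[OF z]) auto
  finally have "exp (LINT x|lborel. ?R x * complex_of_real (deriv (profile_sigma D) x)) =
      (\<Prod>b\<in>D. exp (?I b))"
    using exp_sum[OF young_diagram_finite[OF D]] by simp
  also have "\<dots> = (\<Prod>b\<in>D. (z - box_content b)^2 / ((z - box_content b)^2 - 1))"
  proof (intro prod.cong refl)
    fix b
    have c: "box_content b = of_real (rcontent b)" by (simp add: box_content_def)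
    define w where "w = box_content b - z"
    have w: "exp (?L (rcontent b)) = w" "exp (?L (rcontent b - 1)) = w - 1"
      "exp (?L (rcontent b + 1)) = w + 1" "w - 1 \<noteq> 0" "w + 1 \<noteq> 0"
      using nz[of "rcontent b"] nz[of "rcontent b - 1"] nz[of "rcontent b + 1"]
      unfolding w_def c by (simp_all add: algebra_simps)
    have "exp (?I b) = (w / (w - 1)) / ((w + 1) / w)" unfolding exp_diff w ..
    also have "\<dots> = w^2 / (w^2 - 1)"
    proof -
      have "w^2 - 1 = (w - 1) * (w + 1)" by (simp add: power2_eq_square algebra_simps)
      then show ?thesis using w(4,5) by (simp add: power2_eq_square)
    qed
    also have "w^2 = (z - box_content b)^2" unfolding w_def by (simp add: power2_commute)
    finally show "exp (?I b) = (z - box_content b)^2 / ((z - box_content b)^2 - 1)" .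
  qed
  finally show ?thesis unfolding cauchy_product_def by simp
qed

section \<open>Partial fractions of the Cauchy transform\<close>

lemma initial_segment:
  fixes J :: "nat set"
  assumes "finite J" "\<And>j k. j \<in> J \<Longrightarrow> 1 \<le> j \<and> (1 \<le> k \<and> k \<le> j \<longrightarrow> k \<in> J)"
  shows "J = {1..card J}"
proof (cases "J = {}")
  case False
  then have "Max J \<in> J" using assms(1) by simp
  have "J = {1..Max J}"
  proof (intro equalityI subsetI)
    show "j \<in> {1..Max J}" if "j \<in> J" for j
      using assms(1) assms(2)[OF that] that by simp
    show "j \<in> J" if "j \<in> {1..Max J}" for j
      using assms(2)[OF \<open>Max J \<in> J\<close>, of j] that by simp
  qed
  then have "card J = Max J" by (metis card_atLeastAtMost diff_Suc_1)
  with \<open>J = {1..Max J}\<close> show ?thesis by simp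
qed simp

definition row_len :: "diagram \<Rightarrow> nat \<Rightarrow> nat" where
  "row_len D i = card {j. (i, j) \<in> D}"

lemma finite_row:
  assumes "finite D"
  shows "finite {j. (i, j) \<in> D}"
  by (rule finite_subset[OF _ finite_imageI[OF assms, of snd]]) force

lemma row_eq:
  assumes D: "D \<in> young_diagrams q"
  shows "{j. (i, j) \<in> D} = {1..row_len D i}"
  unfolding row_len_def
proof (rule initial_segment)
  show "finite {j. (i, j) \<in> D}" by (rule finite_row[OF young_diagram_finite[OF D]])
  show "1 \<le> j \<and> (1 \<le> k \<and> k \<le> j \<longrightarrow> k \<in> {j. (i, j) \<in> D})" if "j \<in> {j. (i, j) \<in> D}" for j k
    using that young_diagram_pos[OF D, of i j] young_diagram_down[OF D, of i j i k] by auto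
qed

lemma young_diagram_le:
  assumes D: "D \<in> young_diagrams q" and ij: "(i, j) \<in> D"
  shows "i \<le> q" "j \<le> q"
proof -
  have pos: "1 \<le> i" "1 \<le> j" using young_diagram_pos[OF D ij] by auto
  have "card ((\<lambda>i'. (i', j)) ` {1..i}) \<le> card D"
    using young_diagram_down[OF D ij] pos by (intro card_mono young_diagram_finite[OF D]) auto
  then show "i \<le> q" using young_diagram_card[OF D] by (simp add: card_image inj_on_def)
  have "card ((\<lambda>j'. (i, j')) ` {1..j}) \<le> card D"
    using young_diagram_down[OF D ij] pos by (intro card_mono young_diagram_finite[OF D]) auto
  then show "j \<le> q" using young_diagram_card[OF D] by (simp add: card_image inj_on_def)
qed

lemma finite_young_diagrams: "finite (young_diagrams q)"
proof (rule finite_subset)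
  show "young_diagrams q \<subseteq> Pow ({1..q} \<times> {1..q})"
  proof (intro subsetI PowI)
    fix D b assume D: "D \<in> young_diagrams q" and b: "b \<in> D"
    obtain i j where ij: "b = (i, j)" by (rule prod.exhaust)
    show "b \<in> {1..q} \<times> {1..q}"
      using young_diagram_le[OF D b[unfolded ij]] young_diagram_pos[OF D b[unfolded ij]]
      unfolding ij by simp
  qed
qed simp

lemma young_diagram_Sigma:
  assumes D: "D \<in> young_diagrams q"
  shows "D = (SIGMA i:{1..q}. {1..row_len D i})"
proof -
  have "(i, j) \<in> D \<longleftrightarrow> i \<in> {1..q} \<and> j \<in> {1..row_len D i}" for i j
  proof -
    have "(i, j) \<in> D \<longleftrightarrow> j \<in> {1..row_len D i}" using row_eq[OF D, of i] by blast
    moreover have "i \<in> {1..q}" if "(i, j) \<in> D"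
      using young_diagram_le[OF D that] young_diagram_pos[OF D that] by simp
    ultimately show ?thesis by blast
  qed
  then show ?thesis by auto
qed

lemma row_len_le:
  assumes D: "D \<in> young_diagrams q"
  shows "row_len D i \<le> q"
proof (cases "row_len D i = 0")
  case False
  then have "row_len D i \<in> {j. (i, j) \<in> D}" unfolding row_eq[OF D] by simp
  then show ?thesis using young_diagram_le[OF D, of i "row_len D i"] by simp
qed simp

lemma row_len_antimono:
  assumes D: "D \<in> young_diagrams q" and "1 \<le> i" "i \<le> i'"
  shows "row_len D i' \<le> row_len D i"
  unfolding row_len_def
proof (rule card_mono)
  show "finite {j. (i, j) \<in> D}" by (rule finite_row[OF young_diagram_finite[OF D]])
  show "{j. (i', j) \<in> D} \<subseteq> {j. (i, j) \<in> D}"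
    using young_diagram_down[OF D, of i' _ i] young_diagram_pos[OF D, of i'] assms by auto
qed

text \<open>The factors telescope along a row, and only terms from its two ends survive; for an
  empty row these cancel to 1.\<close>

lemma row_product:
  fixes z :: complex
  assumes z: "\<And>k :: int. \<bar>k\<bar> \<le> int N \<Longrightarrow> z \<noteq> of_int k" and i: "1 \<le> i" "i \<le> N" and l: "l \<le> N"
  shows "(\<Prod>j\<in>{1..l}. (z - (of_nat j - of_nat i))^2 / ((z - (of_nat j - of_nat i))^2 - 1)) =
    (z + of_nat i - 1) / (z + of_nat i) * (1 + 1 / (z - (of_nat l - of_nat i + 1)))"
  using l
proof (induction l)
  case 0
  define u where "u = z + of_nat i - 1"
  have u: "u + 1 \<noteq> 0" "u \<noteq> 0"
    using z[of "- int i"] z[of "1 - int i"] i unfolding u_def by (auto simp: add_eq_0_iff2 algebra_simps)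
  have e: "z + of_nat i = u + 1" "z - (of_nat 0 - of_nat i + 1) = u" "u + 1 - 1 = u"
    unfolding u_def by simp_all
  have "u / (u + 1) * (1 + 1 / u) = 1" using u by (simp add: divide_simps)
  then show ?case unfolding e by simp
next
  case (Suc l)
  define w where "w = z - (of_nat (Suc l) - of_nat i)"
  have w: "w \<noteq> 0" "w - 1 \<noteq> 0" "w + 1 \<noteq> 0"
    using z[of "int (Suc l) - int i"] z[of "int (Suc l) - int i + 1"] z[of "int (Suc l) - int i - 1"] Suc.prems i
    unfolding w_def by (auto simp: algebra_simps)
  have e: "z - (of_nat l - of_nat i + 1) = w" "z - (of_nat (Suc l) - of_nat i + 1) = w - 1"
    unfolding w_def by (simp_all add: algebra_simps)
  have id: "(1 + 1 / w) * (w^2 / (w^2 - 1)) = 1 + 1 / (w - 1)"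
  proof -
    have "w^2 - 1 = (w - 1) * (w + 1)" by (simp add: power2_eq_square algebra_simps)
    then show ?thesis using w by (simp add: divide_simps power2_eq_square)
  qed
  let ?f = "\<lambda>j. (z - (of_nat j - of_nat i))^2 / ((z - (of_nat j - of_nat i))^2 - 1)"
  have "prod ?f {1..Suc l} = prod ?f {1..l} * ?f (Suc l)" by simp
  also have "\<dots> = (z + of_nat i - 1) / (z + of_nat i) * ((1 + 1 / w) * (w^2 / (w^2 - 1)))"
    using Suc unfolding e w_def[symmetric] by (simp only: mult.assoc Suc_leD)
  finally show ?case unfolding id e .
qed

text \<open>Candidate poles of the Cauchy transform; some of them may carry no mass.\<close>

definition pole :: "diagram \<Rightarrow> nat \<Rightarrow> real" where
  "pole D k = real (row_len D (Suc k)) - real k"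

lemma pole_step:
  assumes D: "D \<in> young_diagrams q" and "i < k"
  shows "pole D k \<le> pole D i - 1"
  using row_len_antimono[OF D, of "Suc i" "Suc k"] assms(2) unfolding pole_def by simp

lemma pole_last:
  assumes D: "D \<in> young_diagrams q"
  shows "pole D q = - real q"
proof -
  have "{j. (Suc q, j) \<in> D} = {}" using young_diagram_le[OF D, of "Suc q"] by auto
  then show ?thesis unfolding pole_def row_len_def by simp
qed

lemma pole_bound:
  assumes D: "D \<in> young_diagrams q" and "k \<le> q"
  shows "\<bar>pole D k\<bar> \<le> real q" "\<exists>m :: int. \<bar>m\<bar> \<le> int q \<and> pole D k = of_int m"
proof -
  have "\<bar>int (row_len D (Suc k)) - int k\<bar> \<le> int q"
    using row_len_le[OF D, of "Suc k"] assms(2) by linarith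
  moreover have e: "pole D k = of_int (int (row_len D (Suc k)) - int k)" unfolding pole_def by simp
  ultimately show "\<exists>m :: int. \<bar>m\<bar> \<le> int q \<and> pole D k = of_int m" by blast
  then show "\<bar>pole D k\<bar> \<le> real q" by force
qed

text \<open>The left ends of the \<open>q\<close> rows telescope to z / (z + q). Together with the
  prefactor 1/z this is 1 / (z + q), and -q is the candidate pole belonging to the empty row q +
  1.\<close>

lemma cauchy_product_rows:
  assumes D: "D \<in> young_diagrams q" and z: "\<And>k :: int. \<bar>k\<bar> \<le> int q \<Longrightarrow> z \<noteq> of_int k"
  shows "cauchy_product D z = 1 / (z - of_real (pole D q)) * (\<Prod>k<q. 1 + 1 / (z - of_real (pole D k)))"
proof -
  have nz: "z + of_nat i \<noteq> 0" if "i \<le> q" for i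
    using z[of "- int i"] that by (simp add: add_eq_0_iff2)
  have "(\<Prod>b\<in>D. (z - box_content b)^2 / ((z - box_content b)^2 - 1)) =
      (\<Prod>i\<in>{1..q}. \<Prod>j\<in>{1..row_len D i}. (z - box_content (i, j))^2 / ((z - box_content (i, j))^2 - 1))"
    by (subst young_diagram_Sigma[OF D]) (simp add: prod.Sigma)
  also have "\<dots> = (\<Prod>i\<in>{1..q}. (z + of_nat i - 1) / (z + of_nat i) *
      (1 + 1 / (z - (of_nat (row_len D i) - of_nat i + 1))))"
    using row_product[OF z] row_len_le[OF D] by (intro prod.cong refl) (simp add: box_content_def)
  also have "\<dots> = (\<Prod>i\<in>{1..q}. (z + of_nat i - 1) / (z + of_nat i)) *
      (\<Prod>i\<in>{1..q}. 1 + 1 / (z - (of_nat (row_len D i) - of_nat i + 1)))"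
    by (rule prod.distrib)
  also have "(\<Prod>i\<in>{1..q}. 1 + 1 / (z - (of_nat (row_len D i) - of_nat i + 1))) =
      (\<Prod>k<q. 1 + 1 / (z - of_real (pole D k)))"
    by (rule prod.reindex_bij_witness[of _ Suc "\<lambda>i. i - 1"])
      (auto simp: pole_def of_nat_diff algebra_simps)
  also have "(\<Prod>i\<in>{1..m}. (z + of_nat i - 1) / (z + of_nat i)) = z / (z + of_nat m)" if "m \<le> q" for m
    using that
  proof (induction m)
    case 0
    then show ?case using nz[of 0] by simp
  next
    case (Suc m)
    then show ?case using nz[of m] nz[of "Suc m"] by (simp add: add.commute add.left_commute)
  qed
  finally show ?thesis
    using nz[of 0] unfolding cauchy_product_def pole_last[OF D] by simp
qed

text \<open>For \<open>k < m\<close>, the residue at \<open>a k\<close> of the product of the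
  factors 1 + 1 / (z - a i) with i < m. For \<open>k = m\<close> no factor is left out, and the term
  is the value of that product at \<open>a m\<close>.\<close>

definition pf_weight :: "(nat \<Rightarrow> real) \<Rightarrow> nat \<Rightarrow> nat \<Rightarrow> real" where
  "pf_weight a m k = (\<Prod>i\<in>{..<m} - {k}. 1 + 1 / (a k - a i))"

lemma pf_weight_Suc:
  assumes "k < m"
  shows "pf_weight a (Suc m) k = pf_weight a m k * (1 + 1 / (a k - a m))"
proof -
  have "{..<Suc m} - {k} = insert m ({..<m} - {k})" using assms by auto
  then show ?thesis unfolding pf_weight_def by (simp add: mult.commute)
qed

lemma pf_weight_last:
  shows "pf_weight a (Suc m) m = (\<Prod>i<m. 1 + 1 / (a m - a i))"
    and "pf_weight a m m = (\<Prod>i<m. 1 + 1 / (a m - a i))"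
proof -
  have "{..<Suc m} - {m} = {..<m}" "{..<m} - {m} = {..<m}" by auto
  then show "pf_weight a (Suc m) m = (\<Prod>i<m. 1 + 1 / (a m - a i))"
    "pf_weight a m m = (\<Prod>i<m. 1 + 1 / (a m - a i))" unfolding pf_weight_def by simp_all
qed

text \<open>Stated over a general real field because it is used both at a complex argument and at
  the real point \<open>a m\<close>.\<close>

lemma partial_fraction:
  fixes z :: "'a :: real_field"
  assumes "inj_on a {..<m}" "\<And>k. k < m \<Longrightarrow> z \<noteq> of_real (a k)"
  shows "(\<Prod>i<m. 1 + 1 / (z - of_real (a i))) =
    1 + (\<Sum>k<m. of_real (pf_weight a m k) / (z - of_real (a k)))"
  using assms
proof (induction m arbitrary: z)
  case (Suc m)
  let ?w = "\<lambda>k. of_real (pf_weight a m k) :: 'a" and ?a = "\<lambda>k. of_real (a k) :: 'a"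
  have inj: "inj_on a {..<m}" using Suc.prems(1) by (rule inj_on_subset) auto
  have ne: "a m \<noteq> a k" if "k < m" for k
    using inj_onD[OF Suc.prems(1), of m k] that by auto
  have ne': "?a m \<noteq> ?a k" if "k < m" for k using ne[OF that] by simp
  \<comment> \<open>The residue at the new pole is the old product evaluated there, which the
    induction hypothesis expands.\<close>
  have last: "of_real (pf_weight a (Suc m) m) = 1 + (\<Sum>k<m. ?w k / (?a m - ?a k))"
    unfolding pf_weight_last using Suc.IH[OF inj, of "?a m"] ne by simp
  have zm: "z - ?a m \<noteq> 0" using Suc.prems(2)[of m] by simp
  have "(\<Prod>i<Suc m. 1 + 1 / (z - ?a i)) = (1 + (\<Sum>k<m. ?w k / (z - ?a k))) * (1 + 1 / (z - ?a m))"
    using Suc.IH[OF inj, of z] Suc.prems(2) by simp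
  also have "\<dots> = 1 + (\<Sum>k<m. ?w k / (z - ?a k)) + 1 / (z - ?a m) +
      (\<Sum>k<m. ?w k / (z - ?a k) * (1 / (z - ?a m)))"
    by (simp add: algebra_simps sum_distrib_right add_divide_distrib sum_divide_distrib)
  also have "(\<Sum>k<m. ?w k / (z - ?a k) * (1 / (z - ?a m))) =
      (\<Sum>k<m. ?w k / (?a k - ?a m) / (z - ?a k) + ?w k / (?a m - ?a k) / (z - ?a m))"
  proof (intro sum.cong refl)
    fix k assume "k \<in> {..<m}"
    then have nz: "z - ?a k \<noteq> 0" "?a k - ?a m \<noteq> 0" using Suc.prems(2)[of k] ne'[of k] by auto
    have "1 / (z - ?a k) * (1 / (z - ?a m)) = 1 / (?a k - ?a m) * (1 / (z - ?a k) - 1 / (z - ?a m))"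
      using nz zm by (simp add: divide_simps)
    then have "?w k * (1 / (z - ?a k) * (1 / (z - ?a m))) =
        ?w k * (1 / (?a k - ?a m) * (1 / (z - ?a k) - 1 / (z - ?a m)))" by simp
    moreover have "1 / (?a m - ?a k) = - (1 / (?a k - ?a m))" by (simp add: minus_divide_right)
    then have "?w k / (?a m - ?a k) = - (?w k * (1 / (?a k - ?a m)))"
      by (metis (no_types) mult_minus_right times_divide_eq_right mult.right_neutral)
    ultimately show "?w k / (z - ?a k) * (1 / (z - ?a m)) =
        ?w k / (?a k - ?a m) / (z - ?a k) + ?w k / (?a m - ?a k) / (z - ?a m)"
      by (simp add: algebra_simps)
  qed
  also have "\<dots> = (\<Sum>k<m. ?w k / (?a k - ?a m) / (z - ?a k)) + (\<Sum>k<m. ?w k / (?a m - ?a k)) / (z - ?a m)"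
    by (simp add: sum.distrib sum_divide_distrib)
  finally have "(\<Prod>i<Suc m. 1 + 1 / (z - ?a i)) =
      1 + (\<Sum>k<m. ?w k / (z - ?a k) + ?w k / (?a k - ?a m) / (z - ?a k)) +
      (1 + (\<Sum>k<m. ?w k / (?a m - ?a k))) / (z - ?a m)"
    by (simp add: sum.distrib add_divide_distrib)
  also have "(\<Sum>k<m. ?w k / (z - ?a k) + ?w k / (?a k - ?a m) / (z - ?a k)) =
      (\<Sum>k<m. of_real (pf_weight a (Suc m) k) / (z - ?a k))"
    by (intro sum.cong refl) (simp add: pf_weight_Suc distrib_left add_divide_distrib)
  finally show ?case unfolding last[symmetric] by simp
qed simp

text \<open>The residues of the product of the factors 1 + 1 / (z - a i), i < m, after
  multiplication by 1 / (z - a m).\<close>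

definition mass :: "(nat \<Rightarrow> real) \<Rightarrow> nat \<Rightarrow> nat \<Rightarrow> real" where
  "mass a m k = (if k < m then pf_weight a m k / (a k - a m) else pf_weight a m m)"

text \<open>Gaps of at least 1 make every factor 1 + 1 / (a k - a i) nonnegative: for i < k the
  difference is at most -1, for i > k it is positive. A gap of exactly 1 gives mass zero. The total
  mass is found by evaluating the partial fraction expansion at \<open>a m\<close>.\<close>

lemma mass_properties:
  assumes a: "\<And>i k. i < k \<Longrightarrow> k \<le> m \<Longrightarrow> a k \<le> a i - 1"
  shows mass_nonneg: "k \<le> m \<Longrightarrow> 0 \<le> mass a m k"
    and mass_sum: "(\<Sum>k\<le>m. mass a m k) = 1"
    and mass_partial_fraction: "\<And>z :: complex. (\<And>k. k \<le> m \<Longrightarrow> z \<noteq> of_real (a k)) \<Longrightarrow>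
      1 / (z - of_real (a m)) * (\<Prod>k<m. 1 + 1 / (z - of_real (a k))) =
      (\<Sum>k\<le>m. of_real (mass a m k) / (z - of_real (a k)))"
proof -
  have inj: "inj_on a {..<m}"
  proof (rule inj_onI, rule ccontr)
    fix i k assume "i \<in> {..<m}" "k \<in> {..<m}" "a i = a k" "i \<noteq> k"
    then show False using a[of i k] a[of k i] by (cases "i < k") auto
  qed
  have w: "0 \<le> pf_weight a m k" if "k \<le> m" for k
    unfolding pf_weight_def
  proof (rule prod_nonneg)
    fix i assume i: "i \<in> {..<m} - {k}"
    show "0 \<le> 1 + 1 / (a k - a i)"
    proof (cases "i < k")
      case True
      then have "a k - a i \<le> -1" using a[of i k] that by simp
      then show ?thesis by (simp add: divide_simps)
    next
      case False
      then have "a k - a i > 0" using a[of k i] i by simp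
      then show ?thesis by simp
    qed
  qed
  then show "0 \<le> mass a m k" if "k \<le> m" for k
    using that a[of k m] unfolding mass_def by auto
  have ne: "a m \<noteq> a k" if "k < m" for k using a[of k m] that by simp
  have last: "pf_weight a m m = 1 + (\<Sum>k<m. pf_weight a m k / (a m - a k))"
    unfolding pf_weight_last using partial_fraction[OF inj, of "a m"] ne by simp
  have neg: "pf_weight a m k / (a m - a k) = - (pf_weight a m k / (a k - a m))" for k
    by (metis minus_diff_eq minus_divide_right)
  have split: "{..m} = insert m {..<m}" by auto
  have "(\<Sum>k<m. mass a m k) = (\<Sum>k<m. pf_weight a m k / (a k - a m))"
    by (intro sum.cong) (auto simp: mass_def)
  then show "(\<Sum>k\<le>m. mass a m k) = 1"
    unfolding split using last by (simp add: neg sum_negf) (simp add: mass_def)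
  fix z :: complex assume z: "\<And>k. k \<le> m \<Longrightarrow> z \<noteq> of_real (a k)"
  let ?w = "\<lambda>k. complex_of_real (pf_weight a m k)" and ?a = "\<lambda>k. complex_of_real (a k)"
  have zm: "z - ?a m \<noteq> 0" using z[of m] by simp
  have "1 / (z - ?a m) * (\<Prod>k<m. 1 + 1 / (z - ?a k)) =
      1 / (z - ?a m) + (\<Sum>k<m. ?w k / (z - ?a k) * (1 / (z - ?a m)))"
    using partial_fraction[OF inj, of z] z by (simp add: algebra_simps sum_divide_distrib add_divide_distrib)
  also have "(\<Sum>k<m. ?w k / (z - ?a k) * (1 / (z - ?a m))) =
      (\<Sum>k<m. of_real (mass a m k) / (z - ?a k) + of_real (pf_weight a m k / (a m - a k)) * (1 / (z - ?a m)))"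
  proof (intro sum.cong refl)
    fix k assume k: "k \<in> {..<m}"
    then have nz: "z - ?a k \<noteq> 0" "?a k - ?a m \<noteq> 0" using z[of k] ne[of k] by auto
    have e: "1 / (z - ?a k) * (1 / (z - ?a m)) = 1 / (?a k - ?a m) * (1 / (z - ?a k) - 1 / (z - ?a m))"
      using nz zm by (simp add: divide_simps)
    have "?w k / (z - ?a k) * (1 / (z - ?a m)) = ?w k * (1 / (z - ?a k) * (1 / (z - ?a m)))" by simp
    also have "\<dots> = ?w k / (?a k - ?a m) / (z - ?a k) - ?w k / (?a k - ?a m) * (1 / (z - ?a m))"
      unfolding e by (simp add: algebra_simps)
    finally show "?w k / (z - ?a k) * (1 / (z - ?a m)) =
        of_real (mass a m k) / (z - ?a k) + of_real (pf_weight a m k / (a m - a k)) * (1 / (z - ?a m))"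
      using k unfolding neg by (simp add: mass_def)
  qed
  also have "\<dots> = (\<Sum>k<m. of_real (mass a m k) / (z - ?a k)) +
      of_real (\<Sum>k<m. pf_weight a m k / (a m - a k)) * (1 / (z - ?a m))"
    by (simp add: sum.distrib sum_divide_distrib)
  finally show "1 / (z - ?a m) * (\<Prod>k<m. 1 + 1 / (z - ?a k)) =
      (\<Sum>k\<le>m. of_real (mass a m k) / (z - ?a k))"
    unfolding split using last by (simp add: mass_def add_divide_distrib)
qed

definition atomic_measure :: "nat \<Rightarrow> (nat \<Rightarrow> real) \<Rightarrow> (nat \<Rightarrow> real) \<Rightarrow> real measure" where
  "atomic_measure m v a = distr (measure_pmf (embed_pmf (\<lambda>k. if k \<le> m then v k else 0))) borel a"

lemma atomic_measure:
  fixes f :: "real \<Rightarrow> 'b :: {banach, second_countable_topology}"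
  assumes v: "\<And>k. k \<le> m \<Longrightarrow> 0 \<le> v k" and sum: "(\<Sum>k\<le>m. v k) = 1"
  shows "prob_space (atomic_measure m v a)"
    and "sets (atomic_measure m v a) = sets borel"
    and "AE x in atomic_measure m v a. x \<in> a ` {..m}"
    and "f \<in> borel_measurable borel \<Longrightarrow> integral\<^sup>L (atomic_measure m v a) f = (\<Sum>k\<le>m. v k *\<^sub>R f (a k))"
proof -
  let ?v = "\<lambda>k. if k \<le> m then v k else 0"
  let ?p = "embed_pmf ?v"
  have "(\<integral>\<^sup>+k. ennreal (?v k) \<partial>count_space UNIV) = (\<Sum>k\<in>{..m}. ennreal (?v k))"
    by (rule nn_integral_count_space') auto
  also have "\<dots> = ennreal (\<Sum>k\<le>m. v k)" using v by (subst sum_ennreal[symmetric]) auto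
  finally have p: "pmf ?p k = ?v k" for k
    using v sum by (intro pmf_embed_pmf) auto
  have set: "set_pmf ?p \<subseteq> {..m}" by (auto simp: set_pmf_iff p split: if_splits)
  show "prob_space (atomic_measure m v a)"
    unfolding atomic_measure_def by (intro prob_space.prob_space_distr prob_space_measure_pmf) simp
  show "sets (atomic_measure m v a) = sets borel" unfolding atomic_measure_def by simp
  have "a ` {..m} \<in> sets borel" by (intro borel_closed finite_imp_closed) auto
  then show "AE x in atomic_measure m v a. x \<in> a ` {..m}"
    unfolding atomic_measure_def using set by (subst AE_distr_iff) (auto simp: AE_measure_pmf_iff)
  assume "f \<in> borel_measurable borel"
  then have "integral\<^sup>L (atomic_measure m v a) f = (LINT k|measure_pmf ?p. f (a k))"
    unfolding atomic_measure_def by (intro integral_distr) auto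
  also have "\<dots> = (\<Sum>k\<le>m. pmf ?p k *\<^sub>R f (a k))" by (rule integral_measure_pmf) (use set in auto)
  finally show "integral\<^sup>L (atomic_measure m v a) f = (\<Sum>k\<le>m. v k *\<^sub>R f (a k))" by (simp add: p)
qed

section \<open>Compactly supported measures are determined by their Cauchy transform\<close>

lemma bounded_support_moments:
  assumes M: "prob_space M" "sets M = sets borel" and R: "AE x in M. \<bar>x\<bar> \<le> R"
  shows bounded_support_integrable: "integrable M (\<lambda>x. x ^ l)"
    and bounded_support_abs_moment: "(LINT x|M. \<bar>x\<bar> ^ l) \<le> R ^ l"
    and bounded_support_moment_series: "\<And>w :: complex. norm w * R < 1 \<Longrightarrow>
      (\<lambda>l. of_real (LINT x|M. x ^ l) * w ^ l) sums (LINT x|M. 1 / (1 - w * of_real x))"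
proof -
  interpret prob_space M by (rule M(1))
  note [measurable_cong] = M(2)
  have R0: "0 \<le> R"
  proof (rule ccontr)
    assume "\<not> 0 \<le> R"
    have "AE x in M. False" using R by eventually_elim (use \<open>\<not> 0 \<le> R\<close> in linarith)
    then show False by (simp add: AE_const)
  qed
  have bound: "AE x in M. norm (x ^ l) \<le> R ^ l" for l
    using R by eventually_elim (simp add: power_abs power_mono)
  show int: "integrable M (\<lambda>x. x ^ l)" for l
    by (rule integrable_const_bound[OF bound]) measurable
  have "integrable M (\<lambda>x. \<bar>x\<bar> ^ l)" for l
    using integrable_abs[OF int[of l]] by (simp add: power_abs)
  moreover have "AE x in M. \<bar>x\<bar> ^ l \<le> R ^ l" for l
    using R by eventually_elim (simp add: power_mono)
  ultimately show abs: "(LINT x|M. \<bar>x\<bar> ^ l) \<le> R ^ l" for l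
    using integral_mono_AE[of M "\<lambda>x. \<bar>x\<bar> ^ l" "\<lambda>_. R ^ l"] by (simp add: prob_space)
  fix w :: complex assume w: "norm w * R < 1"
  let ?f = "\<lambda>l x. (w * complex_of_real x) ^ l"
  have int': "integrable M (?f l)" for l
    using int[of l] by (simp add: power_mult_distrib flip: of_real_power)
  have norm: "AE x in M. norm (w * complex_of_real x) < 1"
    using R
  proof eventually_elim
    case (elim x)
    have "norm w * \<bar>x\<bar> \<le> norm w * R" using elim by (intro mult_left_mono) auto
    then show ?case using w by (simp add: norm_mult)
  qed
  have "(\<lambda>l. integral\<^sup>L M (?f l)) sums (LINT x|M. suminf (\<lambda>l. ?f l x))"
  proof (rule sums_integral[OF int'])
    show "AE x in M. summable (\<lambda>l. norm (?f l x))"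
      using norm by eventually_elim (simp add: norm_power summable_geometric)
    show "summable (\<lambda>l. LINT x|M. norm (?f l x))"
    proof (rule summable_comparison_test[OF _ summable_geometric[of "norm w * R"]])
      show "\<exists>N. \<forall>l\<ge>N. norm (LINT x|M. norm (?f l x)) \<le> (norm w * R) ^ l"
      proof (intro exI[of _ 0] allI impI)
        fix l
        have "(LINT x|M. norm (?f l x)) = norm w ^ l * (LINT x|M. \<bar>x\<bar> ^ l)"
          by (simp add: norm_power norm_mult power_mult_distrib)
        also have "\<dots> \<le> norm w ^ l * R ^ l" using abs by (intro mult_left_mono) auto
        finally show "norm (LINT x|M. norm (?f l x)) \<le> (norm w * R) ^ l"
          by (simp add: power_mult_distrib)
      qed
    qed (use w R0 in simp)
  qed
  also have "(LINT x|M. suminf (\<lambda>l. ?f l x)) = (LINT x|M. 1 / (1 - w * of_real x))"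
  proof (rule integral_cong_AE)
    show "AE x in M. suminf (\<lambda>l. ?f l x) = 1 / (1 - w * of_real x)"
      using norm by eventually_elim (simp add: suminf_geometric)
  qed measurable
  also have "(\<lambda>l. integral\<^sup>L M (?f l)) = (\<lambda>l. of_real (LINT x|M. x ^ l) * w ^ l)"
    by (simp add: power_mult_distrib mult.commute flip: of_real_power)
  finally show "(\<lambda>l. of_real (LINT x|M. x ^ l) * w ^ l) sums (LINT x|M. 1 / (1 - w * of_real x))" .
qed

text \<open>For support in [-R, R], the Taylor remainder of the characteristic function is at most 2
  (\<bar>t\<bar> R)^n / n!, which tends to 0. The moments therefore determine the characteristic
  function.\<close>

lemma measure_eqI_moments:
  fixes M N :: "real measure"
  assumes M: "prob_space M" "sets M = sets borel" and RM: "AE x in M. \<bar>x\<bar> \<le> R"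
    and N: "prob_space N" "sets N = sets borel" and RN: "AE x in N. \<bar>x\<bar> \<le> R"
    and eq: "\<And>l. (LINT x|M. x ^ l) = (LINT x|N. x ^ l)"
  shows "M = N"
proof (rule Levy_uniqueness)
  show rM: "real_distribution M" and rN: "real_distribution N"
    using M N by (auto simp: real_distribution_def real_distribution_axioms_def)
  show "char M = char N"
  proof
    fix t :: real
    let ?s = "\<lambda>n. \<Sum>k\<le>n. ((\<i> * complex_of_real t)^k / fact k) * (LINT x|M. x ^ k)"
    let ?b = "\<lambda>n. 2 * ((\<bar>t\<bar> * R) ^ n / fact n)"
    have b: "norm (char P t - (\<Sum>k\<le>n. ((\<i> * complex_of_real t)^k / fact k) * (LINT x|P. x ^ k))) \<le> ?b n"
      if P: "prob_space P" "sets P = sets borel" "AE x in P. \<bar>x\<bar> \<le> R" "real_distribution P" for P n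
    proof -
      have "norm (char P t - (\<Sum>k\<le>n. ((\<i> * complex_of_real t)^k / fact k) * (LINT x|P. x ^ k)))
          \<le> (2*\<bar>t\<bar>^n / fact n) * (LINT x|P. \<bar>x\<bar>^n)"
        by (rule real_distribution.char_approx1[OF P(4) bounded_support_integrable[OF P(1-3)]])
      also have "\<dots> \<le> (2*\<bar>t\<bar>^n / fact n) * R ^ n"
        by (intro mult_left_mono bounded_support_abs_moment[OF P(1-3)]) auto
      finally show ?thesis by (simp add: power_mult_distrib)
    qed
    have "summable (\<lambda>n. (\<bar>t\<bar> * R) ^ n / fact n)"
      using summable_exp[of "\<bar>t\<bar> * R"] by (simp add: divide_inverse mult.commute)
    then have lim: "?b \<longlonglongrightarrow> 0"
      by (rule tendsto_mult_right_zero[OF summable_LIMSEQ_zero])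
    have "(\<lambda>n. char M t - ?s n) \<longlonglongrightarrow> 0"
      by (rule Lim_null_comparison[OF _ lim]) (use b[OF M RM rM] in auto)
    moreover have "(\<lambda>n. char N t - ?s n) \<longlonglongrightarrow> 0"
      by (rule Lim_null_comparison[OF _ lim]) (use b[OF N RN rN] eq in auto)
    ultimately have "(\<lambda>n. (char M t - ?s n) - (char N t - ?s n)) \<longlonglongrightarrow> 0 - 0" by (rule tendsto_diff)
    then show "char M t = char N t" by (simp add: LIMSEQ_const_iff)
  qed
qed

text \<open>In w = 1/z the difference of the two transforms becomes a power series whose
  coefficients are the differences of moments. If one were nonzero, 0 would be an isolated zero; but
  the series vanishes at every nonreal w near 0, in particular at small imaginary ones.\<close>

lemma measure_eqI_cauchy:
  assumes M: "prob_space M" "sets M = sets borel" "compact C" "AE x in M. x \<in> C"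
    and N: "prob_space N" "sets N = sets borel" "compact C'" "AE x in N. x \<in> C'"
    and eq: "\<And>z :: complex. z \<notin> \<real> \<Longrightarrow> (LINT x|M. 1 / (z - of_real x)) = (LINT x|N. 1 / (z - of_real x))"
  shows "M = N"
proof -
  obtain R1 R2 where "\<And>x. x \<in> C \<Longrightarrow> norm x \<le> R1" "\<And>x. x \<in> C' \<Longrightarrow> norm x \<le> R2"
    using compact_imp_bounded[OF M(3)] compact_imp_bounded[OF N(3)] unfolding bounded_iff by blast
  define R where "R = max 1 (max R1 R2)"
  have R: "R > 0" unfolding R_def by simp
  have RM: "AE x in M. \<bar>x\<bar> \<le> R"
    using M(4) by eventually_elim (use \<open>\<And>x. x \<in> C \<Longrightarrow> norm x \<le> R1\<close> in \<open>force simp: R_def\<close>)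
  have RN: "AE x in N. \<bar>x\<bar> \<le> R"
    using N(4) by eventually_elim (use \<open>\<And>x. x \<in> C' \<Longrightarrow> norm x \<le> R2\<close> in \<open>force simp: R_def\<close>)
  define d where "d l = complex_of_real (LINT x|M. x ^ l) - of_real (LINT x|N. x ^ l)" for l
  define f where "f w = (LINT x|M. 1 / (1 - w * of_real x)) - (LINT x|N. 1 / (1 - w * of_real x))"
    for w :: complex
  have ser: "(\<lambda>l. d l * w ^ l) sums f w" if "norm w < 1 / R" for w
  proof -
    have w: "norm w * R < 1" using that R by (simp add: field_simps)
    show ?thesis
      using sums_diff[OF bounded_support_moment_series[OF M(1,2) RM w] bounded_support_moment_series[OF N(1,2) RN w]]
      unfolding d_def f_def by (simp add: algebra_simps)
  qed
  have zero: "f w = 0" if "w \<notin> \<real>" for w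
  proof -
    have w: "w \<noteq> 0" "1 / w \<notin> \<real>"
      using that by (auto simp: divide_inverse)
    have e: "1 / (1 - w * of_real x) = 1 / w * (1 / (1 / w - of_real x))" for x
      using w(1) by (simp add: divide_simps) (simp add: algebra_simps)
    show ?thesis unfolding f_def e integral_mult_right_zero eq[OF w(2)] by (rule diff_self)
  qed
  have f0: "f 0 = 0"
    unfolding f_def by (simp add: prob_space.prob_space[OF M(1)] prob_space.prob_space[OF N(1)])
  have "d l = 0" for l
  proof (cases "l = 0")
    case True
    then show ?thesis
      unfolding d_def by (simp add: prob_space.prob_space[OF M(1)] prob_space.prob_space[OF N(1)])
  next
    case False
    show ?thesis
    proof (rule ccontr)
      assume dl: "d l \<noteq> 0"
      obtain s where s: "0 < s" "\<And>z. z \<in> cball 0 s - {0} \<Longrightarrow> f z \<noteq> 0"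
      proof (rule powser_0_nonzero[of "1 / R" 0 d f l])
        show "(\<lambda>n. d n * (x - 0) ^ n) sums f x" if "norm (x - 0) < 1 / R" for x
          using ser[of x] that by simp
      qed (use R f0 dl False in auto)
      have "\<i> * of_real s \<notin> \<real>" using s(1) by (simp add: complex_is_Real_iff)
      then have "f (\<i> * of_real s) = 0" by (rule zero)
      moreover have "\<i> * of_real s \<in> cball 0 s - {0}" using s(1) by (simp add: norm_mult)
      ultimately show False using s(2) by blast
    qed
  qed
  then have "(LINT x|M. x ^ l) = (LINT x|N. x ^ l)" for l unfolding d_def by simp
  then show ?thesis by (rule measure_eqI_moments[OF M(1,2) RM N(1,2) RN])
qed

text \<open>Resolves the definite description: the residues of the Cauchy transform give a
  probability measure with the required transform, and the transform determines a compactly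
  supported measure.\<close>

lemma transition_measure_eq:
  assumes D: "D \<in> young_diagrams q"
  shows "transition_measure D = atomic_measure q (mass (pole D) q) (pole D)"
proof -
  let ?a = "pole D" and ?v = "mass (pole D) q"
  let ?M = "atomic_measure q ?v ?a"
  let ?P = "\<lambda>M. prob_space M \<and> sets M = sets borel \<and> (\<exists>C. compact C \<and> (AE x in M. x \<in> C)) \<and>
     (\<forall>z :: complex. z \<notin> \<real> \<longrightarrow>
        1 / z * exp (LINT x|lborel. 1 / (complex_of_real x - z)
                                      * complex_of_real (deriv (profile_sigma D) x))
        = (LINT x|M. 1 / (z - complex_of_real x)))"
  have step: "\<And>i k. i < k \<Longrightarrow> k \<le> q \<Longrightarrow> ?a k \<le> ?a i - 1" using pole_step[OF D] by blast
  note v = mass_nonneg[OF step] mass_sum[OF step]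
  note M = atomic_measure[of q ?v, OF v]
  have int: "integral\<^sup>L ?M (\<lambda>x. 1 / (z - complex_of_real x)) = cauchy_product D z" if z: "z \<notin> \<real>" for z
  proof -
    have z1: "z \<noteq> of_int k" and z2: "z \<noteq> of_real x" for k :: int and x using z by auto
    have "integral\<^sup>L ?M (\<lambda>x. 1 / (z - complex_of_real x)) = (\<Sum>k\<le>q. of_real (?v k) / (z - of_real (?a k)))"
      by (subst M(4)) (auto simp: scaleR_conv_of_real)
    also have "\<dots> = cauchy_product D z"
      unfolding cauchy_product_rows[OF D z1] by (rule mass_partial_fraction[OF step z2, symmetric])
    finally show ?thesis .
  qed
  have comp: "compact (?a ` {..q})" by (intro finite_imp_compact) simp
  have PM: "?P ?M"
    using M(1-3) comp int exp_integral_profile[OF D] by auto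
  show ?thesis unfolding transition_measure_def
  proof (rule the_equality)
    show "?P ?M" by (rule PM)
    fix N assume N: "?P N"
    then obtain C where C: "compact C" "AE x in N. x \<in> C" by blast
    show "N = ?M"
      using N PM C
      by (intro measure_eqI_cauchy[OF _ _ C M(1,2) comp M(3)]) auto
  qed
qed

lemma moment_eq:
  assumes D: "D \<in> young_diagrams q"
  shows "moment l D = (\<Sum>k\<le>q. mass (pole D) q k * pole D k ^ l)"
proof -
  have step: "\<And>i k. i < k \<Longrightarrow> k \<le> q \<Longrightarrow> pole D k \<le> pole D i - 1" using pole_step[OF D] by blast
  note M = atomic_measure(4)[of q "mass (pole D) q", OF mass_nonneg[OF step] mass_sum[OF step]]
  show ?thesis unfolding moment_def transition_measure_eq[OF D] by (subst M) auto
qed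

section \<open>Moments as power series coefficients, and recovery of a diagram from them\<close>

definition icontent :: "nat \<times> nat \<Rightarrow> int" where
  "icontent b = int (snd b) - int (fst b)"

lemma content_icontent: "box_content b = of_int (icontent b)"
  by (simp add: box_content_def icontent_def)

lemma icontent_bound:
  assumes "D \<in> young_diagrams q" "b \<in> D"
  shows "\<bar>icontent b\<bar> + 1 \<le> int q"
proof -
  obtain i j where "b = (i, j)" by (rule prod.exhaust)
  then show ?thesis
    using young_diagram_le[of D q i j] young_diagram_pos[of D q i j] assms
    unfolding icontent_def by auto
qed

text \<open>For 0 < \<bar>w\<bar> < 1 / (q + 1) the point z = 1/w has modulus above q + 1, beyond
  all candidate poles and all contents shifted by one. There the partial fractions equal the product
  over boxes, so both have the same expansion at w = 0.\<close>

lemma moment_fps_nth: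
  assumes D: "D \<in> young_diagrams q"
  shows "moment_fps D $ l = of_real (moment l D)"
proof -
  let ?a = "\<lambda>k. complex_of_real (pole D k)" and ?v = "\<lambda>k. complex_of_real (mass (pole D) q k)"
  have step: "\<And>i k. i < k \<Longrightarrow> k \<le> q \<Longrightarrow> pole D k \<le> pole D i - 1" using pole_step[OF D] by blast
  define F where "F = (\<Sum>k\<le>q. fps_const (?v k) * inverse (1 - fps_const (?a k) * fps_X))"
  define f where "f w = (\<Sum>k\<le>q. ?v k * inverse (1 - ?a k * w))" for w :: complex
  let ?num = "\<lambda>w. \<Prod>b\<in>D. (1 - box_content b * w)^2"
  let ?den = "\<lambda>w. \<Prod>b\<in>D. (1 - box_content b * w)^2 - w^2"
  have fF: "f has_fps_expansion F"
    unfolding f_def F_def by (intro fps_expansion_intros) auto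
  have "f w * ?den w = ?num w" if w: "norm w < 1 / (real q + 1)" for w
  proof (cases "w = 0")
    case True
    have "(\<Sum>k\<le>q. ?v k) = 1" using mass_sum[OF step] by (simp flip: of_real_sum)
    then show ?thesis using True by (simp add: f_def)
  next
    case False
    define z where "z = 1 / w"
    have nz: "norm z > real q + 1"
      using w False unfolding z_def by (simp add: norm_divide field_simps)
    have z: "z \<noteq> of_int k" if "\<bar>k\<bar> \<le> int q" for k
    proof
      assume "z = of_int k"
      then have "norm z = \<bar>of_int k\<bar>" by simp
      then show False using nz that by linarith
    qed
    have za: "z \<noteq> ?a k" if kq: "k \<le> q" for k
    proof -
      obtain m :: int where m: "\<bar>m\<bar> \<le> int q" "pole D k = of_int m"
        using pole_bound(2)[OF D kq] by blast
      then show ?thesis using z[OF m(1)] by simp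
    qed
    have w_z: "w = 1 / z" "z \<noteq> 0" using False unfolding z_def by auto
    have "cauchy_product D z = 1 / (z - ?a q) * (\<Prod>k<q. 1 + 1 / (z - ?a k))"
      by (rule cauchy_product_rows[OF D]) (rule z)
    also have "\<dots> = (\<Sum>k\<le>q. ?v k / (z - ?a k))"
      by (rule mass_partial_fraction[OF step]) (simp_all add: za)
    also have "\<dots> = w * f w"
      unfolding f_def sum_distrib_left
    proof (intro sum.cong refl)
      fix k assume "k \<in> {..q}"
      then have "z - ?a k \<noteq> 0" using za by simp
      then show "?v k / (z - ?a k) = w * (?v k * inverse (1 - ?a k * w))"
        unfolding w_z(1) using w_z(2) by (simp add: divide_simps)
    qed
    finally have fw: "f w = (\<Prod>b\<in>D. (z - box_content b)^2 / ((z - box_content b)^2 - 1))"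
      unfolding cauchy_product_def w_z(1) using w_z(2) by simp
    have "(z - box_content b)^2 / ((z - box_content b)^2 - 1) * ((1 - box_content b * w)^2 - w^2) = (1 - box_content b * w)^2"
      if b: "b \<in> D" for b
    proof -
      have "z - box_content b - 1 \<noteq> 0" "z - box_content b + 1 \<noteq> 0"
        using z[of "icontent b + 1"] z[of "icontent b - 1"] icontent_bound[OF D b]
        unfolding content_icontent by (auto simp: algebra_simps)
      moreover have "(z - box_content b)^2 - 1 = (z - box_content b - 1) * (z - box_content b + 1)"
        by (simp add: power2_eq_square algebra_simps)
      ultimately have ne: "(z - box_content b)^2 - 1 \<noteq> 0" by simp
      have e: "1 - box_content b * w = w * (z - box_content b)"
        using w_z by (simp add: field_simps)
      have "(1 - box_content b * w)^2 - w^2 = w^2 * ((z - box_content b)^2 - 1)"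
        unfolding e power_mult_distrib right_diff_distrib[of "w^2"] by simp
      then show ?thesis using ne unfolding e by (simp add: power_mult_distrib)
    qed
    then show ?thesis unfolding fw prod.distrib[symmetric] by (rule prod.cong[OF refl])
  qed
  moreover have "eventually (\<lambda>w. norm w < 1 / (real q + 1)) (nhds (0 :: complex))"
    unfolding eventually_nhds_metric by (intro exI[of _ "1 / (real q + 1)"]) simp
  ultimately have ev: "eventually (\<lambda>w. f w * ?den w = ?num w) (nhds 0)"
    by (auto elim: eventually_mono)
  have "?num has_fps_expansion (\<Prod>b\<in>D. content_factor (box_content b))"
    unfolding content_factor_def by (intro fps_expansion_intros)
  moreover have "(\<lambda>w. f w * ?den w) has_fps_expansion F * (\<Prod>b\<in>D. content_factor (box_content b) - fps_X^2)"
    unfolding content_factor_def by (intro fps_expansion_intros fF)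
  ultimately have "F * (\<Prod>b\<in>D. content_factor (box_content b) - fps_X^2) = (\<Prod>b\<in>D. content_factor (box_content b))"
    using fps_expansion_unique_complex has_fps_expansion_cong[OF ev refl] by blast
  then have "F = fps_const 1 * moment_fps D" by (intro moment_fps_eqI) simp
  then have "moment_fps D $ l = F $ l" by simp
  also have "F $ l = (\<Sum>k\<le>q. ?v k * ?a k ^ l)"
  proof -
    have "inverse (1 - fps_const c * fps_X) = Abs_fps (\<lambda>n. c ^ n)" for c :: complex
    proof (rule fps_inverse_unique)
      show "(1 - fps_const c * fps_X) * Abs_fps (\<lambda>n. c ^ n) = 1"
      proof (rule fps_ext)
        fix n show "((1 - fps_const c * fps_X) * Abs_fps (\<lambda>n. c ^ n)) $ n = 1 $ n"
          by (cases n) (simp_all add: left_diff_distrib mult.assoc)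
      qed
    qed
    then show ?thesis unfolding F_def by (simp add: fps_sum_nth)
  qed
  finally show ?thesis by (simp add: moment_eq[OF D])
qed

definition diagonal :: "diagram \<Rightarrow> int \<Rightarrow> nat" where
  "diagonal D k = card {b \<in> D. icontent b = k}"

text \<open>The boxes of a given content form an initial segment of their diagonal, on which the box
  (i, j) has position \<open>min i j\<close>. A diagram is thus determined by its diagonal
  lengths.\<close>

lemma mem_diagram_iff_diagonal:
  assumes D: "D \<in> young_diagrams q"
  shows "(i, j) \<in> D \<longleftrightarrow> 1 \<le> i \<and> 1 \<le> j \<and> min i j \<le> diagonal D (int j - int i)"
proof (cases "1 \<le> i \<and> 1 \<le> j")
  case True
  define k where "k = int j - int i"
  let ?e = "\<lambda>m. (m + nat (- k), m + nat k)"
  define J where "J = {m. 1 \<le> m \<and> ?e m \<in> D}"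
  have img: "?e ` J = {b \<in> D. icontent b = k}"
  proof (intro equalityI subsetI)
    fix b assume "b \<in> ?e ` J"
    then show "b \<in> {b \<in> D. icontent b = k}" unfolding J_def icontent_def by auto
  next
    fix b assume b: "b \<in> {b \<in> D. icontent b = k}"
    obtain i' j' where ij: "b = (i', j')" by (rule prod.exhaust)
    have "1 \<le> i'" "1 \<le> j'" using young_diagram_pos[OF D, of i' j'] b ij by auto
    then have "b = ?e (min i' j')" "1 \<le> min i' j'" using b ij unfolding icontent_def by auto
    then show "b \<in> ?e ` J" using b unfolding J_def by auto
  qed
  have inj: "inj_on ?e J" by (auto simp: inj_on_def)
  have card: "card J = diagonal D k"
    unfolding diagonal_def img[symmetric] by (rule card_image[OF inj, symmetric])
  have "finite (?e ` J)" unfolding img using young_diagram_finite[OF D] by simp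
  then have "finite J" using inj by (rule finite_imageD)
  then have "J = {1..card J}"
  proof (rule initial_segment)
    fix m m' assume m: "m \<in> J"
    then show "1 \<le> m \<and> (1 \<le> m' \<and> m' \<le> m \<longrightarrow> m' \<in> J)"
      using young_diagram_down[OF D, of "m + nat (- k)" "m + nat k" "m' + nat (- k)" "m' + nat k"]
      unfolding J_def by auto
  qed
  moreover have "(i, j) \<in> D \<longleftrightarrow> min i j \<in> J"
  proof -
    have "?e (min i j) = (i, j)" unfolding k_def by auto
    then show ?thesis using True unfolding J_def by auto
  qed
  ultimately have "(i, j) \<in> D \<longleftrightarrow> min i j \<in> {1..diagonal D k}" unfolding card by blast
  then show ?thesis using True unfolding k_def by simp
next
  case False
  then show ?thesis using young_diagram_pos[OF D, of i j] by blast
qed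

lemma order_prod:
  assumes "finite A" "\<And>i. i \<in> A \<Longrightarrow> p i \<noteq> 0"
  shows "Polynomial.order x (\<Prod>i\<in>A. p i) = (\<Sum>i\<in>A. Polynomial.order x (p i))"
  using assms by (induction A rule: finite_induct) (auto simp: order_mult)

text \<open>In w = 1/z a content k corresponds to the root 1/k of 1 - k w. Content 0 gives a
  constant and leaves no root, so nothing is learnt at k = 0.\<close>

lemma order_reciprocal_root:
  fixes k :: int
  assumes "k \<noteq> 0"
  shows "Polynomial.order (1 / of_int k :: complex) [:1, - of_int c:] = (if c = k then 1 else 0)"
proof (cases "c = k")
  case True
  let ?p = "[:1, - of_int k :: complex:]"
  have p: "?p \<noteq> 0" by simp
  have "poly ?p (1 / of_int k) = 0" using assms by simp
  then have "Polynomial.order (1 / of_int k) ?p \<noteq> 0" using p order_root by blast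
  moreover have "Polynomial.order (1 / of_int k) ?p \<le> degree ?p" by (rule order_degree[OF p])
  ultimately show ?thesis using True assms by simp
next
  case False
  then have "of_int c \<noteq> (of_int k :: complex)" by simp
  then have "poly [:1, - of_int c :: complex:] (1 / of_int k) \<noteq> 0" using assms by (simp add: field_simps)
  then have "Polynomial.order (1 / of_int k) [:1, - of_int c :: complex:] = 0" by (rule order_0I)
  then show ?thesis using False by simp
qed

lemma diagonal_zero:
  assumes D: "D \<in> young_diagrams q" and "int q \<le> \<bar>k\<bar>"
  shows "diagonal D k = 0"
proof -
  have "{b \<in> D. icontent b = k} = {}" using icontent_bound[OF D] assms(2) by force
  then show ?thesis unfolding diagonal_def by (simp only: card.empty)
qed

text \<open>The recursion carries the zeros beyond \<open>q\<close> inward to 0, and by reflection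
  also those below \<open>- q\<close>. Each side reaches 0 without using the recursion at 0.\<close>

lemma harmonic_finite_support_zero:
  fixes d :: "int \<Rightarrow> int"
  assumes rec: "\<And>k. k \<noteq> 0 \<Longrightarrow> 2 * d k = d (k - 1) + d (k + 1)"
    and supp: "\<And>k. int q \<le> \<bar>k\<bar> \<Longrightarrow> d k = 0"
  shows "d k = 0"
proof -
  have up: "d (int q - int m) = 0 \<and> d (int q - int m + 1) = 0"
    if "m \<le> q" "\<And>k. k \<noteq> 0 \<Longrightarrow> 2 * d k = d (k - 1) + d (k + 1)" "\<And>k. int q \<le> \<bar>k\<bar> \<Longrightarrow> d k = 0"
    for m and d :: "int \<Rightarrow> int"
    using that(1)
  proof (induction m)
    case 0
    then show ?case using that(3) by simp
  next
    case (Suc m)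
    then have IH: "d (int q - int m) = 0" "d (int q - int m + 1) = 0" by auto
    have "2 * d (int q - int m) = d (int q - int m - 1) + d (int q - int m + 1)"
      using Suc.prems by (intro that(2)) auto
    then have "d (int q - int m - 1) = 0" using IH by simp
    moreover have "int q - int (Suc m) = int q - int m - 1" by simp
    ultimately show ?case using IH by (simp only: diff_add_cancel)
  qed
  show ?thesis
  proof (cases "int q \<le> \<bar>k\<bar>")
    case False
    show ?thesis
    proof (cases "k \<ge> 0")
      case True
      then show ?thesis using up[of "nat (int q - k)" d, OF _ rec supp] False by auto
    next
      case k: False
      have "(\<lambda>k. d (- k)) (int q - int (nat (int q + k))) = 0"
        using up[of "nat (int q + k)" "\<lambda>k. d (- k)"] rec[of "- _"] supp[of "- _"] k False
        by (auto simp: algebra_simps)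
      then show ?thesis using k False by simp
    qed
  qed (rule supp)
qed

text \<open>After clearing denominators, the orders of vanishing at 1/k show that 2 d(k) - d(k-1) -
  d(k+1) is the same for both diagrams, where d denotes diagonal lengths and k is nonzero. The
  difference of the diagonal lengths then vanishes by
  \<open>harmonic_finite_support_zero\<close>.\<close>

lemma diagram_eqI_moment_fps:
  assumes D: "D \<in> young_diagrams q" and D': "D' \<in> young_diagrams q"
    and eq: "moment_fps D = moment_fps D'"
  shows "D = D'"
proof -
  let ?l = "\<lambda>c :: int. [:1, - of_int c :: complex:]"
  define N where "N D = (\<Prod>b\<in>D. ?l (icontent b) * ?l (icontent b))" for D
  define E where "E D = (\<Prod>b\<in>D. ?l (icontent b + 1) * ?l (icontent b - 1))" for D
  have lin: "fps_of_poly (?l c) = 1 - fps_const (of_int c) * fps_X" for c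
    by (simp add: fps_of_poly_pCons fps_of_poly_const fps_const_neg[symmetric] mult.commute del: fps_const_neg)
  have fN: "fps_of_poly (N D) = (\<Prod>b\<in>D. content_factor (box_content b))" for D
    unfolding N_def fps_of_poly_prod fps_of_poly_mult lin content_factor_def content_icontent power2_eq_square ..
  have fE: "fps_of_poly (E D) = (\<Prod>b\<in>D. content_factor (box_content b) - fps_X^2)" for D
    unfolding E_def fps_of_poly_prod fps_of_poly_mult lin content_factor_def content_icontent
    by (intro prod.cong refl)
      (simp add: power2_eq_square algebra_simps fps_const_add[symmetric] fps_const_sub[symmetric]
        del: fps_const_add fps_const_sub)
  have mf: "moment_fps D * fps_of_poly (E D) = fps_of_poly (N D)" for D
  proof -
    have "inverse (fps_of_poly (E D)) * fps_of_poly (E D) = 1"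
      unfolding fE by (rule inverse_mult_eq_1) (simp add: content_denominator_nth_0)
    then show ?thesis unfolding moment_fps_def fN[symmetric] fE[symmetric] by (simp add: mult.assoc)
  qed
  have "fps_of_poly (N D * E D') = fps_of_poly (N D' * E D)"
    unfolding fps_of_poly_mult mf[symmetric] eq by (simp add: mult_ac)
  then have NE: "N D * E D' = N D' * E D" by (simp add: fps_of_poly_eq_iff)
  have ordN: "Polynomial.order (1 / of_int k) (N D) = 2 * diagonal D k"
    and ordE: "Polynomial.order (1 / of_int k) (E D) = diagonal D (k - 1) + diagonal D (k + 1)"
    and nzN: "N D \<noteq> 0" and nzE: "E D \<noteq> 0"
    if "finite D" "k \<noteq> 0" for D and k :: int
  proof -
    have cnt: "(\<Sum>b\<in>D. if icontent b = m then 1 else 0) = diagonal D m" for m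
      unfolding diagonal_def using \<open>finite D\<close> by (simp only: card_eq_sum sum.inter_filter)
    have nz: "?l c \<noteq> 0" for c by simp
    then have nz2: "?l c * ?l c' \<noteq> 0" for c c' by (simp only: mult_eq_0_iff nz) simp
    have "Polynomial.order (1 / of_int k) (?l (icontent b) * ?l (icontent b)) = 2 * (if icontent b = k then 1 else 0)" for b
      unfolding order_mult[OF nz2] order_reciprocal_root[OF \<open>k \<noteq> 0\<close>] by simp
    then have "Polynomial.order (1 / of_int k) (N D) = (\<Sum>b\<in>D. 2 * (if icontent b = k then 1 else 0))"
      unfolding N_def using nz \<open>finite D\<close> by (subst order_prod) auto
    then show "Polynomial.order (1 / of_int k) (N D) = 2 * diagonal D k"
      unfolding sum_distrib_left[symmetric] cnt .
    have "Polynomial.order (1 / of_int k) (?l (icontent b + 1) * ?l (icontent b - 1)) =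
        (if icontent b = k - 1 then 1 else 0) + (if icontent b = k + 1 then 1 else 0)" for b
      unfolding order_mult[OF nz2] order_reciprocal_root[OF \<open>k \<noteq> 0\<close>] by auto
    then have "Polynomial.order (1 / of_int k) (E D) =
        (\<Sum>b\<in>D. (if icontent b = k - 1 then 1 else 0) + (if icontent b = k + 1 then 1 else 0))"
      unfolding E_def using nz \<open>finite D\<close> by (subst order_prod) auto
    then show "Polynomial.order (1 / of_int k) (E D) = diagonal D (k - 1) + diagonal D (k + 1)"
      unfolding sum.distrib cnt .
    show "N D \<noteq> 0" "E D \<noteq> 0" unfolding N_def E_def using \<open>finite D\<close> by auto
  qed
  note fin = young_diagram_finite[OF D] young_diagram_finite[OF D']
  have prod_order: "Polynomial.order (1 / of_int k) (N A * E B) =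
      2 * diagonal A k + (diagonal B (k - 1) + diagonal B (k + 1))"
    if "finite A" "finite B" "k \<noteq> 0" for A B and k :: int
  proof -
    have "N A * E B \<noteq> 0" using nzN[OF that(1,3)] nzE[OF that(2,3)] by simp
    then have "Polynomial.order (1 / of_int k) (N A * E B) =
        Polynomial.order (1 / of_int k) (N A) + Polynomial.order (1 / of_int k) (E B)"
      by (rule order_mult)
    then show ?thesis by (simp only: ordN[OF that(1,3)] ordE[OF that(2,3)])
  qed
  have rec: "2 * (int (diagonal D k) - int (diagonal D' k)) =
      (int (diagonal D (k - 1)) - int (diagonal D' (k - 1))) +
      (int (diagonal D (k + 1)) - int (diagonal D' (k + 1)))" if "k \<noteq> 0" for k
  proof -
    have "2 * diagonal D k + (diagonal D' (k - 1) + diagonal D' (k + 1)) =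
        2 * diagonal D' k + (diagonal D (k - 1) + diagonal D (k + 1))"
      using arg_cong[OF NE, of "Polynomial.order (1 / of_int k)"]
      unfolding prod_order[OF fin that] prod_order[OF fin(2,1) that] .
    from arg_cong[OF this, of int] show ?thesis by simp
  qed
  have "int (diagonal D k) - int (diagonal D' k) = 0" for k
    by (rule harmonic_finite_support_zero[of "\<lambda>k. int (diagonal D k) - int (diagonal D' k)" q, OF rec])
      (simp_all add: diagonal_zero[OF D] diagonal_zero[OF D'])
  then have "diagonal D = diagonal D'" by (intro ext) simp
  then have "(i, j) \<in> D \<longleftrightarrow> (i, j) \<in> D'" for i j
    unfolding mem_diagram_iff_diagonal[OF D] mem_diagram_iff_diagonal[OF D'] by simp
  then show ?thesis by auto
qed

section \<open>Expansion into normalized characters\<close>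

lemma acts_by_one: "acts_by D 1 1"
  using acts_by_const[of D 1] by simp

text \<open>One factor (A_l - m_l(D1)) / (m_l(D) - m_l(D1)) is multiplied on for each other diagram
  \<open>D1\<close>, with an \<open>l\<close> that may depend on \<open>D1\<close>. The coefficients
  are real and the factors commute, so the product stays central and hermitian.\<close>

lemma separating_element:
  assumes D: "D \<in> young_diagrams q"
  obtains e where "e \<in> center q" "hermitian e"
    "\<And>D'. D' \<in> young_diagrams q \<Longrightarrow> acts_by D' e (if D' = D then 1 else 0)"
proof -
  have "\<exists>e a. e \<in> center q \<and> hermitian e \<and> (\<forall>D'\<in>young_diagrams q. acts_by D' e (a D')) \<and> a D = 1 \<and>
      (\<forall>D'\<in>T. a D' = 0)" if "finite T" "T \<subseteq> young_diagrams q - {D}" for T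
    using that
  proof (induction T rule: finite_induct)
    case empty
    have "acts_by D' (Poly_Mapping.single 0 (of_real 1)) 1" for D' by (simp add: acts_by_one)
    then show ?case using center_const[of "of_real 1" q] hermitian_real[of 1]
      by (intro exI[of _ "Poly_Mapping.single 0 (of_real 1)"] exI[of _ "\<lambda>_. 1"]) auto
  next
    case (insert D1 T)
    then obtain e a where e: "e \<in> center q" "hermitian e"
      and a: "\<And>D'. D' \<in> young_diagrams q \<Longrightarrow> acts_by D' e (a D')" "a D = 1" "\<And>D'. D' \<in> T \<Longrightarrow> a D' = 0"
      by blast
    have D1: "D1 \<in> young_diagrams q" "D1 \<noteq> D" using insert.prems by auto
    obtain l where l: "moment l D \<noteq> moment l D1"
    proof -
      have "moment_fps D \<noteq> moment_fps D1" using diagram_eqI_moment_fps[OF D D1(1)] D1(2) by blast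
      then show thesis
        using that moment_fps_nth[OF D] moment_fps_nth[OF D1(1)] by (auto simp: fps_eq_iff)
    qed
    define r where "r = 1 / (moment l D - moment l D1)"
    define t where "t = Poly_Mapping.single 0 (complex_of_real r) *
      (moment_element q l + Poly_Mapping.single 0 (complex_of_real (- moment l D1)))"
    have s: "moment_element q l + Poly_Mapping.single 0 (complex_of_real (- moment l D1)) \<in> center q"
      by (intro center_add moment_element_center center_const)
    then have t: "t \<in> center q" unfolding t_def by (intro center_mult center_const)
    have th: "hermitian t"
      unfolding t_def
    proof (rule hermitian_mult[OF hermitian_real])
      show "hermitian (moment_element q l + Poly_Mapping.single 0 (complex_of_real (- moment l D1)))"
        by (intro hermitian_add hermitian_moment_element hermitian_real)
    qed (rule center_commute[OF s center_alg[OF center_const]])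
    have ta: "acts_by D' t (of_real (r * (moment l D' - moment l D1)))" if "D' \<in> young_diagrams q" for D'
    proof -
      have "acts_by D' t (of_real r * (moment_fps D' $ l + of_real (- moment l D1)))"
        unfolding t_def by (intro acts_by_mult acts_by_add acts_by_const acts_by_moment_element[OF that])
      then show ?thesis by (simp add: moment_fps_nth[OF that])
    qed
    let ?a = "\<lambda>D'. a D' * of_real (r * (moment l D' - moment l D1))"
    have "e * t \<in> center q" using e t by (intro center_mult)
    moreover have "hermitian (e * t)"
      by (rule hermitian_mult[OF e(2) th center_commute[OF t center_alg[OF e(1)]]])
    moreover have "\<forall>D'\<in>young_diagrams q. acts_by D' (e * t) (?a D')"
      using a(1) ta by (intro ballI acts_by_mult)
    moreover have "?a D = 1" using a(2) l unfolding r_def by simp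
    moreover have "\<forall>D'\<in>insert D1 T. ?a D' = 0" using a(3) by auto
    ultimately show ?case by (intro exI[of _ "e * t"] exI[of _ ?a] conjI)
  qed
  from this[of "young_diagrams q - {D}"] obtain e a where e: "e \<in> center q" "hermitian e"
    "\<forall>D'\<in>young_diagrams q. acts_by D' e (a D')" "a D = 1" "\<forall>D'\<in>young_diagrams q - {D}. a D' = 0"
    using finite_young_diagrams[of q] by auto
  have "acts_by D' e (if D' = D then 1 else 0)" if "D' \<in> young_diagrams q" for D'
  proof -
    have "a D' = (if D' = D then 1 else 0)" using e(4,5) that by auto
    then show ?thesis using e(3) that by metis
  qed
  then show thesis using that e(1,2) by blast
qed

lemma lin_expansion:
  assumes exp: "\<And>\<sigma>. \<sigma> \<in> sym_group q \<Longrightarrow> \<psi> \<sigma> = (\<Sum>D\<in>young_diagrams q. p D * norm_character D \<sigma>)"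
    and x: "x \<in> alg q" and a: "\<And>D. D \<in> young_diagrams q \<Longrightarrow> acts_by D x (a D)"
  shows "lin (\<lambda>g. \<psi> (app g)) x = (\<Sum>D\<in>young_diagrams q. p D * a D)"
proof -
  have "lin (\<lambda>g. \<psi> (app g)) x = lin (\<lambda>g. \<Sum>D\<in>young_diagrams q. p D * norm_character D (app g)) x"
    using alg_keys[OF x] unfolding Sym_def by (intro lin_cong exp) auto
  also have "\<dots> = (\<Sum>D\<in>young_diagrams q. p D * a D)"
    unfolding lin_fun_sum lin_scale
    using norm_character_acts_by[OF _ x a] by (intro sum.cong) auto
  finally show ?thesis .
qed

text \<open>Cut off outside S_q, so that linear relations between functions on all of
  \<open>nat \<Rightarrow> nat\<close> are relations on S_q.\<close>

definition character_fun :: "nat \<Rightarrow> diagram \<Rightarrow> (nat \<Rightarrow> nat) \<Rightarrow> complex" where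
  "character_fun q D \<sigma> = (if \<sigma> \<in> sym_group q then norm_character D \<sigma> else 0)"

lemma character_fun_lin_indep:
  assumes "(\<Sum>D\<in>young_diagrams q. fun_scale (p D) (character_fun q D)) = 0" and D: "D \<in> young_diagrams q"
  shows "p D = 0"
proof -
  obtain e where e: "e \<in> center q"
    "\<And>D'. D' \<in> young_diagrams q \<Longrightarrow> acts_by D' e (if D' = D then 1 else 0)"
    using separating_element[OF D] by metis
  have "(0 :: complex) = (\<Sum>D\<in>young_diagrams q. p D * norm_character D \<sigma>)" if "\<sigma> \<in> sym_group q" for \<sigma>
    using fun_cong[OF assms(1), of \<sigma>] that by (simp add: sum_fun_app fun_scale_def character_fun_def)
  from lin_expansion[of q "\<lambda>_. 0", OF this center_alg[OF e(1)] e(2)]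
  have "(\<Sum>D'\<in>young_diagrams q. p D' * (if D' = D then 1 else 0)) = 0" by (simp add: lin_def)
  then show ?thesis using D finite_young_diagrams[of q] by (simp add: if_distrib cong: if_cong)
qed

lemma character_fun_inj: "inj_on (character_fun q) (young_diagrams q)"
proof (rule inj_onI, rule ccontr)
  fix D D' assume D: "D \<in> young_diagrams q" "D' \<in> young_diagrams q" "D \<noteq> D'"
    and eq: "character_fun q D = character_fun q D'"
  define p where "p = (\<lambda>E. if E = D then 1 else if E = D' then -1 else 0 :: complex)"
  have "(\<Sum>E\<in>young_diagrams q. fun_scale (p E) (character_fun q E)) =
      (\<Sum>E\<in>{D, D'}. fun_scale (p E) (character_fun q E))"
    using D finite_young_diagrams[of q]
    by (intro sum.mono_neutral_right) (auto simp: p_def)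
  also have "\<dots> = 0" using D(3) by (auto simp: p_def eq fun_scale_def fun_eq_iff)
  finally have "p D = 0" using character_fun_lin_indep D(1) by blast
  then show False by (simp add: p_def)
qed

lemma character_fun_independent: "cfun.independent (character_fun q ` young_diagrams q)"
proof (rule cfun.independent_if_scalars_zero)
  show "finite (character_fun q ` young_diagrams q)" using finite_young_diagrams by simp
  fix f x assume f: "(\<Sum>x\<in>character_fun q ` young_diagrams q. fun_scale (f x) x) = 0"
    and "x \<in> character_fun q ` young_diagrams q"
  then obtain D where D: "D \<in> young_diagrams q" "x = character_fun q D" by blast
  have "(\<Sum>D\<in>young_diagrams q. fun_scale (f (character_fun q D)) (character_fun q D)) = 0"
    using f unfolding sum.reindex[OF character_fun_inj] comp_def .
  then show "f x = 0" using character_fun_lin_indep[of "\<lambda>D. f (character_fun q D)" q D] D by simp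
qed

definition class_indicator :: "nat \<Rightarrow> diagram \<Rightarrow> (nat \<Rightarrow> nat) \<Rightarrow> complex" where
  "class_indicator q D \<sigma> = (if \<sigma> \<in> sym_group q \<and> cycle_diagram q \<sigma> = D then 1 else 0)"

lemma central_in_span_class_indicators:
  assumes c: "central q f" and out: "\<And>\<sigma>. \<sigma> \<notin> sym_group q \<Longrightarrow> f \<sigma> = 0"
  shows "f \<in> cfun.span (class_indicator q ` young_diagrams q)"
proof -
  define v where "v D = f (SOME \<sigma>. \<sigma> \<in> sym_group q \<and> cycle_diagram q \<sigma> = D)" for D
  have v: "v (cycle_diagram q \<sigma>) = f \<sigma>" if s: "\<sigma> \<in> sym_group q" for \<sigma>
  proof -
    let ?\<tau> = "SOME \<tau>. \<tau> \<in> sym_group q \<and> cycle_diagram q \<tau> = cycle_diagram q \<sigma>"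
    have t: "?\<tau> \<in> sym_group q \<and> cycle_diagram q ?\<tau> = cycle_diagram q \<sigma>"
      by (rule someI[of _ \<sigma>]) (use s in simp)
    then obtain \<rho> where "\<rho> \<in> sym_group q" "\<rho> \<circ> \<sigma> \<circ> inv \<rho> = ?\<tau>"
      using conjugate_of_cycle_diagram_eq[OF s, of ?\<tau>] by auto
    then show ?thesis unfolding v_def using c s unfolding central_def by metis
  qed
  have "f = (\<Sum>D\<in>young_diagrams q. fun_scale (v D) (class_indicator q D))"
  proof
    fix \<sigma>
    show "f \<sigma> = (\<Sum>D\<in>young_diagrams q. fun_scale (v D) (class_indicator q D)) \<sigma>"
    proof (cases "\<sigma> \<in> sym_group q")
      case True
      have "(\<Sum>D\<in>young_diagrams q. fun_scale (v D) (class_indicator q D)) \<sigma> =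
          (\<Sum>D\<in>young_diagrams q. if D = cycle_diagram q \<sigma> then v D else 0)"
        unfolding sum_fun_app using True
        by (intro sum.cong) (auto simp: fun_scale_def class_indicator_def)
      then show ?thesis
        using v[OF True] cycle_diagram_in_young_diagrams[OF True] finite_young_diagrams[of q] by simp
    next
      case False
      then show ?thesis using out unfolding sum_fun_app by (simp add: fun_scale_def class_indicator_def)
    qed
  qed
  also have "\<dots> \<in> cfun.span (class_indicator q ` young_diagrams q)"
    by (intro cfun.span_sum cfun.span_scale cfun.span_base) auto
  finally show ?thesis .
qed

text \<open>
  The normalized characters are independent class functions, and there are at least as many of them
  as conjugacy classes, so they span.
\<close>

lemma central_expansion:
  assumes c: "central q \<psi>"
  obtains p where "\<And>\<sigma>. \<sigma> \<in> sym_group q \<Longrightarrow> \<psi> \<sigma> = (\<Sum>D\<in>young_diagrams q. p D * norm_character D \<sigma>)"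
proof -
  let ?Y = "young_diagrams q" and ?X = "character_fun q ` young_diagrams q"
  let ?T = "class_indicator q ` young_diagrams q"
  define f where "f \<sigma> = (if \<sigma> \<in> sym_group q then \<psi> \<sigma> else 0)" for \<sigma>
  have conj: "\<tau> \<circ> \<sigma> \<circ> inv \<tau> \<in> sym_group q" if "\<sigma> \<in> sym_group q" "\<tau> \<in> sym_group q" for \<sigma> \<tau>
    using that by (intro sym_group_comp sym_group_inv)
  have fT: "f \<in> cfun.span ?T"
    by (rule central_in_span_class_indicators) (use c conj in \<open>auto simp: central_def f_def\<close>)
  have XT: "?X \<subseteq> cfun.span ?T"
  proof
    fix x assume "x \<in> ?X"
    then obtain D where D: "D \<in> ?Y" "x = character_fun q D" by blast
    show "x \<in> cfun.span ?T" unfolding D(2)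
      by (rule central_in_span_class_indicators)
        (use conj norm_character_central[OF D(1)] in \<open>auto simp: central_def character_fun_def\<close>)
  qed
  have finT: "finite ?T" and finX: "finite ?X" using finite_young_diagrams by auto
  have cardX: "card ?X = card ?Y" by (rule card_image[OF character_fun_inj])
  have "f \<in> cfun.span ?X"
  proof (rule ccontr)
    assume f: "f \<notin> cfun.span ?X"
    then have "cfun.independent (insert f ?X)"
      by (rule cfun.independent_insertI[OF _ character_fun_independent])
    moreover have "insert f ?X \<subseteq> cfun.span ?T" using fT XT by simp
    ultimately have "card (insert f ?X) \<le> card ?T" by (rule conjunct2[OF cfun.independent_span_bound[OF finT]])
    moreover have "f \<notin> ?X" using f by (rule contrapos_nn) (rule cfun.span_base)
    ultimately have "Suc (card ?Y) \<le> card ?T" using finX cardX by simp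
    moreover have "card ?T \<le> card ?Y" using finite_young_diagrams by (rule card_image_le)
    ultimately show False by simp
  qed
  then obtain u where "f = (\<Sum>x\<in>?X. fun_scale (u x) x)"
    unfolding cfun.span_finite[OF finX] by blast
  then have u: "f = (\<Sum>D\<in>?Y. fun_scale (u (character_fun q D)) (character_fun q D))"
    unfolding sum.reindex[OF character_fun_inj] comp_def .
  show thesis
  proof (rule that[of "\<lambda>D. u (character_fun q D)"])
    fix \<sigma> assume s: "\<sigma> \<in> sym_group q"
    have "\<psi> \<sigma> = f \<sigma>" using s by (simp add: f_def)
    also have "\<dots> = (\<Sum>D\<in>?Y. u (character_fun q D) * norm_character D \<sigma>)"
      by (subst u) (simp add: sum_fun_app fun_scale_def, simp add: character_fun_def s)
    finally show "\<psi> \<sigma> = (\<Sum>D\<in>?Y. u (character_fun q D) * norm_character D \<sigma>)" .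
  qed
qed

text \<open>The coefficients of \<open>x\<close> serve as the test vector; hermiticity and the
  substitution of inverses turn the conjugated coefficients into plain ones.\<close>

lemma positive_definite_hermitian_square:
  assumes pd: "positive_definite q \<psi>" and x: "x \<in> alg q" and h: "hermitian x"
  shows "lin (\<lambda>g. \<psi> (app g)) (x * x) \<in> \<real>\<^sub>\<ge>\<^sub>0"
proof -
  let ?c = "Poly_Mapping.lookup x"
  let ?z = "\<lambda>\<sigma>. ?c (inv_into UNIV app \<sigma>)"
  have inv: "inv_into UNIV app (app g) = g" for g by (rule inv_into_f_f[OF inj_on_app]) simp
  have sum: "(\<Sum>\<sigma>\<in>sym_group q. F \<sigma>) = (\<Sum>g\<in>Sym q. F (app g))" for F :: "_ \<Rightarrow> complex"
    unfolding app_Sym[symmetric] by (simp add: sum.reindex[OF inj_on_app])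
  have sub: "Poly_Mapping.keys x \<subseteq> Sym q" by (rule alg_keys[OF x])
  have bij: "bij_betw uminus (Sym q) (Sym q)"
    by (rule bij_betw_byWitness[where f' = uminus]) (auto simp: Sym_uminus_iff)
  have "(\<Sum>\<sigma>\<in>sym_group q. \<Sum>\<tau>\<in>sym_group q. ?z \<sigma> * cnj (?z \<tau>) * \<psi> (inv \<tau> \<circ> \<sigma>)) =
      (\<Sum>g\<in>Sym q. \<Sum>k\<in>Sym q. ?c g * cnj (?c k) * \<psi> (app (- k + g)))"
    unfolding sum inv app_plus app_uminus ..
  also have "\<dots> = (\<Sum>g\<in>Sym q. \<Sum>k\<in>Sym q. ?c g * ?c (- k) * \<psi> (app (- k + g)))"
    using h unfolding hermitian_def by simp
  also have "\<dots> = (\<Sum>g\<in>Sym q. \<Sum>k\<in>Sym q. ?c g * ?c k * \<psi> (app (k + g)))"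
    by (intro sum.cong refl sum.reindex_bij_betw[OF bij])
  also have "\<dots> = (\<Sum>k\<in>Sym q. \<Sum>g\<in>Sym q. ?c g * ?c k * \<psi> (app (k + g)))" by (rule sum.swap)
  also have "\<dots> = lin (\<lambda>g. \<psi> (app g)) (x * x)"
    unfolding lin_mult lin_superset[OF finite_Sym sub]
    by (intro sum.cong refl) (simp add: sum_distrib_left mult_ac)
  finally have eq: "(\<Sum>\<sigma>\<in>sym_group q. \<Sum>\<tau>\<in>sym_group q. ?z \<sigma> * cnj (?z \<tau>) * \<psi> (inv \<tau> \<circ> \<sigma>)) =
      lin (\<lambda>g. \<psi> (app g)) (x * x)" .
  show ?thesis
    using pd[unfolded positive_definite_def, THEN spec, of ?z] unfolding eq .
qed

text \<open>A separating element e for \<open>D\<close> gives p(D) = psi(e) in every expansion,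
  hence uniqueness. Since e * e acts by the same scalars 0 and 1, also p(D) = psi(e * e), which is
  nonnegative.\<close>

lemma weights_characterization:
  assumes c: "central q \<psi>" and pd: "positive_definite q \<psi>" and one: "\<psi> id = 1"
  shows weights_nonneg: "0 \<le> weights q \<psi> D"
    and weights_sum: "(\<Sum>D\<in>young_diagrams q. weights q \<psi> D) = 1"
    and weights_expansion: "\<And>\<sigma>. \<sigma> \<in> sym_group q \<Longrightarrow>
      \<psi> \<sigma> = (\<Sum>D\<in>young_diagrams q. complex_of_real (weights q \<psi> D) * norm_character D \<sigma>)"
proof -
  let ?Y = "young_diagrams q"
  let ?P = "\<lambda>p. (\<forall>D. 0 \<le> p D) \<and> (\<forall>D. D \<notin> ?Y \<longrightarrow> p D = 0) \<and> (\<Sum>D \<in> ?Y. p D) = 1 \<and>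
     (\<forall>\<sigma> \<in> sym_group q. \<psi> \<sigma> = (\<Sum>D \<in> ?Y. complex_of_real (p D) * norm_character D \<sigma>))"
  obtain p where p: "\<And>\<sigma>. \<sigma> \<in> sym_group q \<Longrightarrow> \<psi> \<sigma> = (\<Sum>D\<in>?Y. p D * norm_character D \<sigma>)"
    by (rule central_expansion[OF c]) blast
  have coeff: "p D = lin (\<lambda>g. \<psi> (app g)) x"
    if "\<And>\<sigma>. \<sigma> \<in> sym_group q \<Longrightarrow> \<psi> \<sigma> = (\<Sum>D\<in>?Y. p D * norm_character D \<sigma>)"
      and x: "x \<in> alg q" "\<And>D'. D' \<in> ?Y \<Longrightarrow> acts_by D' x (if D' = D then 1 else 0)" and D: "D \<in> ?Y" for p x D
  proof -
    have "lin (\<lambda>g. \<psi> (app g)) x = (\<Sum>D'\<in>?Y. p D' * (if D' = D then 1 else 0))"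
      by (rule lin_expansion[OF that(1) x])
    then show ?thesis using D finite_young_diagrams[of q] by (simp add: if_distrib cong: if_cong)
  qed
  have nonneg: "p D \<in> \<real>\<^sub>\<ge>\<^sub>0" if D: "D \<in> ?Y" for D
  proof -
    obtain e where e: "e \<in> center q" "hermitian e"
      "\<And>D'. D' \<in> ?Y \<Longrightarrow> acts_by D' e (if D' = D then 1 else 0)"
      by (rule separating_element[OF D]) blast
    have "acts_by D' (e * e) (if D' = D then 1 else 0)" if "D' \<in> ?Y" for D'
      using acts_by_mult[OF e(3)[OF that] e(3)[OF that]] by (simp split: if_splits)
    then have "p D = lin (\<lambda>g. \<psi> (app g)) (e * e)"
      by (intro coeff[OF p alg_mult[OF center_alg[OF e(1)] center_alg[OF e(1)]] _ D])
    then show ?thesis using positive_definite_hermitian_square[OF pd center_alg[OF e(1)] e(2)] by simp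
  qed
  define p' where "p' D = (if D \<in> ?Y then Re (p D) else 0)" for D
  have p': "complex_of_real (p' D) = p D" if "D \<in> ?Y" for D
    using nonneg[OF that] that unfolding p'_def nonneg_Reals_def by auto
  have exp': "\<psi> \<sigma> = (\<Sum>D\<in>?Y. complex_of_real (p' D) * norm_character D \<sigma>)" if "\<sigma> \<in> sym_group q" for \<sigma>
    using p[OF that] p' by simp
  have "(\<Sum>D\<in>?Y. complex_of_real (p' D)) = \<psi> id"
    using exp'[OF id_in_sym_group] norm_character_id by simp
  then have "(\<Sum>D\<in>?Y. p' D) = 1" using one by (metis of_real_eq_1_iff of_real_sum)
  moreover have "0 \<le> p' D" for D
    using nonneg[of D] unfolding p'_def by (auto simp: nonneg_Reals_def)
  ultimately have P: "?P p'" using exp' unfolding p'_def by auto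
  have "weights q \<psi> = p'"
    unfolding weights_def
  proof (rule the_equality)
    show "?P p'" by (rule P)
    fix r assume r: "?P r"
    show "r = p'"
    proof
      fix D show "r D = p' D"
      proof (cases "D \<in> ?Y")
        case True
        obtain e where e: "e \<in> center q"
          "\<And>D'. D' \<in> ?Y \<Longrightarrow> acts_by D' e (if D' = D then 1 else 0)"
          using separating_element[OF True] by metis
        have rexp: "\<psi> \<sigma> = (\<Sum>D\<in>?Y. complex_of_real (r D) * norm_character D \<sigma>)" if "\<sigma> \<in> sym_group q" for \<sigma>
          using r that by blast
        have "complex_of_real (r D) = complex_of_real (p' D)"
          using coeff[of "\<lambda>D. complex_of_real (r D)", OF rexp center_alg[OF e(1)] e(2) True]
            coeff[of "\<lambda>D. complex_of_real (p' D)", OF exp' center_alg[OF e(1)] e(2) True] by simp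
        then show ?thesis by simp
      next
        case False
        then show ?thesis using r P by simp
      qed
    qed
  qed
  then show "0 \<le> weights q \<psi> D" "(\<Sum>D\<in>?Y. weights q \<psi> D) = 1"
    "\<And>\<sigma>. \<sigma> \<in> sym_group q \<Longrightarrow> \<psi> \<sigma> = (\<Sum>D\<in>?Y. complex_of_real (weights q \<psi> D) * norm_character D \<sigma>)"
    using P by auto
qed

section \<open>Concentration of the moments\<close>

definition words :: "nat \<Rightarrow> nat \<Rightarrow> nat list set" where
  "words q l = {xs. set xs \<subseteq> {1..q} \<and> length xs = l}"

lemma words_finite: "finite (words q l)"
  unfolding words_def by (rule finite_words)

lemma words_0: "words q 0 = {[]}"
  by (auto simp: words_def)

definition star_fperm :: "nat \<Rightarrow> nat list \<Rightarrow> fperm" where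
  "star_fperm s xs = foldr (\<lambda>x g. swap x s + g) xs 0"

lemma app_star_fperm: "app (star_fperm s xs) = star_word s xs"
  unfolding star_fperm_def star_word_def
  by (induction xs) (simp_all add: app_zero app_plus app_swap)

lemma jm_power: "jm (Suc q) ^ l = (\<Sum>xs\<in>words q l. gel (star_fperm (Suc q) xs))"
proof (induction l)
  case 0
  show ?case by (simp add: words_0 star_fperm_def)
next
  case (Suc l)
  have "jm (Suc q) = (\<Sum>x\<in>{1..q}. gel (swap x (Suc q)))"
    unfolding jm_def atLeastLessThanSuc_atLeastAtMost ..
  then have "jm (Suc q) ^ Suc l = (\<Sum>x\<in>{1..q}. gel (swap x (Suc q))) * (\<Sum>xs\<in>words q l. gel (star_fperm (Suc q) xs))"
    unfolding power_Suc Suc[symmetric] by (rule arg_cong[of _ _ "\<lambda>x. x * jm (Suc q) ^ l"])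
  also have "\<dots> = (\<Sum>x\<in>{1..q}. \<Sum>xs\<in>words q l. gel (star_fperm (Suc q) (x # xs)))"
    by (simp add: sum_product mult_single star_fperm_def)
  also have "\<dots> = (\<Sum>xs\<in>words q l. \<Sum>x\<in>{1..q}. gel (star_fperm (Suc q) (x # xs)))" by (rule sum.swap)
  also have "\<dots> = (\<Sum>xs\<in>words q (Suc l). gel (star_fperm (Suc q) xs))"
    unfolding words_def by (rule sum_words_Suc[symmetric])
  finally show ?case .
qed

text \<open>The words that survive E: their product fixes the star point.\<close>

definition good_words :: "nat \<Rightarrow> nat \<Rightarrow> nat list set" where
  "good_words q l = {xs \<in> words q l. star_word (Suc q) xs \<in> sym_group q}"

lemma lin_moment_element:
  "lin \<phi> (moment_element q l) = (\<Sum>xs\<in>good_words q l. \<phi> (star_fperm (Suc q) xs))"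
proof -
  have "lin \<phi> (moment_element q l) =
      (\<Sum>xs\<in>words q l. if star_fperm (Suc q) xs \<in> Sym q then \<phi> (star_fperm (Suc q) xs) else 0)"
    unfolding moment_element_def lin_restr lin_on_def jm_power lin_sum by simp
  also have "\<dots> = (\<Sum>xs\<in>good_words q l. \<phi> (star_fperm (Suc q) xs))"
    unfolding good_words_def
    by (subst sum.inter_filter[OF words_finite]) (simp add: Sym_def app_star_fperm)
  finally show ?thesis .
qed

lemma lin_moment_element_word:
  "lin (\<lambda>g. \<psi> (app g)) (moment_element q l) = (\<Sum>xs\<in>good_words q l. \<psi> (star_word (Suc q) xs))"
  by (simp add: lin_moment_element app_star_fperm)

lemma lin_moment_element_square:
  "lin (\<lambda>g. \<psi> (app g)) (moment_element q l * moment_element q l) =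
    (\<Sum>xs\<in>good_words q l. \<Sum>ys\<in>good_words q l. \<psi> (star_word (Suc q) xs \<circ> star_word (Suc q) ys))"
  by (simp add: lin_mult lin_moment_element app_star_fperm app_plus)

lemma perm_length_0:
  assumes p: "p \<in> sym_group q" and "perm_length q p = 0"
  shows "p = id"
proof -
  have "card (orbit p ` {1..q}) = card {1..q}"
    using assms(2) num_cycles_le[of q p] unfolding perm_length_def num_cycles_def by simp
  then have inj: "inj_on (orbit p) {1..q}" by (intro eq_card_imp_inj_on) auto
  have perm: "p permutes {1..q}" using p unfolding sym_group_def by simp
  have "p x = x" for x
  proof (cases "x \<in> {1..q}")
    case True
    have "orbit p (p x) = orbit p x" by (rule permutation_orbit_step[OF sym_group_permutation[OF p]])
    moreover have "p x \<in> {1..q}" using permutes_in_image[OF perm, of x] True by blast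
    ultimately show ?thesis using inj_onD[OF inj] True by blast
  next
    case False
    then show ?thesis using permutes_not_in[OF perm] by blast
  qed
  then show ?thesis by auto
qed

lemma good_word_facts:
  assumes "xs \<in> good_words q l"
  shows "set xs \<subseteq> {1..q}" "length xs = l" "star_word (Suc q) xs \<in> sym_group q"
    and "perm_support (star_word (Suc q) xs) \<subseteq> set xs"
    and "star_word (q + 2) xs = star_word (q + 1) xs"
proof -
  show xs: "set xs \<subseteq> {1..q}" "length xs = l" "star_word (Suc q) xs \<in> sym_group q"
    using assms unfolding good_words_def words_def by auto
  have fix_: "star_word (Suc q) xs (Suc q) = Suc q"
    using xs(3) unfolding sym_group_def by (simp add: permutes_def)
  show "perm_support (star_word (Suc q) xs) \<subseteq> set xs"
  proof
    fix x assume "x \<in> perm_support (star_word (Suc q) xs)"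
    then have x: "star_word (Suc q) xs x \<noteq> x" unfolding perm_support_def by simp
    then have "x \<noteq> Suc q" using fix_ by metis
    then show "x \<in> set xs" using star_word_outside[of x xs "Suc q"] x by blast
  qed
  have "star_word (q + 2) xs = star_word (Suc q) xs"
    by (rule star_word_change_star[OF fix_]) (use xs(1) in auto)
  then show "star_word (q + 2) xs = star_word (q + 1) xs" by simp
qed

text \<open>The product of a good word fixes its star point, so the second word may use q + 2
  instead of q + 1 and \<open>star_words_genus\<close> applies. The bound for a single word is the
  case of an empty second word.\<close>

lemma good_words_length_bounds:
  assumes xs: "xs \<in> good_words q l" and ys: "ys \<in> good_words q l"
  defines "L \<equiv> perm_length q (star_word (Suc q) xs \<circ> star_word (Suc q) ys)"
  shows "2 * (card (set xs \<union> set ys) + (if set xs \<inter> set ys = {} then 0 else 1)) \<le> 2 * l + L"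
    and "L \<le> 2 * l"
    and "2 * card (set xs) \<le> l + perm_length q (star_word (Suc q) xs)"
    and "perm_length q (star_word (Suc q) xs) \<le> l"
proof -
  note x = good_word_facts[OF xs] and y = good_word_facts[OF ys]
  have up: "perm_length (q + 2) p = perm_length q p" "perm_length (Suc q) p = perm_length q p"
    if "p \<in> sym_group q" for p
  proof -
    have p: "p permutes {1..q}" "p permutes {1..Suc q}"
      using that permutes_subset[of p "{1..q}" "{1..Suc q}"] unfolding sym_group_def by auto
    show "perm_length (Suc q) p = perm_length q p" by (rule perm_length_Suc[OF p(1)])
    then show "perm_length (q + 2) p = perm_length q p" using perm_length_Suc[OF p(2)] by simp
  qed
  have comp: "star_word (Suc q) xs \<circ> star_word (Suc q) ys \<in> sym_group q"
    by (rule sym_group_comp[OF x(3) y(3)])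
  have "2 * (card (set xs \<union> set ys) + (if set xs \<inter> set ys = {} then 0 else 1))
    \<le> length xs + length ys + perm_length (q + 2) (star_word (q + 1) xs \<circ> star_word (q + 2) ys)"
    by (rule star_words_genus[OF x(1) y(1)])
  then show "2 * (card (set xs \<union> set ys) + (if set xs \<inter> set ys = {} then 0 else 1)) \<le> 2 * l + L"
    unfolding y(5) x(2) y(2) L_def using up(1)[OF comp] by simp
  have "2 * (card (set xs \<union> set []) + (if set xs \<inter> set [] = {} then 0 else 1))
    \<le> length xs + length ([] :: nat list) + perm_length (q + 2) (star_word (q + 1) xs \<circ> star_word (q + 2) [])"
    by (rule star_words_genus[OF x(1)]) simp
  then show "2 * card (set xs) \<le> l + perm_length q (star_word (Suc q) xs)"
    using up(1)[OF x(3)] x(2) by simp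
  have "perm_length (Suc q) (star_word (Suc q) zs) \<le> length zs" if "set zs \<subseteq> {1..q}" for zs
    by (rule perm_length_star_word_le) (use that in force)+
  from this[of xs] this[of "xs @ ys"] show "perm_length q (star_word (Suc q) xs) \<le> l" "L \<le> 2 * l"
    using x y up(2)[OF x(3)] up(2)[OF comp] unfolding L_def by (simp_all add: star_word_append)
qed

text \<open>One constant for all lengths: the summand 1 covers the identity, where the value is 1,
  and the sum dominates each \<open>c l\<close>.\<close>

lemma F_class_decay:
  assumes \<psi>: "\<psi> \<in> F_class n c \<delta> q" and q: "q \<ge> 1" and c: "\<And>l. l \<ge> 1 \<Longrightarrow> c l > 0"
    and \<rho>: "\<rho> \<in> sym_group q" and n: "perm_length q \<rho> \<le> n"
  shows "norm (\<psi> \<rho>) \<le> (1 + (\<Sum>l\<in>{1..n}. c l)) * real q powr (- real (perm_length q \<rho>) / 2)"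
proof (cases "perm_length q \<rho> = 0")
  case True
  then have "\<psi> \<rho> = 1" using perm_length_0[OF \<rho>] \<psi> unfolding F_class_def by auto
  moreover have "0 \<le> (\<Sum>l\<in>{1..n}. c l)" using c by (intro sum_nonneg less_imp_le) auto
  ultimately show ?thesis using True q by simp
next
  case False
  then have l: "perm_length q \<rho> \<in> {1..n}" using n by simp
  then have "norm (\<psi> \<rho>) \<le> c (perm_length q \<rho>) * real q powr (- real (perm_length q \<rho>) / 2)"
    using \<psi> \<rho> unfolding F_class_def by blast
  also have "\<dots> \<le> (1 + (\<Sum>l\<in>{1..n}. c l)) * real q powr (- real (perm_length q \<rho>) / 2)"
  proof (intro mult_right_mono)
    have "c (perm_length q \<rho>) \<le> (\<Sum>l\<in>{1..n}. c l)"
      using l c by (intro member_le_sum less_imp_le) auto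
    then show "c (perm_length q \<rho>) \<le> 1 + (\<Sum>l\<in>{1..n}. c l)" by simp
  qed simp
  finally show ?thesis .
qed

text \<open>Here \<open>b\<close> is a number of letters, and \<open>e\<close> records the
  additional gain, which is 1 when two words share a letter.\<close>

lemma powr_word_bound:
  assumes "q \<ge> 1" "2 * (b + e) \<le> 2 * l + L"
  shows "real q powr (- real L / 2) \<le> real q ^ l * (1 / real q) ^ b * (1 / real q) ^ e"
proof -
  have "real (2 * (b + e)) \<le> real (2 * l + L)" using assms(2) by (simp only: of_nat_le_iff)
  then have "- real L / 2 \<le> real l - real b - real e" by (simp add: field_simps)
  then have "real q powr (- real L / 2) \<le> real q powr (real l - real b - real e)"
    using assms(1) by (intro powr_mono) auto
  also have "\<dots> = real q ^ l * (1 / real q) ^ b * (1 / real q) ^ e"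
    using assms(1) by (simp add: powr_diff powr_realpow power_one_over divide_inverse power_inverse)
  finally show ?thesis .
qed

lemma covariance_term_bound:
  assumes \<psi>: "\<psi> \<in> F_class n c \<delta> q" and q: "q \<ge> 1" and c: "\<And>l. l \<ge> 1 \<Longrightarrow> c l > 0"
    and \<delta>: "\<delta> \<ge> 0" and n: "2 * l \<le> n"
    and xs: "xs \<in> good_words q l" and ys: "ys \<in> good_words q l"
  defines "C \<equiv> 1 + (\<Sum>l\<in>{1..n}. c l)"
    and "\<rho> \<equiv> star_word (Suc q) xs" and "\<sigma> \<equiv> star_word (Suc q) ys"
  shows "norm (\<psi> (\<rho> \<circ> \<sigma>) - \<psi> \<rho> * \<psi> \<sigma>) \<le>
    2 * C^2 * (\<delta> + 1 / real q) * (real q ^ l * (1 / real q) ^ card (set xs \<union> set ys))"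
proof -
  let ?b = "card (set xs \<union> set ys)" and ?A = "real q ^ l"
  let ?B = "?A * (1 / real q) ^ ?b"
  note x = good_word_facts[OF xs] and y = good_word_facts[OF ys]
  note lx = good_words_length_bounds[OF xs ys] and ly = good_words_length_bounds[OF ys xs]
  have "0 \<le> (\<Sum>l\<in>{1..n}. c l)" using c by (intro sum_nonneg less_imp_le) auto
  then have C: "C \<ge> 1" unfolding C_def by simp
  then have C2: "C \<le> C^2" "1 \<le> C^2" by (auto simp: power2_eq_square intro: order_trans[OF _ mult_mono[of 1 C 1 C]])
  have B: "?B \<ge> 0" by simp
  have rs: "\<rho> \<in> sym_group q" "\<sigma> \<in> sym_group q" "\<rho> \<circ> \<sigma> \<in> sym_group q"
    unfolding \<rho>_def \<sigma>_def using x(3) y(3) sym_group_comp by auto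
  show ?thesis
  proof (cases "set xs \<inter> set ys = {}")
    case True
    \<comment> \<open>Disjoint letters give disjoint supports, so approximate multiplicativity
      supplies the factor \<open>\<delta>\<close>.\<close>
    then have disj: "perm_support \<rho> \<inter> perm_support \<sigma> = {}" using x(4) y(4) unfolding \<rho>_def \<sigma>_def by blast
    have "perm_length q (\<rho> \<circ> \<sigma>) \<le> n" using lx(2) n unfolding \<rho>_def \<sigma>_def by simp
    then have "norm (\<psi> (\<rho> \<circ> \<sigma>) - \<psi> \<rho> * \<psi> \<sigma>) \<le> \<delta> * real q powr (- real (perm_length q (\<rho> \<circ> \<sigma>)) / 2)"
      using \<psi> rs disj unfolding F_class_def by blast
    also have "\<dots> \<le> \<delta> * (?B * (1 / real q) ^ 0)"
      using lx(1) True unfolding \<rho>_def[symmetric] \<sigma>_def[symmetric]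
      by (intro mult_left_mono[OF powr_word_bound[OF q] \<delta>]) simp
    also have "\<dots> \<le> 2 * C^2 * (\<delta> + 1 / real q) * ?B"
    proof -
      have "\<delta> \<le> 1 * (\<delta> + 1 / real q)" by simp
      also have "\<dots> \<le> 2 * C^2 * (\<delta> + 1 / real q)"
        using C2 \<delta> by (intro mult_right_mono) auto
      finally show ?thesis using mult_right_mono[OF _ B] by simp
    qed
    finally show ?thesis .
  next
    case False
    let ?D = "?B * (1 / real q) ^ 1"
    have D: "0 \<le> ?D" by simp
    have "norm (\<psi> (\<rho> \<circ> \<sigma>)) \<le> C * real q powr (- real (perm_length q (\<rho> \<circ> \<sigma>)) / 2)"
      unfolding C_def using lx(2) n unfolding \<rho>_def[symmetric] \<sigma>_def[symmetric]
      by (intro F_class_decay[OF \<psi> q c rs(3)]) auto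
    also have "\<dots> \<le> C * ?D"
      using lx(1) False C unfolding \<rho>_def[symmetric] \<sigma>_def[symmetric]
      by (intro mult_left_mono powr_word_bound[OF q]) auto
    finally have 1: "norm (\<psi> (\<rho> \<circ> \<sigma>)) \<le> C * ?D" .
    \<comment> \<open>With a shared letter no cancellation is used and both terms are small
      separately. For the product of the two values, the gain comes from the shared letters being
      counted twice when the bounds for the single words are added.\<close>
    have inter: "card (set xs \<inter> set ys) \<ge> 1" using False by (simp add: Suc_le_eq card_gt_0_iff)
    have "card (set xs) + card (set ys) = ?b + card (set xs \<inter> set ys)"
      by (rule card_Un_Int) auto
    then have b: "2 * (?b + 1) \<le> 2 * l + (perm_length q \<rho> + perm_length q \<sigma>)"
      using inter lx(3) ly(3) unfolding \<rho>_def[symmetric] \<sigma>_def[symmetric] by presburger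
    have "norm (\<psi> \<rho>) * norm (\<psi> \<sigma>) \<le> (C * real q powr (- real (perm_length q \<rho>) / 2)) *
        (C * real q powr (- real (perm_length q \<sigma>) / 2))"
      unfolding C_def using lx(4) ly(4) n C unfolding \<rho>_def[symmetric] \<sigma>_def[symmetric] C_def
      by (intro mult_mono F_class_decay[OF \<psi> q c] rs) auto
    also have "\<dots> = C^2 * real q powr (- real (perm_length q \<rho> + perm_length q \<sigma>) / 2)"
    proof -
      have "- real (perm_length q \<rho> + perm_length q \<sigma>) / 2 =
        - real (perm_length q \<rho>) / 2 + (- real (perm_length q \<sigma>) / 2)" by (simp add: field_simps)
      then show ?thesis by (simp only: powr_add) (simp add: power2_eq_square)
    qed
    also have "\<dots> \<le> C^2 * ?D"
      using b by (intro mult_left_mono powr_word_bound[OF q]) auto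
    finally have 2: "norm (\<psi> \<rho>) * norm (\<psi> \<sigma>) \<le> C^2 * ?D" .
    have "norm (\<psi> (\<rho> \<circ> \<sigma>) - \<psi> \<rho> * \<psi> \<sigma>) \<le> norm (\<psi> (\<rho> \<circ> \<sigma>)) + norm (\<psi> \<rho> * \<psi> \<sigma>)"
      by (rule norm_triangle_ineq4)
    also have "\<dots> \<le> C * ?D + C^2 * ?D" using 1 2 by (simp add: norm_mult)
    also have "\<dots> \<le> C^2 * ?D + C^2 * ?D"
      using mult_right_mono[OF C2(1) D] by linarith
    also have "\<dots> = 2 * C^2 * (1 / real q) * ?B" by simp
    also have "\<dots> \<le> 2 * C^2 * (\<delta> + 1 / real q) * ?B"
      using \<delta> B C2 by (intro mult_right_mono mult_left_mono) auto
    finally show ?thesis .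
  qed
qed

lemma sum_pairs_distinct_letters:
  assumes "q \<ge> 1"
  shows "(\<Sum>xs\<in>words q l. \<Sum>ys\<in>words q l. (1 / real q) ^ card (set xs \<union> set ys)) \<le> fact (2 * l)"
proof -
  have "(\<Sum>xs\<in>words q l. \<Sum>ys\<in>words q l. (1 / real q) ^ card (set xs \<union> set ys)) =
      (\<Sum>(xs, ys)\<in>words q l \<times> words q l. (1 / real q) ^ card (set xs \<union> set ys))"
    by (rule sum.cartesian_product)
  \<comment> \<open>Concatenation identifies pairs of words of length \<open>l\<close> with words of
    length \<open>2 * l\<close>.\<close>
  also have "\<dots> = (\<Sum>zs\<in>words q (2 * l). (1 / real q) ^ card (set zs))"
    by (rule sum.reindex_bij_witness[of _ "\<lambda>zs. (take l zs, drop l zs)" "\<lambda>(xs, ys). xs @ ys"])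
      (auto simp: words_def Un_def dest: in_set_takeD in_set_dropD)
  also have "\<dots> \<le> fact (2 * l)"
    unfolding words_def by (rule sum_words_distinct_letters[OF assms])
  finally show ?thesis .
qed

lemma moment_variance_bound:
  assumes \<psi>: "\<psi> \<in> F_class n c \<delta> q" and q: "q \<ge> 1" and c: "\<And>l. l \<ge> 1 \<Longrightarrow> c l > 0"
    and \<delta>: "\<delta> \<ge> 0" and n: "2 * l \<le> n"
  defines "C \<equiv> 1 + (\<Sum>l\<in>{1..n}. c l)"
  shows "(\<Sum>D\<in>young_diagrams q. weights q \<psi> D * (moment l D - mean_moment l q \<psi>)^2) \<le>
    2 * C^2 * fact n * (\<delta> + 1 / real q) * real q ^ l"
proof -
  let ?Y = "young_diagrams q" and ?w = "weights q \<psi>" and ?m = "mean_moment l q \<psi>"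
  let ?A = "moment_element q l" and ?W = "good_words q l" and ?\<pi> = "star_word (Suc q)"
  let ?E = "2 * C^2 * (\<delta> + 1 / real q)"
  have cpd: "central q \<psi>" "positive_definite q \<psi>" "\<psi> id = 1" using \<psi> unfolding F_class_def by auto
  have act: "acts_by D ?A (of_real (moment l D))" if "D \<in> ?Y" for D
    using acts_by_moment_element[OF that, of l] moment_fps_nth[OF that] by simp
  note exp = lin_expansion[OF weights_expansion[OF cpd]]
  note cen = center_alg[OF moment_element_center[of q l]]
  have mean: "of_real ?m = (\<Sum>xs\<in>?W. \<psi> (?\<pi> xs))"
    using exp[OF _ cen act] unfolding lin_moment_element_word mean_moment_def by simp
  have act2: "acts_by D (?A * ?A) (of_real (moment l D ^ 2))" if "D \<in> ?Y" for D
    using acts_by_mult[OF act[OF that] act[OF that]] by (simp add: power2_eq_square)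
  have square: "of_real (\<Sum>D\<in>?Y. ?w D * moment l D ^ 2) = (\<Sum>xs\<in>?W. \<Sum>ys\<in>?W. \<psi> (?\<pi> xs \<circ> ?\<pi> ys))"
    using exp[OF _ alg_mult[OF cen cen] act2] unfolding lin_moment_element_square by simp
  have "(\<Sum>D\<in>?Y. ?w D * (moment l D - ?m)^2) =
      (\<Sum>D\<in>?Y. ?w D * moment l D ^ 2) - 2 * ?m * (\<Sum>D\<in>?Y. ?w D * moment l D) + ?m^2 * (\<Sum>D\<in>?Y. ?w D)"
    by (simp add: power2_diff algebra_simps sum.distrib sum_subtractf sum_distrib_left)
      (simp add: sum_distrib_right)
  also have "\<dots> = (\<Sum>D\<in>?Y. ?w D * moment l D ^ 2) - ?m^2"
    unfolding weights_sum[OF cpd] mean_moment_def[symmetric] by (simp add: power2_eq_square)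
  finally have var: "(\<Sum>D\<in>?Y. ?w D * (moment l D - ?m)^2) = (\<Sum>D\<in>?Y. ?w D * moment l D ^ 2) - ?m^2" .
  have "complex_of_real ((\<Sum>D\<in>?Y. ?w D * moment l D ^ 2) - ?m^2) =
      (\<Sum>xs\<in>?W. \<Sum>ys\<in>?W. \<psi> (?\<pi> xs \<circ> ?\<pi> ys) - \<psi> (?\<pi> xs) * \<psi> (?\<pi> ys))"
    unfolding of_real_diff of_real_power square mean
    by (simp add: power2_eq_square sum_product sum_subtractf)
  note eq = arg_cong[OF this, of norm]
  have "\<bar>(\<Sum>D\<in>?Y. ?w D * moment l D ^ 2) - ?m^2\<bar> =
      norm (\<Sum>xs\<in>?W. \<Sum>ys\<in>?W. \<psi> (?\<pi> xs \<circ> ?\<pi> ys) - \<psi> (?\<pi> xs) * \<psi> (?\<pi> ys))"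
    unfolding eq[symmetric] norm_of_real ..
  also have "\<dots> \<le> (\<Sum>xs\<in>?W. \<Sum>ys\<in>?W. norm (\<psi> (?\<pi> xs \<circ> ?\<pi> ys) - \<psi> (?\<pi> xs) * \<psi> (?\<pi> ys)))"
    by (intro order_trans[OF norm_sum] sum_mono norm_sum)
  also have "\<dots> \<le> (\<Sum>xs\<in>?W. \<Sum>ys\<in>?W. ?E * (real q ^ l * (1 / real q) ^ card (set xs \<union> set ys)))"
    unfolding C_def by (intro sum_mono covariance_term_bound[OF \<psi> q c \<delta> n])
  also have "\<dots> \<le> (\<Sum>xs\<in>words q l. \<Sum>ys\<in>words q l. ?E * (real q ^ l * (1 / real q) ^ card (set xs \<union> set ys)))"
  proof -
    have sub: "?W \<subseteq> words q l" unfolding good_words_def by auto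
    have E: "0 \<le> ?E" using \<delta> by simp
    show ?thesis
      using E by (intro order_trans[OF sum_mono[OF sum_mono2[OF words_finite sub]] sum_mono2[OF words_finite sub]])
        (use \<delta> in \<open>auto intro!: sum_nonneg mult_nonneg_nonneg\<close>)
  qed
  also have "\<dots> = ?E * real q ^ l * (\<Sum>xs\<in>words q l. \<Sum>ys\<in>words q l. (1 / real q) ^ card (set xs \<union> set ys))"
    by (simp add: sum_distrib_left mult.assoc)
  \<comment> \<open>The factorial of \<open>2 * l\<close> is replaced by that of \<open>n\<close> to
    make the constant independent of \<open>l\<close>.\<close>
  also have "\<dots> \<le> ?E * real q ^ l * fact n"
  proof (intro mult_left_mono)
    have "(\<Sum>xs\<in>words q l. \<Sum>ys\<in>words q l. (1 / real q) ^ card (set xs \<union> set ys)) \<le> fact (2 * l)"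
      by (rule sum_pairs_distinct_letters[OF q])
    also have "\<dots> \<le> fact n" using n by (rule fact_mono)
    finally show "(\<Sum>xs\<in>words q l. \<Sum>ys\<in>words q l. (1 / real q) ^ card (set xs \<union> set ys)) \<le> fact n" .
  qed (use \<delta> in simp)
  finally show ?thesis unfolding var by (simp add: mult_ac)
qed

theorem theorem1:
  fixes c :: "nat \<Rightarrow> real" and n :: nat
  assumes "\<And>l. l \<ge> 1 \<Longrightarrow> c l > 0"
    and "n \<ge> 1"
  shows "\<exists>K :: real. \<forall>\<delta> \<ge> 0. \<forall>q \<ge> 1. \<forall>\<psi> \<in> F_class n c \<delta> q.
           supported_on q \<psi> ((\<delta> + 1 / real q) powr (1 / 2))
             {D \<in> young_diagrams q. \<forall>l :: nat. 1 \<le> l \<and> real l \<le> real n / 2 \<longrightarrow>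
                \<bar>moment l D - mean_moment l q \<psi>\<bar>
                  \<le> K * (\<delta> + 1 / real q) powr (1 / 4) * real q powr (real l / 2)}"
proof -
  \<comment> \<open>\<open>B\<close> is the constant of \<open>moment_variance_bound\<close>. In
    \<open>K\<close>, the factor \<open>n\<close> pays for the union over all admissible
    \<open>l\<close>, and the summand 1 makes the final inequality strict and \<open>K\<close>
    positive.\<close>
  define B where "B = 2 * (1 + (\<Sum>l\<in>{1..n}. c l))^2 * fact n"
  define K where "K = sqrt (real n * B + 1)"
  have "B \<ge> 0" unfolding B_def by simp
  then have K: "K > 0" "K^2 = real n * B + 1" unfolding K_def by (simp_all add: add_nonneg_pos)
  have main: "supported_on q \<psi> ((\<delta> + 1 / real q) powr (1 / 2))
      {D \<in> young_diagrams q. \<forall>l :: nat. 1 \<le> l \<and> real l \<le> real n / 2 \<longrightarrow>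
         \<bar>moment l D - mean_moment l q \<psi>\<bar>
           \<le> K * (\<delta> + 1 / real q) powr (1 / 4) * real q powr (real l / 2)}"
    if \<delta>: "\<delta> \<ge> 0" and q: "q \<ge> 1" and \<psi>: "\<psi> \<in> F_class n c \<delta> q" for \<delta> q \<psi>
  proof -
    define \<epsilon> where "\<epsilon> = \<delta> + 1 / real q"
    have \<epsilon>: "\<epsilon> > 0" unfolding \<epsilon>_def using \<delta> q by (intro add_nonneg_pos) auto
    let ?Y = "young_diagrams q" and ?w = "weights q \<psi>"
    let ?d = "\<lambda>l D. moment l D - mean_moment l q \<psi>"
    let ?I = "{l. 1 \<le> l \<and> 2 * l \<le> n}"
    let ?t = "\<lambda>l. K^2 * \<epsilon> powr (1 / 2) * real q ^ l"
    let ?V = "{D \<in> ?Y. \<forall>l :: nat. 1 \<le> l \<and> real l \<le> real n / 2 \<longrightarrow>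
         \<bar>?d l D\<bar> \<le> K * \<epsilon> powr (1 / 4) * real q powr (real l / 2)}"
    have cpd: "central q \<psi>" "positive_definite q \<psi>" "\<psi> id = 1" using \<psi> unfolding F_class_def by auto
    have w: "0 \<le> ?w D" for D by (rule weights_nonneg[OF cpd])
    have finI: "finite ?I" by (rule finite_subset[of _ "{1..n}"]) auto
    have cardI: "card ?I \<le> n" using card_mono[of "{1..n}" ?I] by fastforce
    have t: "?t l > 0" for l using K(1) \<epsilon> q by simp
    have sq: "(K * \<epsilon> powr (1 / 4) * real q powr (real l / 2))^2 = ?t l" for l
    proof -
      have "(\<epsilon> powr (1 / 4))^2 = \<epsilon> powr (1 / 2)"
        by (simp add: power2_eq_square powr_add[symmetric])
      moreover have "(real q powr (real l / 2))^2 = real q ^ l"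
        using q by (simp add: power2_eq_square powr_add[symmetric] powr_realpow)
      ultimately show ?thesis by (simp add: power_mult_distrib)
    qed
    \<comment> \<open>Chebyshev for all \<open>l\<close> at once: a violated inequality makes its
      own ratio at least 1, and the other ratios are nonnegative, so this sum dominates the
      indicator of the exceptional diagrams.\<close>
    have bad: "1 \<le> (\<Sum>l\<in>?I. ?d l D ^ 2 / ?t l)" if D: "D \<in> ?Y - ?V" for D
    proof -
      obtain l where l: "1 \<le> l" "real l \<le> real n / 2"
        "\<bar>?d l D\<bar> > K * \<epsilon> powr (1 / 4) * real q powr (real l / 2)" using D by force
      then have "?t l \<le> ?d l D ^ 2"
        unfolding sq[symmetric] using K(1) by (intro abs_le_square_iff[THEN iffD1]) simp
      then have "1 \<le> ?d l D ^ 2 / ?t l" using t[of l] by simp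
      also have "\<dots> \<le> (\<Sum>l\<in>?I. ?d l D ^ 2 / ?t l)"
        using l finI less_imp_le[OF t] by (intro member_le_sum) auto
      finally show ?thesis .
    qed
    have "(\<Sum>D\<in>?Y - ?V. ?w D) \<le> (\<Sum>D\<in>?Y - ?V. ?w D * (\<Sum>l\<in>?I. ?d l D ^ 2 / ?t l))"
      using mult_left_mono[OF bad w] by (intro sum_mono) simp
    also have "\<dots> \<le> (\<Sum>D\<in>?Y. ?w D * (\<Sum>l\<in>?I. ?d l D ^ 2 / ?t l))"
      using w less_imp_le[OF t] finite_young_diagrams[of q]
      by (intro sum_mono2) (auto intro!: mult_nonneg_nonneg sum_nonneg)
    also have "\<dots> = (\<Sum>l\<in>?I. (\<Sum>D\<in>?Y. ?w D * ?d l D ^ 2) / ?t l)"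
      unfolding sum_distrib_left sum_divide_distrib by (subst sum.swap) simp
    also have "\<dots> \<le> (\<Sum>l\<in>?I. B / K^2 * \<epsilon> powr (1 / 2))"
    proof (intro sum_mono)
      fix l assume l: "l \<in> ?I"
      have "(\<Sum>D\<in>?Y. ?w D * ?d l D ^ 2) \<le> B * \<epsilon> * real q ^ l"
        using moment_variance_bound[OF \<psi> q assms(1) \<delta>, of l] l unfolding B_def \<epsilon>_def by simp
      then have "(\<Sum>D\<in>?Y. ?w D * ?d l D ^ 2) / ?t l \<le> B * \<epsilon> * real q ^ l / ?t l"
        using less_imp_le[OF t] by (rule divide_right_mono)
      also have "\<dots> = B / K^2 * (\<epsilon> / \<epsilon> powr (1 / 2))" using q by (simp add: field_simps)
      also have "\<epsilon> / \<epsilon> powr (1 / 2) = \<epsilon> powr (1 / 2)"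
      proof -
        have "\<epsilon> powr (1 / 2) * \<epsilon> powr (1 / 2) = \<epsilon>" using \<epsilon> by (simp add: powr_add[symmetric])
        then show ?thesis using \<epsilon> by (metis nonzero_mult_div_cancel_right powr_eq_0_iff less_irrefl)
      qed
      finally show "(\<Sum>D\<in>?Y. ?w D * ?d l D ^ 2) / ?t l \<le> B / K^2 * \<epsilon> powr (1 / 2)" .
    qed
    also have "\<dots> = (real (card ?I) * B) / K^2 * \<epsilon> powr (1 / 2)" by simp
    \<comment> \<open>At most \<open>n\<close> values of \<open>l\<close> occur, and n B / K^2 < 1
      by the choice of \<open>K\<close>.\<close>
    also have "\<dots> < 1 * \<epsilon> powr (1 / 2)"
    proof (rule mult_strict_right_mono)
      have "real (card ?I) * B \<le> real n * B" using cardI \<open>B \<ge> 0\<close> by (intro mult_right_mono) auto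
      then show "real (card ?I) * B / K^2 < 1" using K(2) \<open>B \<ge> 0\<close> by (simp add: divide_less_eq add_nonneg_pos)
    qed (use \<epsilon> in simp)
    finally have "(\<Sum>D\<in>?Y - ?V. ?w D) < \<epsilon> powr (1 / 2)" by simp
    moreover have "(\<Sum>D\<in>?Y. ?w D) = (\<Sum>D\<in>?Y - ?V. ?w D) + (\<Sum>D\<in>?V. ?w D)"
      using finite_young_diagrams[of q] by (intro sum.subset_diff) auto
    ultimately have "(\<Sum>D\<in>?V. ?w D) > 1 - \<epsilon> powr (1 / 2)"
      using weights_sum[OF cpd] by linarith
    then show ?thesis unfolding supported_on_def diagram_prob_def \<epsilon>_def .
  qed
  show ?thesis
    by (intro exI[of _ K] allI impI ballI main)
qed

end
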